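(* Let $G$ and $H$ be groups and let $G_1=G*H$ be their free product. Then $G_1$ is lacunary hyperbolic if and only if $G$ and $H$ are synchronized LH.
   Context: Hyperbolicity function: let $(X,d)$ be a geodesic metric space. For $t\ge 0$ let $S_t$ be the set of all geodesic triangles in $X$ of perimeter at most $t$. For a geodesic triangle $\triangle$, let $\delta_\triangle$ be the supremum, over all points $p$ lying on a side of $\triangle$, of the distance from $p$ to the union of the other two sides. The hyperbolicity function $f_X:[0,\infty)\to[0,\infty)$ is $f_X(t)=\sup_{\triangle\in S_t}\delta_\triangle$. For a group $G$ with a finite generating set, $f_G$ denotes the hyperbolicity function of the corresponding Cayley graph. Asymptotic cone: given a metric space $(X,D)$, a non-principal ultrafilter $\omega$ on $\mathbb{N}$, a non-decreasing sequence $l=(l_n)$ of positive reals tending to infinity, and a sequence $e=(e_n)$ of points of $X$, the asymptotic cone $\mathrm{Con}^\omega(X,e,l)$ is the set of sequences $(g_n)$ in $X$ with $D(e_n,g_n)/l_n$ bounded, modulo identification of $(f_n)$ and $(g_n)$ when $\lim^\omega D(f_n,g_n)/l_n=0$, with metric $\lim^\omega D(f_n,g_n)/l_n$. A finitely generated group is lacunary hyperbolic if its Cayley graph with respect to a finite generating set has at least one asymptotic cone that is an $\mathbb{R}$-tree. Synchronized LH: lacunary hyperbolic groups $G_1,\dots,G_k$ are called synchronized LH if there exist an increasing sequence $(x_j)_{j\in\mathbb{N}}$ of real numbers tending to infinity and finite generating sets $X_i$ of $G_i$ for all $i$ such that the hyperbolicity functions $f_{G_i}$ with respect to $X_i$ satisfy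 $\lim_{j\to\infty} f_{G_i}(x_j)/x_j=0$ for all $i=1,\dots,k$; equivalently, $\liminf_{t\to\infty}\frac{1}{t}\sum_{i=1}^k f_{G_i}(t)=0$ for these generating sets. *)

theory Defs
  imports "HOL-Analysis.Analysis" "HOL-Algebra.Generated_Groups"
begin

section \<open>Free products of groups\<close>

text \<open>
  The elements of the free product are the reduced words: alternating lists of nontrivial
  elements of the two factors. Two words are multiplied by concatenation followed by reduction.
\<close>

definition reduced_words ::
    "('a, 'c) monoid_scheme \<Rightarrow> ('b, 'd) monoid_scheme \<Rightarrow> ('a + 'b) list set" where
  "reduced_words G H =
    {w. set w \<subseteq> Inl ` (carrier G - {\<one>\<^bsub>G\<^esub>}) \<union> Inr ` (carrier H - {\<one>\<^bsub>H\<^esub>})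
        \<and> successively (\<lambda>x y. isl x \<noteq> isl y) w}"

text \<open>\<open>fp_cons G H x w\<close> is the reduced form of \<open>x # w\<close>, for \<open>x\<close> nontrivial and \<open>w\<close> reduced.\<close>

fun fp_cons ::
    "('a, 'c) monoid_scheme \<Rightarrow> ('b, 'd) monoid_scheme \<Rightarrow> 'a + 'b \<Rightarrow> ('a + 'b) list \<Rightarrow> ('a + 'b) list" where
  "fp_cons G H (Inl a) (Inl b # w) =
     (if a \<otimes>\<^bsub>G\<^esub> b = \<one>\<^bsub>G\<^esub> then w else Inl (a \<otimes>\<^bsub>G\<^esub> b) # w)"
| "fp_cons G H (Inr a) (Inr b # w) =
     (if a \<otimes>\<^bsub>H\<^esub> b = \<one>\<^bsub>H\<^esub> then w else Inr (a \<otimes>\<^bsub>H\<^esub> b) # w)"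
| "fp_cons G H x w = x # w"

definition free_product ::
    "('a, 'c) monoid_scheme \<Rightarrow> ('b, 'd) monoid_scheme \<Rightarrow> ('a + 'b) list monoid" where
  "free_product G H =
    \<lparr>carrier = reduced_words G H, mult = (\<lambda>u v. foldr (fp_cons G H) u v), one = []\<rparr>"

section \<open>Geometric realizations of graphs and Cayley graphs\<close>

text \<open>
  A simple graph is given by its vertex set \<open>V\<close> and a symmetric, irreflexive edge relation \<open>E\<close>.
  Points of the geometric realization are given by barycentric coordinates: the point dividing
  the edge \<open>u v\<close> in the ratio \<open>t : 1 - t\<close> is the function with value \<open>1 - t\<close> at \<open>u\<close>, \<open>t\<close> at \<open>v\<close>,
  and \<open>0\<close> elsewhere. The vertex \<open>u\<close> itself is \<open>edge_point u u 0\<close>.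
\<close>

definition edge_point :: "'a \<Rightarrow> 'a \<Rightarrow> real \<Rightarrow> 'a \<Rightarrow> real" where
  "edge_point u v t = (\<lambda>w. (1 - t) * of_bool (w = u) + t * of_bool (w = v))"

definition graph_points :: "'a set \<Rightarrow> ('a \<times> 'a) set \<Rightarrow> ('a \<Rightarrow> real) set" where
  "graph_points V E =
     {edge_point u v t | u v t. u \<in> V \<and> v \<in> V \<and> (u = v \<or> (u, v) \<in> E) \<and> 0 \<le> t \<and> t \<le> 1}"

definition supp :: "('a \<Rightarrow> real) \<Rightarrow> 'a set" where
  "supp p = {w. p w \<noteq> 0}"

definition vertex_dist :: "('a \<times> 'a) set \<Rightarrow> 'a \<Rightarrow> 'a \<Rightarrow> nat" where
  "vertex_dist E u v = (LEAST n. (u, v) \<in> E ^^ n)"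

definition on_common_edge :: "('a \<times> 'a) set \<Rightarrow> ('a \<Rightarrow> real) \<Rightarrow> ('a \<Rightarrow> real) \<Rightarrow> bool" where
  "on_common_edge E p q \<longleftrightarrow>
     (\<exists>u v. (u = v \<or> (u, v) \<in> E) \<and> supp p \<subseteq> {u, v} \<and> supp q \<subseteq> {u, v})"

text \<open>
  The path metric for which every edge is isometric to the unit interval. For points on a common
  edge it is the difference of their coordinates on that edge; any other path leaves the edge of
  \<open>p\<close> through an end \<open>u\<close>, at distance \<open>1 - p u\<close> from \<open>p\<close>, and reaches \<open>q\<close> through an end \<open>v\<close> of
  its edge. The value \<open>0\<close> off the graph is a dummy, needed as the locale \<open>Metric_space\<close>
  asks for nonnegativity and symmetry of the distance function on the whole type.
\<close>

definition graph_dist ::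
    "'a set \<Rightarrow> ('a \<times> 'a) set \<Rightarrow> ('a \<Rightarrow> real) \<Rightarrow> ('a \<Rightarrow> real) \<Rightarrow> real" where
  "graph_dist V E p q =
    (if p \<notin> graph_points V E \<or> q \<notin> graph_points V E then 0
     else if on_common_edge E p q then Max ((\<lambda>w. \<bar>p w - q w\<bar>) ` (supp p \<union> supp q))
     else Min ((\<lambda>(u, v). (1 - p u) + real (vertex_dist E u v) + (1 - q v)) ` (supp p \<times> supp q)))"

definition finite_generating_set :: "('a, 'c) monoid_scheme \<Rightarrow> 'a set \<Rightarrow> bool" where
  "finite_generating_set G X \<longleftrightarrow> finite X \<and> X \<subseteq> carrier G \<and> generate G X = carrier G"

definition cayley_edges :: "('a, 'c) monoid_scheme \<Rightarrow> 'a set \<Rightarrow> ('a \<times> 'a) set" where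
  "cayley_edges G X =
    {(g, h). g \<in> carrier G \<and> h \<in> carrier G \<and> g \<noteq> h \<and>
             (\<exists>x\<in>X. h = g \<otimes>\<^bsub>G\<^esub> x \<or> g = h \<otimes>\<^bsub>G\<^esub> x)}"

definition cayley_graph :: "('a, 'c) monoid_scheme \<Rightarrow> 'a set \<Rightarrow> ('a \<Rightarrow> real) set" where
  "cayley_graph G X = graph_points (carrier G) (cayley_edges G X)"

definition cayley_dist ::
    "('a, 'c) monoid_scheme \<Rightarrow> 'a set \<Rightarrow> ('a \<Rightarrow> real) \<Rightarrow> ('a \<Rightarrow> real) \<Rightarrow> real" where
  "cayley_dist G X = graph_dist (carrier G) (cayley_edges G X)"

section \<open>Geodesic triangles and the hyperbolicity function\<close>

definition geodesic_segment ::
    "'a set \<Rightarrow> ('a \<Rightarrow> 'a \<Rightarrow> real) \<Rightarrow> 'a \<Rightarrow> 'a \<Rightarrow> 'a set \<Rightarrow> bool" where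
  "geodesic_segment M d x y S \<longleftrightarrow>
    (\<exists>c. c 0 = x \<and> c (d x y) = y \<and> c ` {0..d x y} = S \<and> S \<subseteq> M \<and>
         (\<forall>s\<in>{0..d x y}. \<forall>t\<in>{0..d x y}. d (c s) (c t) = \<bar>s - t\<bar>))"

text \<open>A geodesic triangle is represented by the triple of its sides. The vertices may coincide.\<close>

definition geodesic_triangles ::
    "'a set \<Rightarrow> ('a \<Rightarrow> 'a \<Rightarrow> real) \<Rightarrow> real \<Rightarrow> ('a set \<times> 'a set \<times> 'a set) set" where
  "geodesic_triangles M d t =
    {(A, B, C). \<exists>x\<in>M. \<exists>y\<in>M. \<exists>z\<in>M.
       geodesic_segment M d x y A \<and> geodesic_segment M d y z B \<and> geodesic_segment M d z x C \<and>
       d x y + d y z + d z x \<le> t}"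

definition dist_to_set :: "('a \<Rightarrow> 'a \<Rightarrow> real) \<Rightarrow> 'a \<Rightarrow> 'a set \<Rightarrow> real" where
  "dist_to_set d p S = (INF q\<in>S. d p q)"

fun triangle_delta :: "('a \<Rightarrow> 'a \<Rightarrow> real) \<Rightarrow> 'a set \<times> 'a set \<times> 'a set \<Rightarrow> real" where
  "triangle_delta d (A, B, C) =
     Sup ((\<lambda>p. dist_to_set d p (B \<union> C)) ` A \<union>
          (\<lambda>p. dist_to_set d p (A \<union> C)) ` B \<union>
          (\<lambda>p. dist_to_set d p (A \<union> B)) ` C)"

text \<open>
  In a nonempty metric space, for \<open>t \<ge> 0\<close>, all suprema below are taken over nonempty sets of reals
  bounded by \<open>0\<close> and \<open>t\<close>. Values at negative \<open>t\<close> are irrelevant.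
\<close>

definition hyperbolicity_function :: "'a set \<Rightarrow> ('a \<Rightarrow> 'a \<Rightarrow> real) \<Rightarrow> real \<Rightarrow> real" where
  "hyperbolicity_function M d t = (SUP T\<in>geodesic_triangles M d t. triangle_delta d T)"

definition group_hyperbolicity_function ::
    "('a, 'c) monoid_scheme \<Rightarrow> 'a set \<Rightarrow> real \<Rightarrow> real" where
  "group_hyperbolicity_function G X = hyperbolicity_function (cayley_graph G X) (cayley_dist G X)"

section \<open>Asymptotic cones and real trees\<close>

definition nonprincipal_ultrafilter :: "nat filter \<Rightarrow> bool" where
  "nonprincipal_ultrafilter \<omega> \<longleftrightarrow>
     \<omega> \<noteq> bot \<and> (\<forall>P. eventually P \<omega> \<or> eventually (\<lambda>n. \<not> P n) \<omega>) \<and> (\<forall>n. \<omega> \<noteq> principal {n})"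

definition scaling_sequence :: "(nat \<Rightarrow> real) \<Rightarrow> bool" where
  "scaling_sequence l \<longleftrightarrow> mono l \<and> (\<forall>n. 0 < l n) \<and> filterlim l at_top sequentially"

definition cone_sequences ::
    "'a set \<Rightarrow> ('a \<Rightarrow> 'a \<Rightarrow> real) \<Rightarrow> (nat \<Rightarrow> 'a) \<Rightarrow> (nat \<Rightarrow> real) \<Rightarrow> (nat \<Rightarrow> 'a) set" where
  "cone_sequences M d e l = {g. (\<forall>n. g n \<in> M) \<and> Bseq (\<lambda>n. d (e n) (g n) / l n)}"

definition cone_rel ::
    "'a set \<Rightarrow> ('a \<Rightarrow> 'a \<Rightarrow> real) \<Rightarrow> nat filter \<Rightarrow> (nat \<Rightarrow> 'a) \<Rightarrow> (nat \<Rightarrow> real) \<Rightarrow>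
      ((nat \<Rightarrow> 'a) \<times> (nat \<Rightarrow> 'a)) set" where
  "cone_rel M d \<omega> e l =
    {(f, g). f \<in> cone_sequences M d e l \<and> g \<in> cone_sequences M d e l \<and>
             ((\<lambda>n. d (f n) (g n) / l n) \<longlongrightarrow> 0) \<omega>}"

definition asymptotic_cone ::
    "'a set \<Rightarrow> ('a \<Rightarrow> 'a \<Rightarrow> real) \<Rightarrow> nat filter \<Rightarrow> (nat \<Rightarrow> 'a) \<Rightarrow> (nat \<Rightarrow> real) \<Rightarrow>
      (nat \<Rightarrow> 'a) set set" where
  "asymptotic_cone M d \<omega> e l = cone_sequences M d e l // cone_rel M d \<omega> e l"

text \<open>As for \<open>graph_dist\<close>, the value \<open>0\<close> outside the cone is a dummy.\<close>

definition cone_dist ::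
    "'a set \<Rightarrow> ('a \<Rightarrow> 'a \<Rightarrow> real) \<Rightarrow> nat filter \<Rightarrow> (nat \<Rightarrow> 'a) \<Rightarrow> (nat \<Rightarrow> real) \<Rightarrow>
      (nat \<Rightarrow> 'a) set \<Rightarrow> (nat \<Rightarrow> 'a) set \<Rightarrow> real" where
  "cone_dist M d \<omega> e l F G =
    (if F \<in> asymptotic_cone M d \<omega> e l \<and> G \<in> asymptotic_cone M d \<omega> e l
     then THE r. \<forall>f\<in>F. \<forall>g\<in>G. ((\<lambda>n. d (f n) (g n) / l n) \<longlongrightarrow> r) \<omega>
     else 0)"

definition arc_between ::
    "'a set \<Rightarrow> ('a \<Rightarrow> 'a \<Rightarrow> real) \<Rightarrow> 'a \<Rightarrow> 'a \<Rightarrow> 'a set \<Rightarrow> bool" where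
  "arc_between M d x y A \<longleftrightarrow>
    (\<exists>c :: real \<Rightarrow> 'a. continuous_map (top_of_set {0..1}) (Metric_space.mtopology M d) c \<and>
        inj_on c {0..1} \<and> c 0 = x \<and> c 1 = y \<and> c ` {0..1} = A)"

text \<open>A real tree is a geodesic metric space in which distinct points are joined by only one arc.\<close>

definition real_tree :: "'a set \<Rightarrow> ('a \<Rightarrow> 'a \<Rightarrow> real) \<Rightarrow> bool" where
  "real_tree M d \<longleftrightarrow>
     Metric_space M d \<and>
     (\<forall>x\<in>M. \<forall>y\<in>M. \<exists>S. geodesic_segment M d x y S) \<and>
     (\<forall>x\<in>M. \<forall>y\<in>M. \<forall>A B. arc_between M d x y A \<longrightarrow> arc_between M d x y B \<longrightarrow> A = B)"

section \<open>Lacunary hyperbolic groups\<close>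

definition lacunary_hyperbolic :: "('a, 'c) monoid_scheme \<Rightarrow> bool" where
  "lacunary_hyperbolic G \<longleftrightarrow>
    (\<exists>X. finite_generating_set G X \<and>
      (\<exists>\<omega> e l. nonprincipal_ultrafilter \<omega> \<and> scaling_sequence l \<and>
               (\<forall>n. e n \<in> cayley_graph G X) \<and>
               real_tree (asymptotic_cone (cayley_graph G X) (cayley_dist G X) \<omega> e l)
                         (cone_dist (cayley_graph G X) (cayley_dist G X) \<omega> e l)))"

text \<open>Two groups only: the factors may have different types, so they do not form a family.\<close>

definition synchronized_LH :: "('a, 'c) monoid_scheme \<Rightarrow> ('b, 'd) monoid_scheme \<Rightarrow> bool" where
  "synchronized_LH G H \<longleftrightarrow>
     lacunary_hyperbolic G \<and> lacunary_hyperbolic H \<and>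
     (\<exists>(x :: nat \<Rightarrow> real) X Y.
        strict_mono x \<and> filterlim x at_top sequentially \<and>
        finite_generating_set G X \<and> finite_generating_set H Y \<and>
        (\<lambda>j. group_hyperbolicity_function G X (x j) / x j) \<longlonglongrightarrow> 0 \<and>
        (\<lambda>j. group_hyperbolicity_function H Y (x j) / x j) \<longlonglongrightarrow> 0)"

end

theory Submission
  imports Defs
begin

text \<open>
  If the cone of \<open>G * H\<close> along \<open>\<omega>\<close> with scaling \<open>l\<close> is a real tree, then so are the cones of the
  retracts \<open>G\<close> and \<open>H\<close>, for the images of the generating set under the retractions: they are
  geodesic and embed into it by a bi-Lipschitz map, and uniqueness of arcs is a topological property.
  Limits of geodesic triangles in a real tree being degenerate, \<open>f\<^sub>G(l\<^sub>n)/l\<^sub>n\<close> and \<open>f\<^sub>H(l\<^sub>n)/l\<^sub>n\<close> tend to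
  \<open>0\<close> along the same \<open>\<omega>\<close>, hence along a common sequence.

  Conversely, slim triangles of perimeter up to \<open>x\<^sub>j\<close> in \<open>G\<close> and \<open>H\<close> give the four-point inequality for
  Gromov products, with error \<open>o(x\<^sub>j)\<close>. It passes to \<open>G * H\<close>, as the Gromov product of two
  reduced words is the length of their common prefix plus the product of the next two letters, if
  these are in the same factor. At a scale growing slightly slower than \<open>x\<^sub>j\<close> the cone of \<open>G * H\<close> then
  satisfies the four-point inequality without error, and a geodesic space with this property has
  unique arcs.
\<close>

text \<open>Neither direction compares two generating sets of one group: the retracts use images of
  the given generators, and \<open>G * H\<close> uses the union of the given generators of the
  factors, for which length is additive along reduced words. A retraction sends generators to
  generators, so it does not increase distances; this is what leaves the factors undistorted.

  Fat triangles in a factor may sit far from the base points of the cone. Homogeneity of the Cayley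
  graph repairs this, but translations act here on vertices only, so points are rounded to vertices
  throughout. The errors are bounded, and cones do not see them.

  The free product is reached through four points rather than through triangles because Gromov
  products involve only distances of vertices, for which there is an exact formula. The error does
  not grow with the number of letters: a common first letter adds the same amount to all three
  products. The scale must be slower than \<open>x j\<close> because four points of the cone are at
  distance \<open>B * l n\<close> with \<open>B\<close> unknown; a factor \<open>n + 1\<close>
  between the scales eventually exceeds every such \<open>B\<close>.\<close>

section \<open>Limits along ultrafilters\<close>

text \<open>Cluster points of an ultrafilter are limits: if some member of \<open>F\<close> were
  missing from the image, its complement would be there, and the two filters would have disjoint
  members.\<close>

lemma ultrafilter_le_cases:
  fixes \<omega> :: "'a filter"
  assumes u: "\<And>P. eventually P \<omega> \<or> eventually (\<lambda>n. \<not> P n) \<omega>" and "inf F (filtermap f \<omega>) \<noteq> bot"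
  shows "filtermap f \<omega> \<le> F"
proof (rule filter_leI)
  fix P assume P: "eventually P F"
  show "eventually P (filtermap f \<omega>)"
  proof (rule ccontr)
    assume "\<not> ?thesis"
    with u have "eventually (\<lambda>x. \<not> P x) (filtermap f \<omega>)"
      unfolding eventually_filtermap by blast
    with P have "eventually (\<lambda>x. False) (inf F (filtermap f \<omega>))"
      unfolding eventually_inf by blast
    with assms(2) show False by (simp add: trivial_limit_def)
  qed
qed

lemma ultrafilter_convergent:
  fixes h :: "'a \<Rightarrow> real"
  assumes ne: "\<omega> \<noteq> bot" and u: "\<And>P. eventually P \<omega> \<or> eventually (\<lambda>n. \<not> P n) \<omega>"
    and bd: "eventually (\<lambda>n. \<bar>h n\<bar> \<le> B) \<omega>"
  shows "\<exists>r. (h \<longlongrightarrow> r) \<omega>"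
proof -
  have "compact {-B..B}" by (rule compact_Icc)
  moreover have "filtermap h \<omega> \<noteq> bot" using ne by (simp add: filtermap_bot_iff)
  moreover have "eventually (\<lambda>x. x \<in> {-B..B}) (filtermap h \<omega>)"
    unfolding eventually_filtermap by (rule eventually_mono[OF bd]) (simp add: abs_le_iff)
  ultimately obtain r where "inf (nhds r) (filtermap h \<omega>) \<noteq> bot"
    unfolding compact_filter by blast
  then have "filtermap h \<omega> \<le> nhds r" by (rule ultrafilter_le_cases[OF u])
  then show ?thesis unfolding filterlim_def by blast
qed

text \<open>An ultrafilter containing a singleton is principal, so nonprincipality discards every
  single index and hence every finite set. Ordinary limits therefore persist along \<omega>.\<close>

lemma nonprincipal_ultrafilter_le_sequentially:
  assumes "nonprincipal_ultrafilter \<omega>" shows "\<omega> \<le> sequentially"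
proof (rule filter_leI)
  have ne: "\<omega> \<noteq> bot" and u: "\<And>P. eventually P \<omega> \<or> eventually (\<lambda>n. \<not> P n) \<omega>"
    and np: "\<And>n. \<omega> \<noteq> principal {n}"
    using assms unfolding nonprincipal_ultrafilter_def by auto
  have neq: "eventually (\<lambda>n. n \<noteq> i) \<omega>" for i
  proof (rule ccontr)
    assume "\<not> ?thesis"
    with u[of "\<lambda>n. n \<noteq> i"] have ev: "eventually (\<lambda>n. n = i) \<omega>" by auto
    have "\<omega> = principal {i}"
    proof (rule antisym)
      show "\<omega> \<le> principal {i}" using ev by (simp add: le_principal)
      show "principal {i} \<le> \<omega>"
      proof (rule filter_leI)
        fix P assume "eventually P \<omega>"
        with ev have "eventually (\<lambda>n. P i) \<omega>" by eventually_elim auto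
        with ne have "P i" by (auto simp: eventually_const_iff)
        then show "eventually P (principal {i})" by (simp add: eventually_principal)
      qed
    qed
    with np show False by blast
  qed
  fix P :: "nat \<Rightarrow> bool" assume "eventually P sequentially"
  then obtain N where N: "\<And>n. n \<ge> N \<Longrightarrow> P n" unfolding eventually_sequentially by blast
  have "eventually (\<lambda>n. \<forall>i\<in>{..<N}. n \<noteq> i) \<omega>"
    by (rule eventually_ball_finite) (use neq in auto)
  then show "eventually P \<omega>"
  proof (rule eventually_mono)
    fix n assume "\<forall>i\<in>{..<N}. n \<noteq> i"
    then have "\<not> n < N" by auto
    then show "P n" by (intro N) simp
  qed
qed

text \<open>A finest proper filter below \<open>sequentially\<close> decides every \<open>P\<close>:
  if \<open>P\<close> is compatible with the filter, adjoining it changes nothing. Lying below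
  \<open>sequentially\<close> keeps the filter from being principal.\<close>

lemma ex_nonprincipal_ultrafilter: "\<exists>\<omega>. nonprincipal_ultrafilter \<omega>"
proof -
  define A where "A = {F :: nat filter. F \<noteq> bot \<and> F \<le> sequentially}"
  \<comment> \<open>The order is reversed, so that maximal elements are finest filters and the upper
    bound of a chain is its infimum.\<close>
  define r where "r = {(F, F'). F \<in> A \<and> F' \<in> A \<and> F' \<le> F}"
  have fld: "Field r = A" unfolding r_def Field_def by auto
  have "\<exists>m\<in>Field r. \<forall>a\<in>Field r. (m, a) \<in> r \<longrightarrow> a = m"
  proof (rule Zorns_po_lemma)
    show "Partial_order r"
      unfolding partial_order_on_def preorder_on_def fld
      by (auto simp: r_def refl_on_def trans_def antisym_def)
    fix C assume C: "C \<in> Chains r"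
    show "\<exists>u\<in>Field r. \<forall>a\<in>C. (a, u) \<in> r"
    proof (cases "C = {}")
      case True
      have "sequentially \<in> A" by (simp add: A_def)
      with True show ?thesis unfolding fld by blast
    next
      case False
      have CA: "C \<subseteq> A" using C unfolding Chains_def r_def by auto
      \<comment> \<open>Members of a chain are comparable, so the infimum is proper as soon as each
        member is.\<close>
      have base: "\<exists>x\<in>C. x \<le> inf F F'" if "F \<in> C" "F' \<in> C" for F F'
        using C that unfolding Chains_def r_def by (auto intro: le_infI)
      have "\<not> eventually (\<lambda>_. False) F" if "F \<in> C" for F
        using CA that unfolding A_def by (auto simp: trivial_limit_def)
      then have "\<not> eventually (\<lambda>_. False) (Inf C)"
        using eventually_Inf_base[OF False base] by blast
      then have "Inf C \<noteq> bot" by (auto simp: trivial_limit_def)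
      moreover have "Inf C \<le> sequentially"
        proof -
        obtain F where "F \<in> C" using False by blast
        then show ?thesis using CA unfolding A_def by (intro Inf_lower2[of F]) auto
      qed
      ultimately have "Inf C \<in> A" by (simp add: A_def)
      then show ?thesis unfolding fld
        using CA by (intro bexI[of _ "Inf C"]) (auto simp: r_def intro: Inf_lower)
    qed
  qed
  then obtain \<omega> where w: "\<omega> \<in> A" and max: "\<And>F. F \<in> A \<Longrightarrow> F \<le> \<omega> \<Longrightarrow> F = \<omega>"
    unfolding fld unfolding r_def by auto
  have "eventually P \<omega> \<or> eventually (\<lambda>n. \<not> P n) \<omega>" for P
  proof (cases "inf \<omega> (principal (Collect P)) = bot")
    case True
    then have "eventually (\<lambda>n. False) (inf \<omega> (principal (Collect P)))" by simp
    then show ?thesis unfolding eventually_inf_principal by simp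
  next
    case False
    have "inf \<omega> (principal (Collect P)) \<in> A"
      using False w unfolding A_def by (auto intro: le_infI1)
    then have "inf \<omega> (principal (Collect P)) = \<omega>" by (rule max) simp
    moreover have "eventually P (inf \<omega> (principal (Collect P)))"
      by (simp add: eventually_inf_principal)
    ultimately show ?thesis by simp
  qed
  moreover have "\<omega> \<noteq> principal {n}" for n
  proof
    assume eq: "\<omega> = principal {n}"
    have "eventually (\<lambda>m. m > n) sequentially" by (rule eventually_gt_at_top)
    then have "eventually (\<lambda>m. m > n) \<omega>" using w unfolding A_def by (auto simp: le_filter_def)
    then show False unfolding eq by (simp add: eventually_principal)
  qed
  ultimately show ?thesis using w unfolding nonprincipal_ultrafilter_def A_def by blast
qed

section \<open>Asymptotic cones of coarse metric spaces\<close>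

text \<open>
  Cones do not see bounded errors, so the axioms of a metric are required only up to a
  constant. This spares us the triangle inequality for \<open>graph_dist\<close>.
\<close>

locale coarse_space =
  fixes M :: "'a set" and d :: "'a \<Rightarrow> 'a \<Rightarrow> real" and K :: real
  assumes nonneg: "0 \<le> d x y"
    and refl: "x \<in> M \<Longrightarrow> d x x \<le> K"
    and sym: "x \<in> M \<Longrightarrow> y \<in> M \<Longrightarrow> d x y \<le> d y x + K"
    and triangle: "x \<in> M \<Longrightarrow> y \<in> M \<Longrightarrow> z \<in> M \<Longrightarrow> d x z \<le> d x y + d y z + K"

locale coarse_cone = coarse_space +
  fixes \<omega> :: "nat filter" and e :: "nat \<Rightarrow> 'a" and l :: "nat \<Rightarrow> real"
  assumes ultra: "nonprincipal_ultrafilter \<omega>" and scale: "scaling_sequence l"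
    and base: "\<And>n. e n \<in> M"
begin

abbreviation "\<S> \<equiv> cone_sequences M d e l"
abbreviation "\<C> \<equiv> asymptotic_cone M d \<omega> e l"
abbreviation "\<D> \<equiv> cone_dist M d \<omega> e l"

definition pt :: "(nat \<Rightarrow> 'a) \<Rightarrow> (nat \<Rightarrow> 'a) set" where "pt f = cone_rel M d \<omega> e l `` {f}"

definition ld :: "(nat \<Rightarrow> 'a) \<Rightarrow> (nat \<Rightarrow> 'a) \<Rightarrow> real" where
  "ld f g = Lim \<omega> (\<lambda>n. d (f n) (g n) / l n)"

lemma ne: "\<omega> \<noteq> bot" and u: "eventually P \<omega> \<or> eventually (\<lambda>n. \<not> P n) \<omega>"
  using ultra unfolding nonprincipal_ultrafilter_def by auto

lemma lpos: "0 < l n" and l_mono: "mono l" and l_top: "filterlim l at_top sequentially"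
  using scale unfolding scaling_sequence_def by auto

lemma le_seq: "\<omega> \<le> sequentially"
  by (rule nonprincipal_ultrafilter_le_sequentially[OF ultra])

lemma l_top_ultra: "filterlim l at_top \<omega>"
  using l_top le_seq by (rule filterlim_mono[OF _ order_refl])

lemma const_over_l: "((\<lambda>n. c / l n) \<longlongrightarrow> 0) \<omega>"
  by (rule real_tendsto_divide_at_top[OF tendsto_const l_top_ultra])

text \<open>As \<open>l n\<close> is at least \<open>l 0\<close>, additive constants can be absorbed
  into multiples of the scale, uniformly in \<open>n\<close>.\<close>

lemma const_le_l: "c \<le> \<bar>c\<bar> / l 0 * l n"
proof -
  have "l 0 \<le> l n" using l_mono by (simp add: monoD)
  then have "\<bar>c\<bar> * l 0 \<le> \<bar>c\<bar> * l n" by (rule mult_left_mono) simp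
  moreover have "c * l 0 \<le> \<bar>c\<bar> * l 0" using lpos[of 0] by (intro mult_right_mono) auto
  ultimately have "c * l 0 \<le> \<bar>c\<bar> * l n" by linarith
  then show ?thesis using lpos[of 0] by (simp add: field_simps)
qed

lemma seq_iff: "f \<in> \<S> \<longleftrightarrow> (\<forall>n. f n \<in> M) \<and> (\<exists>B. \<forall>n. d (e n) (f n) \<le> B * l n)"
proof -
  have "Bseq (\<lambda>n. d (e n) (f n) / l n) \<longleftrightarrow> (\<exists>B. \<forall>n. d (e n) (f n) \<le> B * l n)"
  proof
    assume "Bseq (\<lambda>n. d (e n) (f n) / l n)"
    then obtain B where B: "\<And>n. norm (d (e n) (f n) / l n) \<le> B" unfolding Bseq_def by blast
    have "d (e n) (f n) \<le> B * l n" for n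
      using B[of n] lpos[of n] nonneg[of "e n" "f n"] by (simp add: field_simps)
    then show "\<exists>B. \<forall>n. d (e n) (f n) \<le> B * l n" by blast
  next
    assume "\<exists>B. \<forall>n. d (e n) (f n) \<le> B * l n"
    then obtain B where B: "\<And>n. d (e n) (f n) \<le> B * l n" by blast
    show "Bseq (\<lambda>n. d (e n) (f n) / l n)"
    proof (rule BseqI')
      fix n show "norm (d (e n) (f n) / l n) \<le> B"
        using B[of n] lpos[of n] nonneg[of "e n" "f n"] by (simp add: field_simps)
    qed
  qed
  then show ?thesis unfolding cone_sequences_def by simp
qed

lemma seqI:
  assumes "\<And>n. f n \<in> M" "\<And>n. d (e n) (f n) \<le> B * l n + c"
  shows "f \<in> \<S>"
proof -
  have "d (e n) (f n) \<le> (B + \<bar>c\<bar> / l 0) * l n" for n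
    using assms(2)[of n] const_le_l[of c n] by (simp add: distrib_right)
  then show ?thesis unfolding seq_iff using assms(1) by blast
qed

lemma seq_in: "f \<in> \<S> \<Longrightarrow> f n \<in> M" by (simp add: seq_iff)

lemma base_seq: "e \<in> \<S>"
  by (rule seqI[where B=0 and c=K]) (use refl base in auto)

lemma seq_dist_bound:
  assumes "f \<in> \<S>" "g \<in> \<S>" shows "\<exists>B\<ge>0. \<forall>n. d (f n) (g n) \<le> B * l n"
proof -
  obtain B C where B: "\<And>n. d (e n) (f n) \<le> B * l n" and C: "\<And>n. d (e n) (g n) \<le> C * l n"
    using assms unfolding seq_iff by blast
  have "d (f n) (g n) \<le> \<bar>B + C + \<bar>2 * K\<bar> / l 0\<bar> * l n" for n
  proof -
    have "d (f n) (g n) \<le> d (f n) (e n) + d (e n) (g n) + K"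
      using assms by (intro triangle base seq_in)
    moreover have "d (f n) (e n) \<le> d (e n) (f n) + K" using assms by (intro sym base seq_in)
    ultimately have "d (f n) (g n) \<le> B * l n + C * l n + 2 * K" using B[of n] C[of n] by simp
    also have "\<dots> \<le> (B + C + \<bar>2 * K\<bar> / l 0) * l n"
      using const_le_l[of "2 * K" n] by (simp add: distrib_right)
    also have "\<dots> \<le> \<bar>B + C + \<bar>2 * K\<bar> / l 0\<bar> * l n" using lpos[of n] by (simp add: mult_right_mono)
    finally show ?thesis .
  qed
  then show ?thesis by (intro exI[of _ "\<bar>B + C + \<bar>2 * K\<bar> / l 0\<bar>"]) auto
qed

lemma near_seq:
  assumes "f \<in> \<S>" "\<And>n. g n \<in> M" "\<And>n. d (f n) (g n) \<le> B * l n + c"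
  shows "g \<in> \<S>"
proof -
  obtain C where C: "\<And>n. d (e n) (f n) \<le> C * l n" using assms unfolding seq_iff by blast
  show ?thesis
  proof (rule seqI[OF assms(2)])
    fix n
    have "d (e n) (g n) \<le> d (e n) (f n) + d (f n) (g n) + K"
      using assms(2) seq_in[OF assms(1)] by (intro triangle base)
    with C[of n] assms(3)[of n] show "d (e n) (g n) \<le> (C + B) * l n + (c + K)"
      by (simp add: distrib_right)
  qed
qed

lemma ld_lim: assumes "f \<in> \<S>" "g \<in> \<S>" shows "((\<lambda>n. d (f n) (g n) / l n) \<longlongrightarrow> ld f g) \<omega>"
proof -
  obtain B where B: "\<And>n. d (f n) (g n) \<le> B * l n" using seq_dist_bound[OF assms] by blast
  have "\<bar>d (f n) (g n) / l n\<bar> \<le> B" for n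
    using B[of n] nonneg[of "f n" "g n"] lpos[of n] by (simp add: field_simps)
  then obtain r where r: "((\<lambda>n. d (f n) (g n) / l n) \<longlongrightarrow> r) \<omega>"
    using ultrafilter_convergent[OF ne u, of "\<lambda>n. d (f n) (g n) / l n" B] by auto
  show ?thesis unfolding ld_def using r tendsto_Lim[OF _ r] ne by auto
qed

lemma ld_eqI: "((\<lambda>n. d (f n) (g n) / l n) \<longlongrightarrow> r) \<omega> \<Longrightarrow> ld f g = r"
  unfolding ld_def by (rule tendsto_Lim) (use ne in auto)

lemma ld_nonneg: assumes "f \<in> \<S>" "g \<in> \<S>" shows "0 \<le> ld f g"
  using tendsto_lowerbound[OF ld_lim[OF assms], of 0] nonneg lpos ne
  by (simp add: less_imp_le)

text \<open>Errors of the form \<open>c / l n\<close> vanish in the limit. This is how each coarse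
  axiom becomes an exact one in the cone.\<close>

lemma lim_le:
  assumes "(a \<longlongrightarrow> x) \<omega>" "(b \<longlongrightarrow> y) \<omega>" "eventually (\<lambda>n. a n \<le> b n + c / l n) \<omega>"
  shows "x \<le> y"
proof -
  have "((\<lambda>n. b n + c / l n) \<longlongrightarrow> y + 0) \<omega>" by (intro tendsto_add assms const_over_l)
  from tendsto_le[OF ne this assms(1) assms(3)] show ?thesis by simp
qed

lemma ld_refl: assumes "f \<in> \<S>" shows "ld f f = 0"
proof -
  have "ld f f \<le> 0"
  proof (rule lim_le[OF ld_lim[OF assms assms] tendsto_const[of 0], of K])
    show "eventually (\<lambda>n. d (f n) (f n) / l n \<le> 0 + K / l n) \<omega>"
      using refl seq_in[OF assms] lpos by (intro always_eventually) (simp add: divide_right_mono less_imp_le)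
  qed
  with ld_nonneg[OF assms assms] show ?thesis by simp
qed

lemma ld_sym_le: assumes "f \<in> \<S>" "g \<in> \<S>" shows "ld f g \<le> ld g f"
proof (rule lim_le[OF ld_lim[OF assms] ld_lim[OF assms(2,1)], of K])
  show "eventually (\<lambda>n. d (f n) (g n) / l n \<le> d (g n) (f n) / l n + K / l n) \<omega>"
    using sym[OF seq_in[OF assms(1)] seq_in[OF assms(2)]] lpos
    by (intro always_eventually allI) (simp add: divide_right_mono less_imp_le flip: add_divide_distrib)
qed

lemma ld_sym: assumes "f \<in> \<S>" "g \<in> \<S>" shows "ld f g = ld g f"
  using ld_sym_le assms by (meson antisym)

lemma ld_triangle:
  assumes "f \<in> \<S>" "g \<in> \<S>" "h \<in> \<S>" shows "ld f h \<le> ld f g + ld g h"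
proof (rule lim_le[OF ld_lim[OF assms(1,3)] tendsto_add[OF ld_lim[OF assms(1,2)] ld_lim[OF assms(2,3)]], of K])
  show "eventually (\<lambda>n. d (f n) (h n) / l n \<le> d (f n) (g n) / l n + d (g n) (h n) / l n + K / l n) \<omega>"
    using triangle[OF seq_in[OF assms(1)] seq_in[OF assms(2)] seq_in[OF assms(3)]] lpos
    by (intro always_eventually allI) (simp add: divide_right_mono less_imp_le flip: add_divide_distrib)
qed

lemma mem_rel: "(f, g) \<in> cone_rel M d \<omega> e l \<longleftrightarrow> f \<in> \<S> \<and> g \<in> \<S> \<and> ld f g = 0"
  unfolding cone_rel_def using ld_lim ld_eqI by (auto; metis)

lemma mem_pt: "f \<in> \<S> \<Longrightarrow> g \<in> pt f \<longleftrightarrow> g \<in> \<S> \<and> ld f g = 0"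
  unfolding pt_def by (simp add: mem_rel)

lemma cone_eq: "\<C> = pt ` \<S>"
  unfolding asymptotic_cone_def quotient_def pt_def by auto

lemma pt_in: "f \<in> \<S> \<Longrightarrow> pt f \<in> \<C>" by (simp add: cone_eq)

lemma cone_E: assumes "F \<in> \<C>" obtains f where "f \<in> \<S>" "F = pt f" using assms by (auto simp: cone_eq)

lemma dist_pt: assumes f: "f \<in> \<S>" and g: "g \<in> \<S>" shows "\<D> (pt f) (pt g) = ld f g"
proof -
  have eq: "ld f' g' = ld f g" if "f' \<in> pt f" "g' \<in> pt g" for f' g'
  proof -
    have h: "f' \<in> \<S>" "ld f f' = 0" "g' \<in> \<S>" "ld g g' = 0" using that mem_pt f g by auto
    then show ?thesis
      using ld_triangle[of f' f g'] ld_triangle[of f g g'] ld_triangle[of f f' g] ld_triangle[of f' g' g]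
        ld_sym[of f f'] ld_sym[of g g'] f g by simp
  qed
  have sub: "f' \<in> \<S>" "g' \<in> \<S>" if "f' \<in> pt f" "g' \<in> pt g" for f' g' using that mem_pt f g by auto
  have mem: "f \<in> pt f" "g \<in> pt g" using f g ld_refl mem_pt by auto
  have "(THE r. \<forall>f\<in>pt f. \<forall>g\<in>pt g. ((\<lambda>n. d (f n) (g n) / l n) \<longlongrightarrow> r) \<omega>) = ld f g"
  proof (rule the_equality)
    show "\<forall>f'\<in>pt f. \<forall>g'\<in>pt g. ((\<lambda>n. d (f' n) (g' n) / l n) \<longlongrightarrow> ld f g) \<omega>"
      using ld_lim sub eq by metis
    show "r = ld f g" if "\<forall>f\<in>pt f. \<forall>g\<in>pt g. ((\<lambda>n. d (f n) (g n) / l n) \<longlongrightarrow> r) \<omega>" for r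
      using ld_eqI that mem by metis
  qed
  then show ?thesis unfolding cone_dist_def using pt_in f g by simp
qed

lemma pt_eq_iff: assumes f: "f \<in> \<S>" and g: "g \<in> \<S>" shows "pt f = pt g \<longleftrightarrow> ld f g = 0"
proof
  assume "pt f = pt g"
  then show "ld f g = 0" using f g mem_pt ld_refl by metis
next
  assume 0: "ld f g = 0"
  have "ld f h = 0 \<longleftrightarrow> ld g h = 0" if "h \<in> \<S>" for h
    using ld_triangle[of f g h] ld_triangle[of g f h] ld_nonneg[of f h] ld_nonneg[of g h] 0 f g that ld_sym[OF f g]
    by auto
  then show "pt f = pt g" using mem_pt[OF f] mem_pt[OF g] by blast
qed

lemma metric: "Metric_space \<C> \<D>"
proof
  show "0 \<le> \<D> x y" for x y
  proof (cases "x \<in> \<C> \<and> y \<in> \<C>")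
    case True then show ?thesis by (auto elim!: cone_E simp: dist_pt ld_nonneg)
  next
    case False then show ?thesis by (auto simp: cone_dist_def)
  qed
  show "\<D> x y = \<D> y x" for x y
  proof (cases "x \<in> \<C> \<and> y \<in> \<C>")
    case True then show ?thesis by (auto elim!: cone_E simp: dist_pt ld_sym)
  next
    case False then show ?thesis by (auto simp: cone_dist_def)
  qed
  show "\<D> x y = 0 \<longleftrightarrow> x = y" if "x \<in> \<C>" "y \<in> \<C>" for x y
    using that by (elim cone_E) (simp add: dist_pt pt_eq_iff)
  show "\<D> x z \<le> \<D> x y + \<D> y z" if "x \<in> \<C>" "y \<in> \<C>" "z \<in> \<C>" for x y z
    using that by (auto elim!: cone_E simp: dist_pt ld_triangle)
qed

end

sublocale coarse_cone \<subseteq> cone: Metric_space "asymptotic_cone M d \<omega> e l" "cone_dist M d \<omega> e l"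
  by (rule metric)

context coarse_cone
begin

definition limit_path :: "(nat \<Rightarrow> real \<Rightarrow> 'a) \<Rightarrow> (nat \<Rightarrow> real) \<Rightarrow> real \<Rightarrow> (nat \<Rightarrow> 'a) set" where
  "limit_path c L s = pt (\<lambda>n. c n (min (s * l n) (L n)))"

text \<open>
  Paths of length \<open>L n\<close> that are isometric up to \<open>C\<close> converge to a path of length \<open>\<Lambda>\<close>; the
  \<open>min\<close> is needed because \<open>\<Lambda> * l n\<close> may exceed \<open>L n\<close>.
\<close>

lemma
  assumes c: "\<And>n s. 0 \<le> s \<Longrightarrow> s \<le> L n \<Longrightarrow> c n s \<in> M"
    and iso: "\<And>n s t. 0 \<le> s \<Longrightarrow> s \<le> L n \<Longrightarrow> 0 \<le> t \<Longrightarrow> t \<le> L n \<Longrightarrow> \<bar>d (c n s) (c n t) - \<bar>s - t\<bar>\<bar> \<le> C"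
    and L0: "\<And>n. 0 \<le> L n" and start: "(\<lambda>n. c n 0) \<in> \<S>" and \<Lambda>: "((\<lambda>n. L n / l n) \<longlongrightarrow> \<Lambda>) \<omega>"
  shows limit_path_seq: "(\<And>n. 0 \<le> v n) \<Longrightarrow> (\<And>n. v n \<le> L n) \<Longrightarrow> (\<And>n. v n \<le> B * l n) \<Longrightarrow> (\<lambda>n. c n (v n)) \<in> \<S>"
    and limit_path_in: "0 \<le> s \<Longrightarrow> limit_path c L s \<in> \<C>"
    and limit_path_dist: "0 \<le> s \<Longrightarrow> s \<le> \<Lambda> \<Longrightarrow> 0 \<le> t \<Longrightarrow> t \<le> \<Lambda> \<Longrightarrow>
          \<D> (limit_path c L s) (limit_path c L t) = \<bar>s - t\<bar>"
    and limit_path_0: "limit_path c L 0 = pt (\<lambda>n. c n 0)"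
    and limit_path_eq: "(\<And>n. 0 \<le> v n) \<Longrightarrow> (\<And>n. v n \<le> L n) \<Longrightarrow> (\<And>n. v n \<le> B * l n) \<Longrightarrow>
          ((\<lambda>n. v n / l n) \<longlongrightarrow> t) \<omega> \<Longrightarrow> limit_path c L t = pt (\<lambda>n. c n (v n))"
proof -
  show seq: "(\<lambda>n. c n (s n)) \<in> \<S>" if "\<And>n. 0 \<le> s n" "\<And>n. s n \<le> L n" "\<And>n. s n \<le> b * l n" for s b
  proof (rule near_seq[OF start])
    fix n show "c n (s n) \<in> M" using c that by simp
    have "d (c n 0) (c n (s n)) \<le> \<bar>0 - s n\<bar> + C"
      using iso[of 0 n "s n"] that(1,2)[of n] L0[of n] by linarith
    with that(1,3)[of n] show "d (c n 0) (c n (s n)) \<le> b * l n + C" by linarith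
  qed
  have seq': "(\<lambda>n. c n (min (s * l n) (L n))) \<in> \<S>" if "0 \<le> s" for s
    by (rule seq[OF _ _ min.cobounded1]) (use that lpos L0 in \<open>auto simp: less_imp_le\<close>)
  show "limit_path c L s \<in> \<C>" if "0 \<le> s" for s
    unfolding limit_path_def using seq'[OF that] by (rule pt_in)
  have lim: "((\<lambda>n. min (s * l n) (L n) / l n) \<longlongrightarrow> min s \<Lambda>) \<omega>" for s
  proof -
    have "((\<lambda>n. min s (L n / l n)) \<longlongrightarrow> min s \<Lambda>) \<omega>" by (intro tendsto_min tendsto_const \<Lambda>)
    moreover have "min s (L n / l n) = min (s * l n) (L n) / l n" for n
      using lpos[of n] by (auto simp: min_def field_simps)
    ultimately show ?thesis by simp
  qed
  \<comment> \<open>Only the limits of the rescaled parameters matter. This gives the distances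
    along the limit path and also lets other parameter sequences represent its points.\<close>
  have gen: "ld (\<lambda>n. c n (v n)) (\<lambda>n. c n (w n)) = \<bar>s - t\<bar>"
    if v: "\<And>n. 0 \<le> v n" "\<And>n. v n \<le> L n" and w: "\<And>n. 0 \<le> w n" "\<And>n. w n \<le> L n"
      and vs: "((\<lambda>n. v n / l n) \<longlongrightarrow> s) \<omega>" and wt: "((\<lambda>n. w n / l n) \<longlongrightarrow> t) \<omega>" for v w s t
  proof (rule ld_eqI)
    have main: "((\<lambda>n. \<bar>v n / l n - w n / l n\<bar>) \<longlongrightarrow> \<bar>s - t\<bar>) \<omega>" by (intro tendsto_intros vs wt)
    have "((\<lambda>n. d (c n (v n)) (c n (w n)) / l n - \<bar>v n / l n - w n / l n\<bar>) \<longlongrightarrow> 0) \<omega>"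
    proof (rule Lim_null_comparison[OF _ const_over_l[of C]])
      have "\<bar>d (c n (v n)) (c n (w n)) / l n - \<bar>v n / l n - w n / l n\<bar>\<bar> \<le> C / l n" for n
      proof -
        have "d (c n (v n)) (c n (w n)) / l n - \<bar>v n / l n - w n / l n\<bar>
            = (d (c n (v n)) (c n (w n)) - \<bar>v n - w n\<bar>) / l n"
          using lpos[of n] by (simp add: diff_divide_distrib[symmetric] abs_divide)
        then show ?thesis
          using iso[OF v(1,2) w(1,2), of n] lpos[of n] by (simp add: abs_divide divide_right_mono)
      qed
      then show "eventually (\<lambda>n. norm (d (c n (v n)) (c n (w n)) / l n - \<bar>v n / l n - w n / l n\<bar>) \<le> C / l n) \<omega>"
        by simp
    qed
    from tendsto_add[OF this main] show "((\<lambda>n. d (c n (v n)) (c n (w n)) / l n) \<longlongrightarrow> \<bar>s - t\<bar>) \<omega>" by simp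
  qed
  show "\<D> (limit_path c L s) (limit_path c L t) = \<bar>s - t\<bar>" if "0 \<le> s" "s \<le> \<Lambda>" "0 \<le> t" "t \<le> \<Lambda>" for s t
    unfolding limit_path_def using that
    by (subst dist_pt[OF seq' seq']) (auto intro!: gen lim[THEN tendsto_eq_rhs] simp: L0 lpos less_imp_le)
  show "limit_path c L 0 = pt (\<lambda>n. c n 0)" unfolding limit_path_def by (simp add: L0 min_absorb1)
  show "limit_path c L t = pt (\<lambda>n. c n (v n))"
    if v: "\<And>n. 0 \<le> v n" "\<And>n. v n \<le> L n" "\<And>n. v n \<le> B * l n" and vt: "((\<lambda>n. v n / l n) \<longlongrightarrow> t) \<omega>" for v B t
  proof -
    have t0: "0 \<le> t" using tendsto_lowerbound[OF vt, of 0] v(1) lpos ne by (simp add: less_imp_le)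
    have tL: "t \<le> \<Lambda>"
      by (rule tendsto_le[OF ne \<Lambda> vt]) (use v(2) lpos in \<open>simp add: divide_right_mono less_imp_le\<close>)
    have "ld (\<lambda>n. c n (min (t * l n) (L n))) (\<lambda>n. c n (v n)) = \<bar>min t \<Lambda> - t\<bar>"
      by (rule gen[OF _ _ v(1,2) lim vt]) (use t0 L0 lpos in \<open>auto simp: less_imp_le\<close>)
    with tL show ?thesis unfolding limit_path_def
      using pt_eq_iff[OF seq'[OF t0] seq[OF v]] by simp
  qed
qed

end

section \<open>Real trees\<close>

context Metric_space
begin

section \<open>Lipschitz paths and arcs\<close>

lemma Lipschitz_real_continuous_map:
  fixes f :: "real \<Rightarrow> 'a"
  assumes "\<And>s. s \<in> T \<Longrightarrow> f s \<in> M" and L: "\<And>s t. s \<in> T \<Longrightarrow> t \<in> T \<Longrightarrow> d (f s) (f t) \<le> L * \<bar>s - t\<bar>"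
  shows "continuous_map (top_of_set T) mtopology f"
  unfolding continuous_map_to_metric
proof (intro ballI allI impI)
  fix s \<epsilon> :: real assume "s \<in> topspace (top_of_set T)" and \<epsilon>: "0 < \<epsilon>"
  then have s: "s \<in> T" by simp
  define \<eta> where "\<eta> = \<epsilon> / (\<bar>L\<bar> + 1)"
  have \<eta>: "0 < \<eta>" using \<epsilon> by (simp add: \<eta>_def)
  show "\<exists>U. openin (top_of_set T) U \<and> s \<in> U \<and> (\<forall>y\<in>U. f y \<in> mball (f s) \<epsilon>)"
  proof (intro exI[of _ "T \<inter> ball s \<eta>"] conjI ballI)
    show "openin (top_of_set T) (T \<inter> ball s \<eta>)" by (simp add: openin_open_Int)
    show "s \<in> T \<inter> ball s \<eta>" using s \<eta> by simp
    fix t assume t: "t \<in> T \<inter> ball s \<eta>"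
    then have "d (f s) (f t) \<le> L * \<bar>s - t\<bar>" using L s by simp
    also have "\<dots> \<le> (\<bar>L\<bar> + 1) * \<bar>s - t\<bar>" by (intro mult_right_mono) auto
    also have "\<dots> < (\<bar>L\<bar> + 1) * \<eta>" using t by (intro mult_strict_left_mono) (auto simp: dist_real_def)
    also have "\<dots> = \<epsilon>" by (simp add: \<eta>_def)
    finally show "f t \<in> mball (f s) \<epsilon>" using assms(1) s t by simp
  qed
qed

lemma arc_between_Lipschitz:
  assumes L: "0 < L" and f: "\<And>s. 0 \<le> s \<Longrightarrow> s \<le> L \<Longrightarrow> f s \<in> M"
    and lip: "\<And>s t. 0 \<le> s \<Longrightarrow> s \<le> t \<Longrightarrow> t \<le> L \<Longrightarrow> d (f s) (f t) \<le> t - s"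
    and inj: "\<And>s t. 0 \<le> s \<Longrightarrow> s < t \<Longrightarrow> t \<le> L \<Longrightarrow> f s \<noteq> f t"
  shows "arc_between M d (f 0) (f L) (f ` {0..L})"
  unfolding arc_between_def
proof (intro exI[of _ "\<lambda>t. f (L * t)"] conjI)
  have r: "0 \<le> L * t \<and> L * t \<le> L" if "t \<in> {0..1}" for t using that L by (auto simp: mult_left_le)
  have "d (f (L * s)) (f (L * t)) \<le> L * \<bar>s - t\<bar>" if "s \<in> {0..1}" "t \<in> {0..1}" for s t
  proof (cases "s \<le> t")
    case True then show ?thesis using lip[of "L * s" "L * t"] r that L by (simp add: algebra_simps)
  next
    case False then show ?thesis using lip[of "L * t" "L * s"] r that L
      by (simp add: algebra_simps commute[of "f (L * s)"])
  qed
  then show "continuous_map (top_of_set {0..1}) mtopology (\<lambda>t. f (L * t))"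
    by (intro Lipschitz_real_continuous_map) (use f r in auto)
  show "inj_on (\<lambda>t. f (L * t)) {0..1}"
  proof (rule linorder_inj_onI')
    fix s t :: real assume "s \<in> {0..1}" "t \<in> {0..1}" "s < t"
    then show "f (L * s) \<noteq> f (L * t)" using inj[of "L * s" "L * t"] r L by simp
  qed
  have "(\<lambda>t. L * t) ` {0..1} = {0..L}" using L by (simp add: image_mult_atLeastAtMost)
  then show "(\<lambda>t. f (L * t)) ` {0..1} = f ` {0..L}" by (metis image_image)
qed auto

lemma arc_between_geodesic:
  assumes "0 < L" and "\<And>s. 0 \<le> s \<Longrightarrow> s \<le> L \<Longrightarrow> f s \<in> M"
    and iso: "\<And>s t. 0 \<le> s \<Longrightarrow> s \<le> L \<Longrightarrow> 0 \<le> t \<Longrightarrow> t \<le> L \<Longrightarrow> d (f s) (f t) = \<bar>s - t\<bar>"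
  shows "arc_between M d (f 0) (f L) (f ` {0..L})"
proof (rule arc_between_Lipschitz[OF assms(1,2)])
  show "f s \<noteq> f t" if "0 \<le> s" "s < t" "t \<le> L" for s t using iso[of s t] assms(2)[of s] that by force
qed (use iso in auto)

text \<open>
  If a path from \<open>x\<close> to \<open>y\<close> avoided a point \<open>p\<close> of a geodesic from \<open>x\<close> to \<open>y\<close>, then the points
  with positive Gromov product with \<open>x\<close> at \<open>p\<close> and the other points different from \<open>p\<close> would
  disconnect the path.
\<close>

lemma four_point_path_contains_segment:
  assumes four: "\<And>w x y z. w \<in> M \<Longrightarrow> x \<in> M \<Longrightarrow> y \<in> M \<Longrightarrow> z \<in> M \<Longrightarrow>
        min (d w x + d w y - d x y) (d w y + d w z - d y z) \<le> d w x + d w z - d x z"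
    and A: "connectedin mtopology A" "x \<in> A" "y \<in> A" and p: "p \<in> M" "d x p + d p y = d x y"
  shows "p \<in> A"
proof (rule ccontr)
  assume pA: "p \<notin> A"
  have AM: "A \<subseteq> M" using A(1) connectedin_subset_topspace by fastforce
  \<comment> \<open>Twice the Gromov product at \<open>p\<close>. It vanishes on \<open>x\<close>
    and \<open>y\<close> because \<open>p\<close> lies between them, which puts \<open>y\<close>
    into \<open>V\<close> below.\<close>
  define g where "g q q' = d p q + d p q' - d q q'" for q q'
  have four': "min (g x y) (g y z) \<le> g x z" if "x \<in> M" "y \<in> M" "z \<in> M" for x y z
    using four[OF p(1) that] by (simp add: g_def)
  define U where "U = {q \<in> M. q \<noteq> p \<and> 0 < g x q}"
  define V where "V = {q \<in> M. q \<noteq> p \<and> g x q \<le> 0}"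
  \<comment> \<open>Points nearer to \<open>q\<close> than \<open>p\<close> is have positive product
    with \<open>q\<close>. By the four-point inequality the ball of radius \<open>d p q\<close>
    around \<open>q\<close> then stays in whichever of \<open>U\<close> and \<open>V\<close>
    contains \<open>q\<close>, so both are open.\<close>
  have near: "q' \<noteq> p \<and> 0 < g q q' \<and> 0 < g q' q" if "q \<in> M" "q' \<in> M" "d q q' < d p q" for q q'
  proof -
    have "q' \<noteq> p" using that by (auto simp: commute)
    moreover from this have "0 < d p q'" using that p by auto
    ultimately show ?thesis using that by (simp add: g_def commute[of q'])
  qed
  have pos: "0 < d p q" if "q \<in> M" "q \<noteq> p" for q using that p by auto
  have x: "x \<in> M" "x \<noteq> p" and y: "y \<in> M" "y \<noteq> p" using A AM pA by auto
  have "openin mtopology U"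
    unfolding openin_mtopology
  proof (intro conjI allI impI)
    fix q assume q: "q \<in> U"
    show "\<exists>r>0. mball q r \<subseteq> U"
    proof (intro exI[of _ "d p q"] conjI subsetI)
      show "0 < d p q" using q pos by (auto simp: U_def)
      fix q' assume "q' \<in> mball q (d p q)"
      then have "q' \<in> M" "q' \<noteq> p \<and> 0 < g q q' \<and> 0 < g q' q" "q \<in> M" using near by auto
      then show "q' \<in> U" using four'[of x q q'] x q by (auto simp: U_def)
    qed
  qed (auto simp: U_def)
  moreover have "openin mtopology V"
    unfolding openin_mtopology
  proof (intro conjI allI impI)
    fix q assume q: "q \<in> V"
    show "\<exists>r>0. mball q r \<subseteq> V"
    proof (intro exI[of _ "d p q"] conjI subsetI)
      show "0 < d p q" using q pos by (auto simp: V_def)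
      fix q' assume "q' \<in> mball q (d p q)"
      then have "q' \<in> M" "q' \<noteq> p \<and> 0 < g q q' \<and> 0 < g q' q" "q \<in> M" using near by auto
      then show "q' \<in> V" using four'[of x q' q] x q by (auto simp: V_def)
    qed
  qed (auto simp: V_def)
  moreover have "A \<subseteq> U \<union> V" using AM pA by (auto simp: U_def V_def)
  moreover have "U \<inter> V \<inter> A = {}" by (auto simp: U_def V_def)
  moreover have "x \<in> U" using x pos[OF x] by (simp add: U_def g_def)
  moreover have "y \<in> V" using y p by (simp add: V_def g_def commute)
  ultimately show False using A unfolding connectedin by blast
qed

text \<open>The segment lies on the arc by the preceding lemma. Conversely, a point \<open>q\<close>
  cuts the arc into two closed pieces which by injectivity share only \<open>q\<close>; the
  connected segment is covered by them and meets both, so it meets their intersection.\<close>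

lemma four_point_arc_eq_segment:
  assumes four: "\<And>w x y z. w \<in> M \<Longrightarrow> x \<in> M \<Longrightarrow> y \<in> M \<Longrightarrow> z \<in> M \<Longrightarrow>
        min (d w x + d w y - d x y) (d w y + d w z - d y z) \<le> d w x + d w z - d x z"
    and A: "arc_between M d x y A" and S: "geodesic_segment M d x y S"
  shows "A = S"
proof
  obtain c :: "real \<Rightarrow> _" where c: "continuous_map (top_of_set {0..1}) mtopology c" "inj_on c {0..1}"
    "c 0 = x" "c 1 = y" "c ` {0..1} = A"
    using A[unfolded arc_between_def] by (elim exE conjE)
  obtain g where g: "g 0 = x" "g (d x y) = y" "g ` {0..d x y} = S" "S \<subseteq> M"
    and iso: "\<And>s t. s \<in> {0..d x y} \<Longrightarrow> t \<in> {0..d x y} \<Longrightarrow> d (g s) (g t) = \<bar>s - t\<bar>"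
    using S unfolding geodesic_segment_def by blast
  have "connectedin (top_of_set {0..1::real}) {0..1}" by (simp add: connectedin_absolute)
  from connectedin_continuous_map_image[OF c(1) this] have Acon: "connectedin mtopology A"
    by (simp add: c)
  have xyA: "x \<in> A" "y \<in> A" unfolding c(5)[symmetric] c(3)[symmetric] c(4)[symmetric] by auto
  show SA: "S \<subseteq> A"
  proof
    fix p assume p: "p \<in> S"
    then obtain s where s: "s \<in> {0..d x y}" "p = g s" unfolding g(3)[symmetric] by blast
    have "d x p = s" using iso[of 0 s] s g by simp
    moreover have "d p y = d x y - s" using iso[of s "d x y"] s g by simp
    ultimately have "d x p + d p y = d x y" by simp
    moreover have "p \<in> M" using p g(4) by blast
    ultimately show "p \<in> A" using four_point_path_contains_segment[OF _ Acon xyA] four by blast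
  qed
  have gc: "continuous_map (top_of_set {0..d x y}) mtopology g"
    by (rule Lipschitz_real_continuous_map[where L=1]) (use iso g in auto)
  have "connectedin (top_of_set {0..d x y}) {0..d x y}" by (simp add: connectedin_absolute)
  from connectedin_continuous_map_image[OF gc this] have Scon: "connectedin mtopology S"
    by (simp add: g)
  have closed: "closedin mtopology (c ` {a..b})" if "0 \<le> a" "b \<le> 1" for a b
  proof (rule compactin_imp_closedin[OF Hausdorff_space_mtopology])
    have "compactin (top_of_set {0..1}) {a..b}" using that by (simp add: compactin_subtopology)
    then show "compactin mtopology (c ` {a..b})" by (rule image_compactin[OF _ c(1)])
  qed
  show "A \<subseteq> S"
  proof
    fix q assume "q \<in> A"
    then obtain t where t: "t \<in> {0..1}" "q = c t" unfolding c(5)[symmetric] by blast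
    let ?E = "c ` {0..t}" and ?F = "c ` {t..1}"
    have "{0..1} = {0..t} \<union> {t..1}" using t by auto
    then have "S \<subseteq> ?E \<union> ?F" using SA unfolding c(5)[symmetric] by (metis image_Un)
    have "x \<in> S" "y \<in> S" unfolding g(3)[symmetric]
      using imageI[of 0 "{0..d x y}" g] imageI[of "d x y" "{0..d x y}" g] g(1,2) by auto
    then have "x \<in> ?E \<inter> S" "y \<in> ?F \<inter> S"
      using imageI[of 0 "{0..t}" c] imageI[of 1 "{t..1}" c] t c(3,4) by auto
    have "?E \<inter> ?F \<inter> S \<noteq> {}"
    proof -
      have "closedin mtopology ?E" "closedin mtopology ?F" using closed t by auto
      then show ?thesis using \<open>S \<subseteq> ?E \<union> ?F\<close> \<open>x \<in> ?E \<inter> S\<close> \<open>y \<in> ?F \<inter> S\<close> Scon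
        unfolding connectedin_closedin by blast
    qed
    then obtain u v where uv: "u \<in> {0..t}" "v \<in> {t..1}" "c u = c v" "c u \<in> S"
      by (force simp: image_iff)
    then have "u = v" using inj_onD[OF c(2) uv(3)] t by auto
    then have "u = t" using uv by auto
    then show "q \<in> S" using uv t by simp
  qed
qed

lemma four_point_real_tree:
  assumes "\<And>w x y z. w \<in> M \<Longrightarrow> x \<in> M \<Longrightarrow> y \<in> M \<Longrightarrow> z \<in> M \<Longrightarrow>
        min (d w x + d w y - d x y) (d w y + d w z - d y z) \<le> d w x + d w z - d x z"
    and "\<And>x y. x \<in> M \<Longrightarrow> y \<in> M \<Longrightarrow> \<exists>S. geodesic_segment M d x y S"
  shows "real_tree M d"
  unfolding real_tree_def
proof (intro conjI ballI allI impI)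
  show "Metric_space M d" by (rule Metric_space_axioms)
  fix x y A B assume "x \<in> M" "y \<in> M" and AB: "arc_between M d x y A" "arc_between M d x y B"
  then obtain S where S: "geodesic_segment M d x y S" using assms(2) by blast
  have "A = S" by (rule four_point_arc_eq_segment[OF assms(1) AB(1) S])
  moreover have "B = S" by (rule four_point_arc_eq_segment[OF assms(1) AB(2) S])
  ultimately show "A = B" by simp
qed (use assms(2) in blast)

end

text \<open>A continuous injection carries arcs to arcs, so two arcs with the same ends have equal
  images and are equal. Geodesics do not come back in this way and have to be supplied.\<close>

lemma real_tree_pullback:
  assumes T: "real_tree M' d'" and M: "Metric_space M d"
    and geo: "\<And>x y. x \<in> M \<Longrightarrow> y \<in> M \<Longrightarrow> \<exists>S. geodesic_segment M d x y S"
    and \<phi>: "\<phi> \<in> M \<rightarrow> M'" "inj_on \<phi> M" and lip: "\<And>x y. x \<in> M \<Longrightarrow> y \<in> M \<Longrightarrow> d' (\<phi> x) (\<phi> y) \<le> B * d x y"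
  shows "real_tree M d"
proof -
  interpret M: Metric_space M d by (rule M)
  interpret M': Metric_space M' d' using T by (simp add: real_tree_def)
  have cont: "continuous_map M.mtopology M'.mtopology \<phi>"
    unfolding M'.continuous_map_to_metric
  proof (intro ballI allI impI)
    fix x \<epsilon> :: real and x0 assume "x0 \<in> topspace M.mtopology" and \<epsilon>: "0 < \<epsilon>"
    then have x0: "x0 \<in> M" by simp
    define \<eta> where "\<eta> = \<epsilon> / (\<bar>B\<bar> + 1)"
    have \<eta>: "0 < \<eta>" using \<epsilon> by (simp add: \<eta>_def)
    show "\<exists>U. openin M.mtopology U \<and> x0 \<in> U \<and> (\<forall>y\<in>U. \<phi> y \<in> M'.mball (\<phi> x0) \<epsilon>)"
    proof (intro exI[of _ "M.mball x0 \<eta>"] conjI ballI)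
      fix y assume y: "y \<in> M.mball x0 \<eta>"
      then have "d' (\<phi> x0) (\<phi> y) \<le> B * d x0 y" using lip x0 by simp
      also have "\<dots> \<le> (\<bar>B\<bar> + 1) * d x0 y" by (intro mult_right_mono) auto
      also have "\<dots> < (\<bar>B\<bar> + 1) * \<eta>" using y by (intro mult_strict_left_mono) auto
      also have "\<dots> = \<epsilon>" by (simp add: \<eta>_def)
      finally show "\<phi> y \<in> M'.mball (\<phi> x0) \<epsilon>" using y x0 \<phi> by auto
    qed (use x0 \<eta> in auto)
  qed
  have arc: "arc_between M' d' (\<phi> x) (\<phi> y) (\<phi> ` A) \<and> A \<subseteq> M" if h: "arc_between M d x y A" for x y A
  proof -
    obtain c :: "real \<Rightarrow> _" where c: "continuous_map (top_of_set {0..1}) M.mtopology c" "inj_on c {0..1}"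
      "c 0 = x" "c 1 = y" "c ` {0..1} = A"
      using h[unfolded arc_between_def] by (elim exE conjE)
    have AM: "A \<subseteq> M" using continuous_map_image_subset_topspace[OF c(1)] c(5) by simp
    have "arc_between M' d' (\<phi> x) (\<phi> y) (\<phi> ` A)"
      unfolding arc_between_def
    proof (intro exI[of _ "\<phi> \<circ> c"] conjI)
      show "continuous_map (top_of_set {0..1}) M'.mtopology (\<phi> \<circ> c)"
        by (rule continuous_map_compose[OF c(1) cont])
      show "inj_on (\<phi> \<circ> c) {0..1}"
        by (rule comp_inj_on[OF c(2)]) (use inj_on_subset[OF \<phi>(2) AM] c(5) in simp)
    qed (use c in auto)
    with AM show ?thesis by blast
  qed
  have "A = A'" if "arc_between M d x y A" "arc_between M d x y A'" "x \<in> M" "y \<in> M" for x y A A'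
  proof -
    have "\<phi> x \<in> M'" "\<phi> y \<in> M'" using that(3,4) \<phi>(1) by auto
    moreover have "arc_between M' d' (\<phi> x) (\<phi> y) (\<phi> ` A)" "arc_between M' d' (\<phi> x) (\<phi> y) (\<phi> ` A')"
      "A \<subseteq> M" "A' \<subseteq> M"
      using arc[OF that(1)] arc[OF that(2)] by auto
    moreover from this have "\<phi> ` A = \<phi> ` A' \<longleftrightarrow> A = A'"
      by (intro inj_on_image_eq_iff[OF \<phi>(2)])
    ultimately show ?thesis using T[unfolded real_tree_def] by simp
  qed
  with M geo show ?thesis unfolding real_tree_def by (intro conjI ballI allI impI)
qed

text \<open>
  If \<open>\<alpha> s\<close> were on neither of the other sides, then following \<open>\<gamma>\<close> backwards from \<open>x\<close> up to the first
  point on \<open>\<beta>\<close>, and \<open>\<beta>\<close> backwards from there, would be a second arc from \<open>x\<close> to \<open>y\<close>.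
\<close>

lemma real_tree_geodesic_triangle:
  assumes T: "real_tree M d" and len: "0 \<le> a" "0 \<le> b" "0 \<le> c"
    and \<alpha>: "\<And>s. 0 \<le> s \<Longrightarrow> s \<le> a \<Longrightarrow> \<alpha> s \<in> M"
    and \<beta>: "\<And>s. 0 \<le> s \<Longrightarrow> s \<le> b \<Longrightarrow> \<beta> s \<in> M"
    and \<gamma>: "\<And>s. 0 \<le> s \<Longrightarrow> s \<le> c \<Longrightarrow> \<gamma> s \<in> M"
    and \<alpha>_iso: "\<And>s t. 0 \<le> s \<Longrightarrow> s \<le> a \<Longrightarrow> 0 \<le> t \<Longrightarrow> t \<le> a \<Longrightarrow> d (\<alpha> s) (\<alpha> t) = \<bar>s - t\<bar>"
    and \<beta>_iso: "\<And>s t. 0 \<le> s \<Longrightarrow> s \<le> b \<Longrightarrow> 0 \<le> t \<Longrightarrow> t \<le> b \<Longrightarrow> d (\<beta> s) (\<beta> t) = \<bar>s - t\<bar>"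
    and \<gamma>_iso: "\<And>s t. 0 \<le> s \<Longrightarrow> s \<le> c \<Longrightarrow> 0 \<le> t \<Longrightarrow> t \<le> c \<Longrightarrow> d (\<gamma> s) (\<gamma> t) = \<bar>s - t\<bar>"
    and corners: "\<alpha> a = \<beta> 0" "\<beta> b = \<gamma> 0" "\<gamma> c = \<alpha> 0" and s: "0 \<le> s" "s \<le> a"
  shows "\<alpha> s \<in> \<beta> ` {0..b} \<union> \<gamma> ` {0..c}"
proof (rule ccontr)
  assume out: "\<alpha> s \<notin> \<beta> ` {0..b} \<union> \<gamma> ` {0..c}"
  interpret Metric_space M d using T by (simp add: real_tree_def)
  have apos: "0 < a"
  proof (rule ccontr)
    assume "\<not> 0 < a" then have "s = 0" using s len by simp
    then have "\<alpha> s = \<gamma> c" using corners by simp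
    with out len show False by auto
  qed
  have xy: "\<alpha> 0 \<noteq> \<alpha> a" using \<alpha>_iso[of 0 a] apos \<alpha>[of 0] by force
  \<comment> \<open>Pairs of parameters at which \<gamma> and \<beta> meet. The set is compact and
    contains \<open>(0, b)\<close>, so there is a largest parameter \<open>u\<close> at which
    \<gamma> is on \<beta>. It is the first hit on the way back, which makes the path
    \<open>f\<close> below injective.\<close>
  define K where "K = {w \<in> {0..c} \<times> {0..b}. d (\<gamma> (fst w)) (\<beta> (snd w)) = 0}"
  have "continuous_on ({0..c} \<times> {0..b}) (\<lambda>w. d (\<gamma> (fst w)) (\<beta> (snd w)))"
  proof (rule continuous_on_subset[OF _ order_refl], subst continuous_on_iff, intro ballI allI impI)
    fix w \<epsilon> :: real and w0 :: "real \<times> real"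
    assume w0: "w0 \<in> {0..c} \<times> {0..b}" and \<epsilon>: "0 < \<epsilon>"
    show "\<exists>\<eta>>0. \<forall>w\<in>{0..c} \<times> {0..b}. dist w w0 < \<eta> \<longrightarrow>
        dist (d (\<gamma> (fst w)) (\<beta> (snd w))) (d (\<gamma> (fst w0)) (\<beta> (snd w0))) < \<epsilon>"
    proof (intro exI[of _ "\<epsilon> / 2"] conjI ballI impI)
      fix w :: "real \<times> real" assume w: "w \<in> {0..c} \<times> {0..b}" "dist w w0 < \<epsilon> / 2"
      have "\<bar>fst w - fst w0\<bar> < \<epsilon> / 2" "\<bar>snd w - snd w0\<bar> < \<epsilon> / 2"
        using w(2) dist_fst_le[of w w0] dist_snd_le[of w w0] by (auto simp: dist_real_def)
      moreover have "d (\<gamma> (fst w)) (\<gamma> (fst w0)) = \<bar>fst w - fst w0\<bar>"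
        "d (\<beta> (snd w)) (\<beta> (snd w0)) = \<bar>snd w - snd w0\<bar>" using w w0 \<gamma>_iso \<beta>_iso by auto
      moreover have "\<gamma> (fst w) \<in> M" "\<gamma> (fst w0) \<in> M" "\<beta> (snd w) \<in> M" "\<beta> (snd w0) \<in> M"
        using w w0 \<gamma> \<beta> by auto
      ultimately show "dist (d (\<gamma> (fst w)) (\<beta> (snd w))) (d (\<gamma> (fst w0)) (\<beta> (snd w0))) < \<epsilon>"
        using triangle[of "\<gamma> (fst w)" "\<gamma> (fst w0)" "\<beta> (snd w)"]
          triangle[of "\<gamma> (fst w0)" "\<beta> (snd w0)" "\<beta> (snd w)"]
          triangle[of "\<gamma> (fst w0)" "\<gamma> (fst w)" "\<beta> (snd w0)"]
          triangle[of "\<gamma> (fst w)" "\<beta> (snd w)" "\<beta> (snd w0)"]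
          commute[of "\<gamma> (fst w)" "\<gamma> (fst w0)"] commute[of "\<beta> (snd w)" "\<beta> (snd w0)"]
        by (simp add: dist_real_def abs_less_iff)
    qed (use \<epsilon> in auto)
  qed
  then have "closed K" unfolding K_def
    by (intro continuous_closed_preimage_constant closed_Times) auto
  moreover have "bounded K" unfolding K_def
    by (rule bounded_subset[OF bounded_Times[of "{0..c}" "{0..b}"]]) auto
  ultimately have "compact K" by (simp add: compact_eq_bounded_closed)
  moreover have "(0, b) \<in> K" using len corners \<beta>[of b] by (auto simp: K_def)
  ultimately obtain w where w: "w \<in> K" and wmax: "\<And>w'. w' \<in> K \<Longrightarrow> fst w' \<le> fst w"
    using continuous_attains_sup[of K fst] continuous_on_fst[OF continuous_on_id, of K]
    by (metis empty_iff)
  obtain u v where uv: "w = (u, v)" by (cases w)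
  have u: "0 \<le> u" "u \<le> c" and v: "0 \<le> v" "v \<le> b" and hit: "\<gamma> u = \<beta> v"
    using w uv \<gamma> \<beta> by (auto simp: K_def)
  have first: "u' \<le> u" if "0 \<le> u'" "u' \<le> c" "0 \<le> v'" "v' \<le> b" "\<gamma> u' = \<beta> v'" for u' v'
    using wmax[of "(u', v')"] that \<beta>[of v'] uv by (auto simp: K_def)
  \<comment> \<open>The path runs back along \<gamma> from \<open>c\<close> to \<open>u\<close>,
    then back along \<beta> from \<open>v\<close> to \<open>0\<close>; it changes over at time
    \<open>c - u\<close>.\<close>
  define f where "f t = (if t \<le> c - u then \<gamma> (c - t) else \<beta> (v - (t - (c - u))))" for t
  define L where "L = (c - u) + v"
  have f0: "f 0 = \<alpha> 0" using u corners by (simp add: f_def)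
  have fL: "f L = \<alpha> a" using u v hit corners by (auto simp: f_def L_def)
  have "0 < L"
  proof (rule ccontr)
    assume "\<not> 0 < L" then have "L = 0" using u v by (simp add: L_def)
    then show False using f0 fL xy by simp
  qed
  then have "arc_between M d (f 0) (f L) (f ` {0..L})"
  proof (rule arc_between_Lipschitz)
    fix t assume t: "0 \<le> t" "t \<le> L"
    then show "f t \<in> M" using u v by (auto simp: f_def L_def intro!: \<gamma> \<beta>)
  next
    fix t t' assume t: "0 \<le> t" "t \<le> t'" "t' \<le> L"
    consider "t' \<le> c - u" | "c - u < t" | "t \<le> c - u" "c - u < t'" by linarith
    then show "d (f t) (f t') \<le> t' - t"
    proof cases
      case 1 then show ?thesis using t u by (simp add: f_def \<gamma>_iso)
    next
      case 2 then show ?thesis using t u v by (simp add: f_def \<beta>_iso L_def)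
    next
      case 3
      have "d (\<gamma> (c - t)) (\<beta> (v - (t' - (c - u)))) \<le> d (\<gamma> (c - t)) (\<gamma> u) + d (\<beta> v) (\<beta> (v - (t' - (c - u))))"
        using 3 t u v hit triangle[of "\<gamma> (c - t)" "\<gamma> u" "\<beta> (v - (t' - (c - u)))"] \<gamma> \<beta>
        by (simp add: L_def)
      also have "\<dots> = t' - t" using 3 t u v by (simp add: \<gamma>_iso \<beta>_iso L_def)
      finally show ?thesis using 3 by (simp add: f_def)
    qed
  next
    fix t t' assume t: "0 \<le> t" "t < t'" "t' \<le> L"
    consider "t' \<le> c - u" | "c - u < t" | "t \<le> c - u" "c - u < t'" by linarith
    then show "f t \<noteq> f t'"
    proof cases
      case 1
      then have "d (f t) (f t') = t' - t" using t u by (simp add: f_def \<gamma>_iso)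
      moreover have "f t' \<in> M" using 1 t u by (auto simp: f_def intro!: \<gamma>)
      ultimately show ?thesis using t by auto
    next
      case 2
      then have "d (f t) (f t') = t' - t" using t u v by (simp add: f_def \<beta>_iso L_def)
      moreover have "f t' \<in> M" using 2 t u v by (auto simp: f_def L_def intro!: \<beta>)
      ultimately show ?thesis using t by auto
    next
      case 3
      show ?thesis
      proof
        assume "f t = f t'"
        then have eq: "\<gamma> (c - t) = \<beta> (v - (t' - (c - u)))" using 3 by (simp add: f_def)
        then have "c - t \<le> u" using 3 t u v by (intro first) (auto simp: L_def)
        then have "c - t = u" using 3 by simp
        then have "\<beta> v = \<beta> (v - (t' - (c - u)))" using eq hit by simp
        moreover have "d (\<beta> v) (\<beta> (v - (t' - (c - u)))) = t' - (c - u)"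
          using 3 t u v by (simp add: \<beta>_iso L_def)
        ultimately show False using 3 v \<beta>[of v] by simp
      qed
    qed
  qed
  moreover have "arc_between M d (\<alpha> 0) (\<alpha> a) (\<alpha> ` {0..a})"
    by (rule arc_between_geodesic[OF apos \<alpha> \<alpha>_iso])
  ultimately have "\<alpha> ` {0..a} = f ` {0..L}"
    using T f0 fL \<alpha>[of 0] \<alpha>[of a] len unfolding real_tree_def by auto
  moreover have "\<alpha> s \<in> \<alpha> ` {0..a}" using s by simp
  ultimately have "\<alpha> s \<in> f ` {0..L}" by simp
  then obtain t where t: "0 \<le> t" "t \<le> L" "\<alpha> s = f t" by (elim imageE) (rule that, auto)
  show False
  proof (cases "t \<le> c - u")
    case True
    then have "\<alpha> s \<in> \<gamma> ` {0..c}" using t u by (auto simp: f_def)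
    with out show False by blast
  next
    case False
    then have "\<alpha> s \<in> \<beta> ` {0..b}" using t u v by (auto simp: f_def L_def)
    with out show False by blast
  qed
qed

section \<open>Geodesics with a parametrization\<close>

definition unit_speed :: "'a set \<Rightarrow> ('a \<Rightarrow> 'a \<Rightarrow> real) \<Rightarrow> real \<Rightarrow> (real \<Rightarrow> 'a) \<Rightarrow> bool" where
  "unit_speed M d L c \<longleftrightarrow> (\<forall>s\<in>{0..L}. c s \<in> M) \<and> (\<forall>s\<in>{0..L}. \<forall>t\<in>{0..L}. d (c s) (c t) = \<bar>s - t\<bar>)"

lemma unit_speed_in: "unit_speed M d L c \<Longrightarrow> 0 \<le> s \<Longrightarrow> s \<le> L \<Longrightarrow> c s \<in> M"
  by (simp add: unit_speed_def)

lemma unit_speed_iso: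
  "unit_speed M d L c \<Longrightarrow> 0 \<le> s \<Longrightarrow> s \<le> L \<Longrightarrow> 0 \<le> t \<Longrightarrow> t \<le> L \<Longrightarrow> d (c s) (c t) = \<bar>s - t\<bar>"
  by (simp add: unit_speed_def)

lemma geodesic_segment_iff:
  "geodesic_segment M d x y S \<longleftrightarrow>
    (\<exists>c. c 0 = x \<and> c (d x y) = y \<and> S = c ` {0..d x y} \<and> unit_speed M d (d x y) c)"
  unfolding geodesic_segment_def unit_speed_def by (intro iff_exI) auto

section \<open>Geometric realizations of connected graphs\<close>

locale connected_graph =
  fixes V :: "'a set" and E :: "('a \<times> 'a) set"
  assumes edges: "E \<subseteq> V \<times> V" and sym_E: "(u, v) \<in> E \<Longrightarrow> (v, u) \<in> E"
    and connected: "u \<in> V \<Longrightarrow> v \<in> V \<Longrightarrow> (u, v) \<in> E\<^sup>*"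
begin

abbreviation "vd \<equiv> vertex_dist E"
abbreviation "\<G> \<equiv> graph_points V E"
abbreviation "gd \<equiv> graph_dist V E"

lemma vd_path: "u \<in> V \<Longrightarrow> v \<in> V \<Longrightarrow> (u, v) \<in> E ^^ vd u v"
  unfolding vertex_dist_def using connected[of u v] by (auto simp: rtrancl_is_UN_relpow intro: LeastI)

lemma vd_le: "(u, v) \<in> E ^^ n \<Longrightarrow> vd u v \<le> n"
  unfolding vertex_dist_def by (rule Least_le)

lemma vd_refl [simp]: "vd u u = 0"
  using vd_le[of u u 0] by simp

lemma vd_triangle: "u \<in> V \<Longrightarrow> v \<in> V \<Longrightarrow> w \<in> V \<Longrightarrow> vd u w \<le> vd u v + vd v w"
  using vd_path[of u v] vd_path[of v w] by (intro vd_le) (auto simp: relpow_add)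

lemma vd_sym: assumes "u \<in> V" "v \<in> V" shows "vd u v = vd v u"
proof -
  have "(v, u) \<in> E ^^ n" if "(u, v) \<in> E ^^ n" for u v n
    using that
  proof (induction n arbitrary: v)
    case (Suc n)
    then obtain w where "(u, w) \<in> E ^^ n" "(w, v) \<in> E" by auto
    with Suc.IH sym_E show ?case by (intro relpow_Suc_I2[of v w]) auto
  qed simp
  then show ?thesis using vd_path assms vd_le by (meson antisym)
qed

lemma vd_edge: "u = v \<or> (u, v) \<in> E \<Longrightarrow> vd u v \<le> 1"
  using vd_le[of u v 1] by auto

lemma supp_edge_point: "supp (edge_point u v t) \<subseteq> {u, v}"
  by (auto simp: supp_def edge_point_def)

lemma graph_pointE:
  assumes "p \<in> \<G>"
  obtains u v where "u \<in> V" "v \<in> V" "u = v \<or> (u, v) \<in> E" "supp p \<subseteq> {u, v}" "supp p \<noteq> {}"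
    "\<And>w. 0 \<le> p w" "\<And>w. p w \<le> 1"
proof -
  obtain u v t where p: "p = edge_point u v t" "u \<in> V" "v \<in> V" "u = v \<or> (u, v) \<in> E" "0 \<le> t" "t \<le> 1"
    using assms unfolding graph_points_def by auto
  have "p u \<noteq> 0 \<or> p v \<noteq> 0" using p by (auto simp: edge_point_def split: if_splits)
  then have "supp p \<noteq> {}" by (auto simp: supp_def)
  moreover have "0 \<le> p w" "p w \<le> 1" for w using p by (auto simp: edge_point_def)
  ultimately show ?thesis using p supp_edge_point[of u v t] by (intro that[of u v]) simp_all
qed

definition vx :: "'a \<Rightarrow> 'a \<Rightarrow> real" where "vx u = edge_point u u 0"

lemma vx_in: "u \<in> V \<Longrightarrow> vx u \<in> \<G>"
  unfolding vx_def graph_points_def by force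

lemma supp_vx: "supp (vx u) = {u}"
  by (auto simp: supp_def vx_def edge_point_def)

text \<open>Rounds a point to an end of its edge, so that translations and word lengths, which
  concern vertices, can be applied to arbitrary points.\<close>

definition rd :: "('a \<Rightarrow> real) \<Rightarrow> 'a" where "rd p = (SOME w. w \<in> supp p)"

lemma rd_supp: "p \<in> \<G> \<Longrightarrow> rd p \<in> supp p"
  unfolding rd_def by (elim graph_pointE) (simp add: some_in_eq)

lemma rd_vx [simp]: "rd (vx u) = u"
  unfolding rd_def supp_vx by simp

lemma vd_diff: assumes "u \<in> V" "v \<in> V" "u' \<in> V" "v' \<in> V" "vd u u' \<le> 1" "vd v v' \<le> 1"
  shows "vd u v \<le> vd u' v' + 2"
proof -
  have "vd u v \<le> vd u u' + (vd u' v' + vd v' v)"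
    using vd_triangle[of u u' v] vd_triangle[of u' v' v] assms by linarith
  then show ?thesis using assms vd_sym[of v v'] by simp
qed

lemma supp_close: assumes "p \<in> \<G>" "u \<in> supp p" "v \<in> supp p" shows "vd u v \<le> 1"
  using assms(1)
proof (rule graph_pointE)
  fix a b assume ab: "a \<in> V" "b \<in> V" "a = b \<or> (a, b) \<in> E" "supp p \<subseteq> {a, b}"
  then have "u = v \<or> (u, v) \<in> E" using assms(2,3) sym_E by auto
  then show ?thesis by (rule vd_edge)
qed

lemma supp_V: "p \<in> \<G> \<Longrightarrow> supp p \<subseteq> V" by (elim graph_pointE) auto

lemma rd_in: "p \<in> \<G> \<Longrightarrow> rd p \<in> V"
  using rd_supp supp_V by blast

lemma finite_supp: "p \<in> \<G> \<Longrightarrow> finite (supp p)"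
  by (elim graph_pointE) (auto intro: finite_subset)

text \<open>On a common edge both distances are at most 1. Otherwise the offsets
  \<open>1 - p u\<close> and \<open>1 - q v\<close> contribute at most 1 each, and replacing the
  chosen ends by the optimal ones costs at most one edge on either side.\<close>

lemma gd_coarse:
  assumes p: "p \<in> \<G>" and q: "q \<in> \<G>"
  shows "\<bar>gd p q - real (vd (rd p) (rd q))\<bar> \<le> 2" and "0 \<le> gd p q"
proof -
  have ps: "rd p \<in> supp p" "supp p \<noteq> {}" "finite (supp p)" and qs: "rd q \<in> supp q" "supp q \<noteq> {}" "finite (supp q)"
    using rd_supp finite_supp p q by auto
  have b: "0 \<le> p w" "p w \<le> 1" "0 \<le> q w" "q w \<le> 1" for w using p q by (auto elim!: graph_pointE)
  have "\<bar>gd p q - real (vd (rd p) (rd q))\<bar> \<le> 2 \<and> 0 \<le> gd p q"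
  proof (cases "on_common_edge E p q")
    case True
    then obtain u v where uv: "u = v \<or> (u, v) \<in> E" "supp p \<subseteq> {u, v}" "supp q \<subseteq> {u, v}"
      unfolding on_common_edge_def by blast
    have "rd p = rd q \<or> (rd p, rd q) \<in> E" using uv ps(1) qs(1) sym_E by blast
    then have vd1: "vd (rd p) (rd q) \<le> 1" by (rule vd_edge)
    have eq: "gd p q = Max ((\<lambda>w. \<bar>p w - q w\<bar>) ` (supp p \<union> supp q))"
      using True p q by (simp add: graph_dist_def)
    have fin: "finite ((\<lambda>w. \<bar>p w - q w\<bar>) ` (supp p \<union> supp q))" using ps qs by simp
    have in01: "\<bar>p w - q w\<bar> \<le> 1" for w using b[of w] by (simp add: abs_le_iff)
    have "gd p q \<le> 1" unfolding eq using fin ps in01 by (subst Max_le_iff) auto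
    moreover have "\<bar>p (rd p) - q (rd p)\<bar> \<le> gd p q" unfolding eq using fin ps by (intro Max_ge) auto
    ultimately show ?thesis using vd1 by linarith
  next
    case False
    define F where "F = (\<lambda>(u, v). (1 - p u) + real (vd u v) + (1 - q v)) ` (supp p \<times> supp q)"
    have eq: "gd p q = Min F" using False p q by (simp add: graph_dist_def F_def)
    have fin: "finite F" "F \<noteq> {}" using ps qs by (auto simp: F_def)
    have "(1 - p (rd p)) + real (vd (rd p) (rd q)) + (1 - q (rd q)) \<in> F"
      using ps qs by (auto simp: F_def image_iff)
    then have "gd p q \<le> (1 - p (rd p)) + real (vd (rd p) (rd q)) + (1 - q (rd q))"
      unfolding eq using fin by (intro Min_le)
    then have up: "gd p q \<le> real (vd (rd p) (rd q)) + 2" using b[of "rd p"] b[of "rd q"] by linarith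
    have low: "real (vd (rd p) (rd q)) - 2 \<le> x \<and> 0 \<le> x" if "x \<in> F" for x
    proof -
      have "\<exists>u\<in>supp p. \<exists>v\<in>supp q. x = (1 - p u) + real (vd u v) + (1 - q v)"
        using that unfolding F_def by force
      then obtain u v where uv: "u \<in> supp p" "v \<in> supp q" "x = (1 - p u) + real (vd u v) + (1 - q v)" by blast
      have "vd (rd p) (rd q) \<le> vd u v + 2"
        using supp_close[OF p ps(1) uv(1)] supp_close[OF q qs(1) uv(2)] supp_V[OF p] supp_V[OF q] ps(1) qs(1) uv
        by (intro vd_diff) auto
      then show ?thesis using uv(3) b(2)[of u] b(4)[of v] by linarith
    qed
    have "Min F \<in> F" using fin by simp
    from low[OF this] up show ?thesis unfolding eq by linarith
  qed
  then show "\<bar>gd p q - real (vd (rd p) (rd q))\<bar> \<le> 2" and "0 \<le> gd p q" by auto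
qed

lemma gd_refl: assumes "p \<in> \<G>" shows "gd p p = 0"
proof -
  have "on_common_edge E p p" using assms unfolding on_common_edge_def by (elim graph_pointE) blast
  then show ?thesis using assms by (elim graph_pointE) (simp add: graph_dist_def image_constant_conv)
qed

lemma gd_outside: "p \<notin> \<G> \<or> q \<notin> \<G> \<Longrightarrow> gd p q = 0" by (auto simp: graph_dist_def)

text \<open>The triangle inequality holds for \<open>vd\<close> and involves three distances, each
  of which is off by at most 2; this gives 6. Symmetry involves two and costs 4.\<close>

sublocale coarse_space \<G> gd 6
proof
  show "0 \<le> gd p q" for p q using gd_coarse(2) gd_outside by (cases "p \<in> \<G> \<and> q \<in> \<G>") auto
  show "gd p p \<le> 6" if "p \<in> \<G>" for p using gd_refl that by simp
  show "gd p q \<le> gd q p + 6" if "p \<in> \<G>" "q \<in> \<G>" for p q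
    using gd_coarse(1)[OF that] gd_coarse(1)[OF that(2,1)] vd_sym[of "rd p" "rd q"] rd_in that by auto
  show "gd p r \<le> gd p q + gd q r + 6" if "p \<in> \<G>" "q \<in> \<G>" "r \<in> \<G>" for p q r
  proof -
    have "vd (rd p) (rd r) \<le> vd (rd p) (rd q) + vd (rd q) (rd r)" using that rd_in vd_triangle by blast
    then show ?thesis using gd_coarse(1)[OF that(1,2)] gd_coarse(1)[OF that(2,3)] gd_coarse(1)[OF that(1,3)]
      by linarith
  qed
qed

text \<open>
  In the coordinates of a shortest path \<open>f 0, \<dots>, f n\<close>, the point at distance \<open>s\<close> from \<open>f 0\<close> has the
  barycentric coordinate \<open>max 0 (1 - \<bar>s - k\<bar>)\<close> at \<open>f k\<close>.
\<close>

lemma vertex_geodesic: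
  assumes x: "x \<in> V" and y: "y \<in> V"
  obtains c where "c 0 = vx x" "c (vd x y) = vx y" "unit_speed \<G> gd (vd x y) c"
proof -
  define n where "n = vd x y"
  have "(x, y) \<in> E ^^ n" using vd_path x y by (simp add: n_def)
  then obtain f where f: "f 0 = x" "f n = y" "\<And>i. i < n \<Longrightarrow> (f i, f (Suc i)) \<in> E"
    unfolding relpow_fun_conv by blast
  have fV: "f i \<in> V" if "i \<le> n" for i
    using that f(3)[of "i - 1"] f(1) x edges by (cases i) auto
  have sub: "(f i, f (i + k)) \<in> E ^^ k" if "i + k \<le> n" for i k
    using that f(3) unfolding relpow_fun_conv by (intro exI[of _ "\<lambda>j. f (i + j)"]) auto
  have vd_f': "vd (f i) (f j) = j - i" if "i \<le> j" "j \<le> n" for i j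
  proof -
    have up: "vd (f a) (f b) \<le> b - a" if "a \<le> b" "b \<le> n" for a b
      using vd_le[OF sub[of a "b - a"]] that by simp
    have "n \<le> vd (f 0) (f i) + (vd (f i) (f j) + vd (f j) (f n))"
      using vd_triangle[of "f 0" "f i" "f n"] vd_triangle[of "f i" "f j" "f n"] fV[of i] fV[of j] x y that f(1,2)
      by (simp add: n_def)
    then show ?thesis using up[of 0 i] up[of i j] up[of j n] that by linarith
  qed
  have vd_f: "real (vd (f i) (f j)) = \<bar>real i - real j\<bar>" if "i \<le> n" "j \<le> n" for i j
  proof (cases "i \<le> j")
    case True then show ?thesis using vd_f'[of i j] that by simp
  next
    case False then show ?thesis using vd_f'[of j i] vd_sym[of "f i" "f j"] fV that by simp
  qed
  have f_inj: "f i = f j \<longleftrightarrow> i = j" if "i \<le> n" "j \<le> n" for i j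
    using vd_f[OF that] by auto
  \<comment> \<open>At \<open>s = n\<close> this mentions the unconstrained value
    \<open>f (Suc n)\<close>, but with coefficient 0.\<close>
  define c where "c s = edge_point (f (nat \<lfloor>s\<rfloor>)) (f (Suc (nat \<lfloor>s\<rfloor>))) (s - real (nat \<lfloor>s\<rfloor>))" for s
  have c_int: "c (real k) = vx (f k)" for k
    by (auto simp: c_def vx_def edge_point_def)
  have fl: "real (nat \<lfloor>s\<rfloor>) \<le> s" "s < real (nat \<lfloor>s\<rfloor>) + 1" if "0 \<le> s" for s
    using that by (auto simp: of_nat_nat)
  have c_pt: "c s \<in> \<G>" and c_val: "\<And>k. k \<le> n \<Longrightarrow> c s (f k) = max 0 (1 - \<bar>s - real k\<bar>)"
    and c_supp: "supp (c s) \<subseteq> f ` {..n}" if s: "0 \<le> s" "s \<le> real n" for s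
  proof -
    define i where "i = nat \<lfloor>s\<rfloor>"
    have i: "real i \<le> s" "s < real i + 1" using fl[OF s(1)] by (auto simp: i_def)
    have ci: "c s = edge_point (f i) (f (Suc i)) (s - real i)" by (simp add: c_def i_def)
    have "c s \<in> \<G> \<and> (\<forall>k\<le>n. c s (f k) = max 0 (1 - \<bar>s - real k\<bar>)) \<and> supp (c s) \<subseteq> f ` {..n}"
    proof (cases "i < n")
      case True
      have "f i \<in> V" "f (Suc i) \<in> V" "0 \<le> s - real i" "s - real i \<le> 1"
        using fV True i by auto
      then have "c s \<in> \<G>" unfolding ci graph_points_def using f(3)[OF True] by blast
      moreover have "c s (f k) = max 0 (1 - \<bar>s - real k\<bar>)" if k: "k \<le> n" for k
      proof -
        consider "k < i" | "k = i" | "k = Suc i" | "Suc i < k" by linarith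
        then show ?thesis using i f_inj[OF k, of i] f_inj[OF k, of "Suc i"] f_inj[of i "Suc i"] True
          by cases (auto simp: ci edge_point_def max_def)
      qed
      moreover have "supp (c s) \<subseteq> f ` {..n}" using supp_edge_point[of "f i" "f (Suc i)"] True
        unfolding ci by fastforce
      ultimately show ?thesis by blast
    next
      case False
      then have "i = n" "s = real n" using i s by auto
      then have cn: "c s = vx (f n)" using c_int by simp
      have "c s (f k) = max 0 (1 - \<bar>s - real k\<bar>)" if k: "k \<le> n" for k
        
        unfolding cn using f_inj[OF k, of n] k \<open>s = real n\<close>
        by (auto simp: vx_def edge_point_def max_def)
      then show ?thesis unfolding cn using vx_in fV supp_vx by auto
    qed
    then show "c s \<in> \<G>" "\<And>k. k \<le> n \<Longrightarrow> c s (f k) = max 0 (1 - \<bar>s - real k\<bar>)" "supp (c s) \<subseteq> f ` {..n}"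
      by auto
  qed
  have supp_iff: "f k \<in> supp (c s) \<longleftrightarrow> \<bar>s - real k\<bar> < 1" if "0 \<le> s" "s \<le> real n" "k \<le> n" for s k
    using c_val[OF that] by (auto simp: supp_def max_def)
  have main: "gd (c s) (c t) = t - s" if st: "0 \<le> s" "s \<le> t" "t \<le> real n" for s t
  proof -
    have s: "0 \<le> s" "s \<le> real n" and t: "0 \<le> t" "t \<le> real n" using st by auto
    have suppE: "\<exists>k\<le>n. w = f k \<and> (\<bar>s - real k\<bar> < 1)" if "w \<in> supp (c s)" for w
      using c_supp[OF s] that supp_iff[OF s] by auto
    have suppE': "\<exists>k\<le>n. w = f k \<and> (\<bar>t - real k\<bar> < 1)" if "w \<in> supp (c t)" for w
      using c_supp[OF t] that supp_iff[OF t] by auto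
    show ?thesis
    proof (cases "on_common_edge E (c s) (c t)")
      case True
      then obtain a b where ab: "a = b \<or> (a, b) \<in> E" "supp (c s) \<subseteq> {a, b}" "supp (c t) \<subseteq> {a, b}"
        unfolding on_common_edge_def by blast
      \<comment> \<open>Rounding outwards: \<open>f i\<close> and \<open>f j\<close> carry positive
        coordinates, so they lie on the common edge and \<open>j\<close> is at most
        \<open>Suc i\<close>. Hence \<open>s\<close> and \<open>t\<close> belong to one unit
        interval, and every coordinate in the support changes by \<open>t - s\<close>.\<close>
      define i where "i = nat \<lfloor>s\<rfloor>"
      define j where "j = nat \<lceil>t\<rceil>"
      have i: "real i \<le> s" "s < real i + 1" using fl[OF s(1)] by (auto simp: i_def)
      have j: "t \<le> real j" "real j < t + 1" using t by (auto simp: j_def of_nat_nat) linarith+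
      have ij: "i \<le> n" "j \<le> n" using i j s t by linarith+
      have "f i \<in> supp (c s)" "f j \<in> supp (c t)" using supp_iff s t ij i j by auto
      then have "f i = f j \<or> (f i, f j) \<in> E" using ab sym_E by blast
      then have "\<bar>real i - real j\<bar> \<le> 1" using vd_edge vd_f[OF ij] by force
      then have ti: "t \<le> real i + 1" using j by linarith
      have val: "\<bar>c s w - c t w\<bar> = t - s" if "w \<in> supp (c s) \<union> supp (c t)" for w
      proof -
        obtain k where k: "k \<le> n" "w = f k" "\<bar>s - real k\<bar> < 1 \<or> \<bar>t - real k\<bar> < 1"
          using \<open>w \<in> supp (c s) \<union> supp (c t)\<close> suppE suppE' by blast
        have "real k < real i + 2" "real i < real k + 1" using k(3) i ti st by linarith+
        then have "k = i \<or> k = Suc i" by linarith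
        then show ?thesis using c_val[OF s k(1)] c_val[OF t k(1)] k(2) i ti st by (auto simp: max_def)
      qed
      have "supp (c s) \<union> supp (c t) \<noteq> {}" using \<open>f i \<in> supp (c s)\<close> by blast
      then have "(\<lambda>w. \<bar>c s w - c t w\<bar>) ` (supp (c s) \<union> supp (c t)) = {t - s}"
        using val by (auto simp: image_iff)
      then show ?thesis using True c_pt s t by (simp add: graph_dist_def)
    next
      case False
      \<comment> \<open>Rounding inwards: \<open>f i\<close> and \<open>f j\<close> are the ends
        facing each other, and they attain the minimum. If \<open>i\<close> exceeded
        \<open>j\<close>, both points would lie on the edge from \<open>f j\<close> to
        \<open>f (Suc j)\<close>.\<close>
      define i where "i = nat \<lceil>s\<rceil>"
      define j where "j = nat \<lfloor>t\<rfloor>"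
      have i: "s \<le> real i" "real i < s + 1" using s by (auto simp: i_def of_nat_nat) linarith+
      have j: "real j \<le> t" "t < real j + 1" using fl[OF t(1)] by (auto simp: j_def)
      have ijn: "i \<le> n" "j \<le> n" using i j s t by linarith+
      have ij: "i \<le> j"
      proof (rule ccontr)
        assume "\<not> i \<le> j"
        then have i': "i = Suc j" using i j st by linarith
        have sj: "real j < s" using i i' by linarith
        have "w \<in> {f j, f (Suc j)}" if "w \<in> supp (c s) \<union> supp (c t)" for w
        proof -
          obtain k where k: "k \<le> n" "w = f k" "\<bar>s - real k\<bar> < 1 \<or> \<bar>t - real k\<bar> < 1"
            using \<open>w \<in> supp (c s) \<union> supp (c t)\<close> suppE suppE' by blast
          then have "k = j \<or> k = Suc j" using sj j st by linarith
          then show ?thesis using k by auto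
        qed
        moreover have "(f j, f (Suc j)) \<in> E" using f(3)[of j] i' ijn by simp
        ultimately have "on_common_edge E (c s) (c t)" unfolding on_common_edge_def by blast
        with False show False by blast
      qed
      define F where "F = (\<lambda>(u, v). (1 - c s u) + real (vd u v) + (1 - c t v)) ` (supp (c s) \<times> supp (c t))"
      have eq: "gd (c s) (c t) = Min F" using False c_pt s t by (simp add: graph_dist_def F_def)
      have F: "x \<in> F \<longleftrightarrow> (\<exists>k\<le>n. \<exists>m\<le>n. \<bar>s - real k\<bar> < 1 \<and> \<bar>t - real m\<bar> < 1 \<and>
          x = \<bar>s - real k\<bar> + \<bar>real k - real m\<bar> + \<bar>t - real m\<bar>)" for x
      proof
        assume "x \<in> F"
        then have "\<exists>u\<in>supp (c s). \<exists>v\<in>supp (c t). x = (1 - c s u) + real (vd u v) + (1 - c t v)"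
          unfolding F_def by force
        then obtain u v where uv: "u \<in> supp (c s)" "v \<in> supp (c t)"
          "x = (1 - c s u) + real (vd u v) + (1 - c t v)" by blast
        obtain k m where km: "k \<le> n" "u = f k" "\<bar>s - real k\<bar> < 1" "m \<le> n" "v = f m" "\<bar>t - real m\<bar> < 1"
          using suppE[OF uv(1)] suppE'[OF uv(2)] by blast
        have "x = \<bar>s - real k\<bar> + \<bar>real k - real m\<bar> + \<bar>t - real m\<bar>"
          using uv(3) km c_val[OF s km(1)] c_val[OF t km(4)] vd_f[OF km(1,4)] by simp
        with km show "\<exists>k\<le>n. \<exists>m\<le>n. \<bar>s - real k\<bar> < 1 \<and> \<bar>t - real m\<bar> < 1 \<and>
          x = \<bar>s - real k\<bar> + \<bar>real k - real m\<bar> + \<bar>t - real m\<bar>" by blast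
      next
        assume "\<exists>k\<le>n. \<exists>m\<le>n. \<bar>s - real k\<bar> < 1 \<and> \<bar>t - real m\<bar> < 1 \<and>
          x = \<bar>s - real k\<bar> + \<bar>real k - real m\<bar> + \<bar>t - real m\<bar>"
        then obtain k m where km: "k \<le> n" "m \<le> n" "\<bar>s - real k\<bar> < 1" "\<bar>t - real m\<bar> < 1"
          "x = \<bar>s - real k\<bar> + \<bar>real k - real m\<bar> + \<bar>t - real m\<bar>" by blast
        then have "x = (1 - c s (f k)) + real (vd (f k) (f m)) + (1 - c t (f m))"
          using c_val[OF s km(1)] c_val[OF t km(2)] vd_f[OF km(1,2)] by simp
        moreover have "f k \<in> supp (c s)" "f m \<in> supp (c t)" using supp_iff s t km by auto
        ultimately show "x \<in> F" unfolding F_def by force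
      qed
      have "Min F = t - s"
      proof (rule Min_eqI)
        show "finite F" unfolding F_def using finite_supp c_pt s t by simp
        show "t - s \<le> x" if "x \<in> F" for x using that unfolding F by auto
        show "t - s \<in> F" unfolding F
          by (intro exI[of _ i] exI[of _ j] conjI) (use i j ij ijn in auto)
      qed
      then show ?thesis using eq by simp
    qed
  qed
  have main': "gd (c s) (c t) = \<bar>s - t\<bar>" if "0 \<le> s" "s \<le> real n" "0 \<le> t" "t \<le> real n" for s t
  proof (cases "s \<le> t")
    case True then show ?thesis using main that by simp
  next
    case False
    have "gd (c s) (c t) = gd (c t) (c s)"
    proof -
      have com: "on_common_edge E (c s) (c t) \<longleftrightarrow> on_common_edge E (c t) (c s)"
        unfolding on_common_edge_def by blast
      have "(\<lambda>(u, v). (1 - c s u) + real (vd u v) + (1 - c t v)) ` (supp (c s) \<times> supp (c t))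
          = (\<lambda>(u, v). (1 - c t u) + real (vd u v) + (1 - c s v)) ` (supp (c t) \<times> supp (c s))" (is "?L = ?R")
      proof -
        have "vd u v = vd v u" if "u \<in> supp (c s)" "v \<in> supp (c t)" for u v
          using vd_sym supp_V[OF c_pt] \<open>0 \<le> s\<close> \<open>s \<le> real n\<close> \<open>0 \<le> t\<close> \<open>t \<le> real n\<close> that by blast
        then show ?thesis by (force simp: image_iff)
      qed
      then show ?thesis using com by (simp add: graph_dist_def abs_minus_commute Un_commute)
    qed
    then show ?thesis using main[of t s] that False by simp
  qed
  have "c 0 = vx x" using c_int[of 0] f(1) by simp
  moreover have "c (real n) = vx y" using c_int[of n] f(2) by simp
  moreover have "unit_speed \<G> gd (real n) c" using c_pt main' by (simp add: unit_speed_def)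
  ultimately show ?thesis using that[of c] by (simp add: n_def)
qed

lemma gd_vx: assumes "u \<in> V" "v \<in> V" shows "gd (vx u) (vx v) = real (vd u v)"
proof -
  obtain c where c: "c 0 = vx u" "c (vd u v) = vx v" "unit_speed \<G> gd (vd u v) c"
    using vertex_geodesic[OF assms] .
  have "gd (c 0) (c (vd u v)) = \<bar>0 - real (vd u v)\<bar>" by (rule unit_speed_iso[OF c(3)]) auto
  then show ?thesis using c(1,2) by simp
qed

end

section \<open>Cayley graphs\<close>

locale cayley = group G for G (structure) +
  fixes X assumes gen: "finite_generating_set G X"
begin

lemma X_sub: "X \<subseteq> carrier G" and gen_X: "generate G X = carrier G"
  using gen by (auto simp: finite_generating_set_def)

abbreviation "\<E> \<equiv> cayley_edges G X"

lemma edge_translate: assumes "g \<in> carrier G" "(u, v) \<in> \<E>" shows "(g \<otimes> u, g \<otimes> v) \<in> \<E>"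
  using assms X_sub by (auto simp: cayley_edges_def m_assoc[symmetric] subset_eq)

lemma edge_generator: assumes "u \<in> carrier G" "x \<in> X" shows "(u, u \<otimes> x) \<in> \<E>\<^sup>*" "(u, u \<otimes> inv x) \<in> \<E>\<^sup>*"
proof -
  have x: "x \<in> carrier G" using assms X_sub by blast
  have "u = u \<otimes> x \<or> (u, u \<otimes> x) \<in> \<E>" using assms x by (auto simp: cayley_edges_def)
  then show "(u, u \<otimes> x) \<in> \<E>\<^sup>*" by (metis r_into_rtrancl rtrancl.rtrancl_refl)
  have "u = u \<otimes> inv x \<otimes> x" using assms x by (simp add: m_assoc)
  then have "u = u \<otimes> inv x \<or> (u, u \<otimes> inv x) \<in> \<E>" using assms x by (auto simp: cayley_edges_def)
  then show "(u, u \<otimes> inv x) \<in> \<E>\<^sup>*" by (metis r_into_rtrancl rtrancl.rtrancl_refl)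
qed

lemma edge_connected: assumes "u \<in> carrier G" "v \<in> carrier G" shows "(u, v) \<in> \<E>\<^sup>*"
proof -
  have "\<forall>u\<in>carrier G. (u, u \<otimes> g) \<in> \<E>\<^sup>*" if "g \<in> generate G X" for g
    using that
  proof induction
    case (eng g h)
    have gh: "g \<in> carrier G" "h \<in> carrier G" using eng gen_X by auto
    show ?case
    proof
      fix u assume u: "u \<in> carrier G"
      have "(u, u \<otimes> g) \<in> \<E>\<^sup>*" "(u \<otimes> g, u \<otimes> g \<otimes> h) \<in> \<E>\<^sup>*" using eng gh u by auto
      then show "(u, u \<otimes> (g \<otimes> h)) \<in> \<E>\<^sup>*" using gh u by (simp add: m_assoc[symmetric])
    qed
  qed (use edge_generator in auto)
  then have "(u, u \<otimes> (inv u \<otimes> v)) \<in> \<E>\<^sup>*" using assms gen_X by simp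
  then show ?thesis using assms by (simp add: m_assoc[symmetric])
qed

sublocale connected_graph "carrier G" "cayley_edges G X"
proof
  show "\<E> \<subseteq> carrier G \<times> carrier G" by (auto simp: cayley_edges_def)
  show "(v, u) \<in> \<E>" if "(u, v) \<in> \<E>" for u v using that by (auto simp: cayley_edges_def)
qed (rule edge_connected)

lemma vd_translate_le: assumes "g \<in> carrier G" "u \<in> carrier G" "v \<in> carrier G" shows "vd (g \<otimes> u) (g \<otimes> v) \<le> vd u v"
proof (rule vd_le)
  have "(g \<otimes> u, g \<otimes> v) \<in> \<E> ^^ n" if "(u, v) \<in> \<E> ^^ n" for n v
    using that
  proof (induction n arbitrary: v)
    case (Suc n)
    then obtain w where "(u, w) \<in> \<E> ^^ n" "(w, v) \<in> \<E>" by auto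
    then have "(g \<otimes> u, g \<otimes> w) \<in> \<E> ^^ n" "(g \<otimes> w, g \<otimes> v) \<in> \<E>"
      using Suc.IH edge_translate assms by auto
    then show ?case by (rule relpow_Suc_I)
  qed auto
  then show "(g \<otimes> u, g \<otimes> v) \<in> \<E> ^^ vd u v" using vd_path assms by blast
qed

lemma vd_translate: assumes "g \<in> carrier G" "u \<in> carrier G" "v \<in> carrier G" shows "vd (g \<otimes> u) (g \<otimes> v) = vd u v"
proof (rule antisym[OF vd_translate_le[OF assms]])
  have "vd (inv g \<otimes> (g \<otimes> u)) (inv g \<otimes> (g \<otimes> v)) \<le> vd (g \<otimes> u) (g \<otimes> v)"
    using assms by (intro vd_translate_le) auto
  then show "vd u v \<le> vd (g \<otimes> u) (g \<otimes> v)" using assms by (simp add: m_assoc[symmetric])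
qed

lemma cayley_graph_eq: "cayley_graph G X = \<G>" and cayley_dist_eq: "cayley_dist G X = gd"
  by (simp_all add: cayley_graph_def cayley_dist_def)

end

text \<open>When generators go to generators, each edge goes to an edge or collapses to a vertex.
  This serves both the inclusions of the factors and the retractions onto them.\<close>

lemma hom_vertex_dist_le:
  assumes G: "cayley G X" and K: "cayley K Z" and \<phi>: "\<phi> \<in> hom G K" "\<phi> ` X \<subseteq> Z"
    and uv: "u \<in> carrier G" "v \<in> carrier G"
  shows "vertex_dist (cayley_edges K Z) (\<phi> u) (\<phi> v) \<le> vertex_dist (cayley_edges G X) u v"
proof -
  interpret G: cayley G X by (rule G)
  interpret K: cayley K Z by (rule K)
  have \<phi>_in: "\<phi> g \<in> carrier K" if "g \<in> carrier G" for g using \<phi>(1) that by (auto simp: hom_def)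
  have "K.vd (\<phi> u) (\<phi> v) \<le> n \<and> v \<in> carrier G" if "(u, v) \<in> G.\<E> ^^ n" for v n
    using that
  proof (induction n arbitrary: v)
    case (Suc n)
    then obtain w where w: "(u, w) \<in> G.\<E> ^^ n" "(w, v) \<in> G.\<E>" by auto
    then have c: "w \<in> carrier G" "v \<in> carrier G" by (auto simp: cayley_edges_def)
    obtain x where x: "x \<in> X" "v = w \<otimes>\<^bsub>G\<^esub> x \<or> w = v \<otimes>\<^bsub>G\<^esub> x" using w(2) by (auto simp: cayley_edges_def)
    then have "\<phi> v = \<phi> w \<otimes>\<^bsub>K\<^esub> \<phi> x \<or> \<phi> w = \<phi> v \<otimes>\<^bsub>K\<^esub> \<phi> x"
      using hom_mult[OF \<phi>(1)] c G.X_sub by blast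
    moreover have "\<phi> x \<in> Z" using \<phi>(2) x by blast
    ultimately have "\<phi> w = \<phi> v \<or> (\<phi> w, \<phi> v) \<in> K.\<E>" using c \<phi>_in unfolding cayley_edges_def by auto
    then have "K.vd (\<phi> w) (\<phi> v) \<le> 1" by (rule K.vd_edge)
    moreover have "K.vd (\<phi> u) (\<phi> v) \<le> K.vd (\<phi> u) (\<phi> w) + K.vd (\<phi> w) (\<phi> v)"
      using c uv \<phi>_in by (intro K.vd_triangle)
    ultimately show ?case using Suc.IH[OF w(1)] c by simp
  qed (use uv in simp)
  from this[OF G.vd_path[OF uv]] show ?thesis by simp
qed

section \<open>The hyperbolicity function\<close>

lemma geodesic_triangle_rotate: "(A, B, C) \<in> geodesic_triangles M d t \<Longrightarrow> (B, C, A) \<in> geodesic_triangles M d t"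
  unfolding geodesic_triangles_def
proof clarsimp
  fix x y z
  assume "x \<in> M" "y \<in> M" "z \<in> M" "geodesic_segment M d x y A" "geodesic_segment M d y z B"
    "geodesic_segment M d z x C" "d x y + d y z + d z x \<le> t"
  then show "\<exists>x\<in>M. \<exists>y\<in>M. geodesic_segment M d x y B \<and> (\<exists>z\<in>M. geodesic_segment M d y z C \<and>
      geodesic_segment M d z x A \<and> d x y + d y z + d z x \<le> t)"
    by (intro bexI[of _ y] bexI[of _ z] bexI[of _ x] conjI) auto
qed

context
  fixes M :: "'a set" and d :: "'a \<Rightarrow> 'a \<Rightarrow> real"
  assumes d0: "\<And>x y. 0 \<le> d x y"
begin

lemma geodesic_ends: "geodesic_segment M d x y S \<Longrightarrow> x \<in> S \<and> y \<in> S"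
  unfolding geodesic_segment_iff using d0 by force

lemma dist_to_set_le: "q \<in> S \<Longrightarrow> dist_to_set d p S \<le> d p q"
  unfolding dist_to_set_def using d0 by (intro cINF_lower bdd_belowI2) auto

text \<open>The corner \<open>x\<close> of the side \<open>A\<close> also lies on \<open>C\<close>,
  and it is no further from \<open>p\<close> than the length of \<open>A\<close>. The suprema of
  reals below are thereby taken over bounded sets.\<close>

lemma side_dist_bounds:
  assumes T: "(A, B, C) \<in> geodesic_triangles M d t" and p: "p \<in> A"
  shows "0 \<le> dist_to_set d p (B \<union> C) \<and> dist_to_set d p (B \<union> C) \<le> t"
proof -
  obtain x y z where g: "geodesic_segment M d x y A" "geodesic_segment M d z x C"
    and t: "d x y + d y z + d z x \<le> t" using T unfolding geodesic_triangles_def by blast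
  have xC: "x \<in> C" using geodesic_ends[OF g(2)] by simp
  obtain c where c: "c 0 = x" "A = c ` {0..d x y}" "unit_speed M d (d x y) c"
    using g(1) unfolding geodesic_segment_iff by auto
  obtain s where s: "s \<in> {0..d x y}" "p = c s" using p c(2) by blast
  have "dist_to_set d p (B \<union> C) \<le> d p x" using xC by (intro dist_to_set_le) simp
  also have "d p x = s" using unit_speed_iso[OF c(3), of s 0] s c(1) d0[of x y] by simp
  also have "s \<le> t" using s t d0[of y z] d0[of z x] by simp
  finally have "dist_to_set d p (B \<union> C) \<le> t" .
  moreover have "0 \<le> dist_to_set d p (B \<union> C)"
    unfolding dist_to_set_def using xC d0 by (intro cINF_greatest) auto
  ultimately show ?thesis by simp
qed

lemma triangle_delta_range:
  assumes T: "(A, B, C) \<in> geodesic_triangles M d t"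
  shows "0 \<le> triangle_delta d (A, B, C)" "triangle_delta d (A, B, C) \<le> t"
    and "p \<in> A \<Longrightarrow> dist_to_set d p (B \<union> C) \<le> triangle_delta d (A, B, C)"
proof -
  define S where "S = (\<lambda>p. dist_to_set d p (B \<union> C)) ` A \<union> (\<lambda>p. dist_to_set d p (A \<union> C)) ` B \<union>
    (\<lambda>p. dist_to_set d p (A \<union> B)) ` C"
  note T' = geodesic_triangle_rotate[OF T]
  note T'' = geodesic_triangle_rotate[OF T']
  have r: "0 \<le> x \<and> x \<le> t" if "x \<in> S" for x
    using that side_dist_bounds[OF T] side_dist_bounds[OF T'] side_dist_bounds[OF T'']
    unfolding S_def by (auto simp: Un_commute)
  have bdd: "bdd_above S" using r by (intro bdd_aboveI[of _ t]) blast
  obtain a where a: "a \<in> A" using T geodesic_ends unfolding geodesic_triangles_def by blast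
  then have ne: "dist_to_set d a (B \<union> C) \<in> S" by (simp add: S_def)
  have eq: "triangle_delta d (A, B, C) = Sup S" by (simp add: S_def)
  show "0 \<le> triangle_delta d (A, B, C)" unfolding eq
    using r[OF ne] cSup_upper[OF ne bdd] by linarith
  show "triangle_delta d (A, B, C) \<le> t" unfolding eq using r ne by (intro cSup_least) auto
  show "dist_to_set d p (B \<union> C) \<le> triangle_delta d (A, B, C)" if "p \<in> A"
    unfolding eq by (rule cSup_upper[OF _ bdd]) (use that in \<open>simp add: S_def\<close>)
qed

lemma bdd_above_triangle_delta: "bdd_above (triangle_delta d ` geodesic_triangles M d t)"
proof (rule bdd_aboveI2)
  fix T assume "T \<in> geodesic_triangles M d t"
  then show "triangle_delta d T \<le> t" by (cases T) (use triangle_delta_range(2) in blast)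
qed

text \<open>The distance to the other sides is an infimum, and the slack of 1 provides a point that
  nearly attains it; after division by the scale the slack disappears.\<close>

lemma hyperbolicity_function_slim:
  assumes T: "(A, B, C) \<in> geodesic_triangles M d t" and p: "p \<in> A"
  shows "\<exists>q\<in>B \<union> C. d p q \<le> hyperbolicity_function M d t + 1"
proof -
  from cSUP_upper[OF T bdd_above_triangle_delta] have "dist_to_set d p (B \<union> C) \<le> hyperbolicity_function M d t"
    using triangle_delta_range(3)[OF T p] unfolding hyperbolicity_function_def by linarith
  then have "Inf (d p ` (B \<union> C)) < hyperbolicity_function M d t + 1" unfolding dist_to_set_def by simp
  moreover have "B \<union> C \<noteq> {}" using T geodesic_ends unfolding geodesic_triangles_def by blast
  ultimately obtain v where "v \<in> d p ` (B \<union> C)" "v < hyperbolicity_function M d t + 1"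
    using cInf_lessD[of "d p ` (B \<union> C)"] by blast
  then show ?thesis by (auto intro: less_imp_le)
qed

context
  fixes b assumes b: "b \<in> M" "d b b = 0"
begin

text \<open>Keeps the family of triangles nonempty, so that the supremum over it has its intended
  value.\<close>

lemma trivial_triangle: assumes "0 \<le> t" shows "({b}, {b}, {b}) \<in> geodesic_triangles M d t"
proof -
  have "geodesic_segment M d b b {b}"
    unfolding geodesic_segment_def using b by (intro exI[of _ "\<lambda>_. b"]) auto
  then show ?thesis unfolding geodesic_triangles_def
    by (simp, intro bexI[of _ b] conjI) (use b assms in auto)
qed

lemma hyperbolicity_function_nonneg: assumes "0 \<le> t" shows "0 \<le> hyperbolicity_function M d t"
proof -
  from cSUP_upper[OF trivial_triangle[OF assms] bdd_above_triangle_delta] show ?thesis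
    using triangle_delta_range(1)[OF trivial_triangle[OF assms]] unfolding hyperbolicity_function_def
    by linarith
qed

text \<open>A number below the two nested suprema is exceeded by some point of some triangle;
  rotating the triangle puts this point on the first side.\<close>

lemma hyperbolicity_function_fat:
  assumes t: "0 \<le> t" and a: "a < hyperbolicity_function M d t"
  obtains A B C p where "(A, B, C) \<in> geodesic_triangles M d t" "p \<in> A" "\<And>q. q \<in> B \<union> C \<Longrightarrow> a < d p q"
proof -
  have "triangle_delta d ` geodesic_triangles M d t \<noteq> {}" using trivial_triangle[OF t] by blast
  then obtain T where T: "T \<in> geodesic_triangles M d t" "a < triangle_delta d T"
    using less_cSupD[of "triangle_delta d ` geodesic_triangles M d t" a] a
    unfolding hyperbolicity_function_def by blast
  obtain A B C where T_eq: "T = (A, B, C)" by (cases T)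
  have ABC: "(A, B, C) \<in> geodesic_triangles M d t" using T T_eq by simp
  define S where "S = (\<lambda>p. dist_to_set d p (B \<union> C)) ` A \<union> (\<lambda>p. dist_to_set d p (A \<union> C)) ` B \<union>
    (\<lambda>p. dist_to_set d p (A \<union> B)) ` C"
  have "A \<noteq> {}" using ABC geodesic_ends unfolding geodesic_triangles_def by blast
  then have "S \<noteq> {}" by (simp add: S_def)
  moreover have "a < Sup S" using T(2) T_eq by (simp add: S_def)
  ultimately obtain v where "v \<in> S" "a < v" using less_cSupD by blast
  then consider p where "p \<in> A" "a < dist_to_set d p (B \<union> C)" | p where "p \<in> B" "a < dist_to_set d p (C \<union> A)"
    | p where "p \<in> C" "a < dist_to_set d p (A \<union> B)" unfolding S_def by (auto simp: Un_commute)
  then show ?thesis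
  proof cases
    case 1 show ?thesis by (rule that[OF ABC 1(1)]) (meson 1(2) dist_to_set_le less_le_trans)
  next
    case 2 show ?thesis by (rule that[OF geodesic_triangle_rotate[OF ABC] 2(1)])
      (meson 2(2) dist_to_set_le less_le_trans)
  next
    case 3 show ?thesis by (rule that[OF geodesic_triangle_rotate[OF geodesic_triangle_rotate[OF ABC]] 3(1)])
      (meson 3(2) dist_to_set_le less_le_trans)
  qed
qed

end

end

section \<open>Cones of Cayley graphs\<close>

context coarse_cone
begin

lemma pt_near:
  assumes f: "f \<in> \<S>" and g: "\<And>n. g n \<in> M" and C: "\<And>n. d (f n) (g n) \<le> C"
  shows "g \<in> \<S>" "pt g = pt f"
proof -
  show g': "g \<in> \<S>" by (rule near_seq[OF f g, where B=0 and c=C]) (use C in auto)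
  have "ld f g \<le> 0"
    by (rule lim_le[OF ld_lim[OF f g'] tendsto_const[of 0], of C])
      (use C lpos in \<open>auto intro!: always_eventually divide_right_mono simp: less_imp_le\<close>)
  then have "ld f g = 0" using ld_nonneg[OF f g'] by simp
  then show "pt g = pt f" using pt_eq_iff[OF f g'] by simp
qed

end

locale cayley_cone = cayley G X +
  coarse_cone "graph_points (carrier G) (cayley_edges G X)" "graph_dist (carrier G) (cayley_edges G X)" 6 \<omega> e l
  for G (structure) and X \<omega> e l
begin

lemma gd_rd: "p \<in> \<G> \<Longrightarrow> gd p (vx (rd p)) \<le> 2"
  using gd_coarse(1)[of p "vx (rd p)"] vx_in rd_in by simp

text \<open>Geodesics of the graph are available between vertices. Rounding the two representing
  sequences moves them by at most 2 and leaves their classes unchanged, and the limit of geodesics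
  between the rounded points joins these classes.\<close>

lemma cone_geodesic:
  assumes "F \<in> \<C>" "F' \<in> \<C>" shows "\<exists>S. geodesic_segment \<C> \<D> F F' S"
proof -
  obtain f g where f: "f \<in> \<S>" "F = pt f" and g: "g \<in> \<S>" "F' = pt g" using assms cone_E by metis
  define L where "L n = real (vd (rd (f n)) (rd (g n)))" for n
  have V: "rd (f n) \<in> carrier G" "rd (g n) \<in> carrier G" for n using f g seq_in rd_in by auto
  have "\<exists>c. c 0 = vx (rd (f n)) \<and> c (L n) = vx (rd (g n)) \<and> unit_speed \<G> gd (L n) c" for n
    using vertex_geodesic[OF V] unfolding L_def by metis
  then obtain c where c: "\<And>n. c n 0 = vx (rd (f n))" "\<And>n. c n (L n) = vx (rd (g n))"
    "\<And>n. unit_speed \<G> gd (L n) (c n)" by metis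
  have start: "(\<lambda>n. c n 0) \<in> \<S>" "pt (\<lambda>n. c n 0) = F"
    unfolding c f(2) using pt_near[OF f(1), of "\<lambda>n. vx (rd (f n))" 2] gd_rd[OF seq_in[OF f(1)]] vx_in V by auto
  have stop: "(\<lambda>n. c n (L n)) \<in> \<S>" "pt (\<lambda>n. c n (L n)) = F'"
    unfolding c g(2) using pt_near[OF g(1), of "\<lambda>n. vx (rd (g n))" 2] gd_rd[OF seq_in[OF g(1)]] vx_in V by auto
  have Ld: "\<bar>gd (c n 0) (c n (L n)) - 0\<bar> = L n" for n
    using unit_speed_iso[OF c(3), of 0 n "L n"] by (simp add: L_def)
  have eqL: "(\<lambda>n. L n / l n) = (\<lambda>n. gd (c n 0) (c n (L n)) / l n)" using Ld nonneg by auto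
  define \<Lambda> where "\<Lambda> = ld (\<lambda>n. c n 0) (\<lambda>n. c n (L n))"
  have lim: "((\<lambda>n. L n / l n) \<longlongrightarrow> \<Lambda>) \<omega>"
    unfolding eqL \<Lambda>_def by (rule ld_lim[OF start(1) stop(1)])
  have \<Lambda>_eq: "\<D> F F' = \<Lambda>" unfolding \<Lambda>_def start(2)[symmetric] stop(2)[symmetric]
    by (rule dist_pt[OF start(1) stop(1)])
  obtain B where B: "\<And>n. L n \<le> B * l n" using seq_dist_bound[OF start(1) stop(1)] Ld nonneg by auto
  have L0: "0 \<le> L n" for n by (simp add: L_def)
  note lp = unit_speed_in[OF c(3)]
  have iso: "\<bar>gd (c n s) (c n t) - \<bar>s - t\<bar>\<bar> \<le> 0" if "0 \<le> s" "s \<le> L n" "0 \<le> t" "t \<le> L n" for n s t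
    using unit_speed_iso[OF c(3) that] by simp
  have "\<Lambda> \<ge> 0" using \<Lambda>_eq cone.nonneg by metis
  have "unit_speed \<C> \<D> \<Lambda> (limit_path c L)"
    unfolding unit_speed_def
    using limit_path_in[OF lp iso L0 start(1) lim] limit_path_dist[OF lp iso L0 start(1) lim] by auto
  moreover have "limit_path c L 0 = F" using limit_path_0[OF lp iso L0 start(1) lim] start(2) by simp
  moreover have "limit_path c L \<Lambda> = F'"
    using limit_path_eq[OF lp iso L0 start(1) lim L0 order_refl B lim] stop(2) by simp
  ultimately show ?thesis unfolding geodesic_segment_iff \<Lambda>_eq by blast
qed

text \<open>Left translation moves the first corner of each fat triangle near \<open>e n\<close>. As
  the perimeters are at most \<open>l n\<close>, the sides have limits in the cone, and a point
  whose distance to the other two sides exceeds \<open>r * l n\<close> becomes a point on neither of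
  them, which a real tree excludes.\<close>

lemma fat_triangles_in_cone:
  assumes T: "real_tree \<C> \<D>" and r: "0 < r"
  shows "\<not> eventually (\<lambda>n. r * l n < hyperbolicity_function \<G> gd (l n)) \<omega>"
proof
  assume bad: "eventually (\<lambda>n. r * l n < hyperbolicity_function \<G> gd (l n)) \<omega>"
  have o1: "vx \<one> \<in> \<G>" "gd (vx \<one>) (vx \<one>) = 0" using vx_in gd_refl by auto
  \<comment> \<open>A triangle is needed at every index. Where no fat one is available, a constant
    one fills in and the final implication is vacuous.\<close>
  have "\<exists>\<alpha> \<beta> \<gamma> a b c s. unit_speed \<G> gd a \<alpha> \<and> unit_speed \<G> gd b \<beta> \<and> unit_speed \<G> gd c \<gamma> \<and>
      \<alpha> a = \<beta> 0 \<and> \<beta> b = \<gamma> 0 \<and> \<gamma> c = \<alpha> 0 \<and> 0 \<le> a \<and> 0 \<le> b \<and> 0 \<le> c \<and> a + b + c \<le> l n \<and> 0 \<le> s \<and> s \<le> a \<and>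
      (r * l n < hyperbolicity_function \<G> gd (l n) \<longrightarrow> (\<forall>q\<in>\<beta> ` {0..b} \<union> \<gamma> ` {0..c}. r * l n < gd (\<alpha> s) q))"
    for n
  proof (cases "r * l n < hyperbolicity_function \<G> gd (l n)")
    case True
    have "0 \<le> l n" using lpos[of n] by simp
    from hyperbolicity_function_fat[where d=gd, OF nonneg o1 this True]
    obtain A B C p where T: "(A, B, C) \<in> geodesic_triangles \<G> gd (l n)" "p \<in> A"
      "\<And>q. q \<in> B \<union> C \<Longrightarrow> r * l n < gd p q" by blast
    then obtain x y z where g: "geodesic_segment \<G> gd x y A" "geodesic_segment \<G> gd y z B"
      "geodesic_segment \<G> gd z x C" and per: "gd x y + gd y z + gd z x \<le> l n"
      unfolding geodesic_triangles_def by blast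
    obtain \<alpha> where \<alpha>: "\<alpha> 0 = x" "\<alpha> (gd x y) = y" "A = \<alpha> ` {0..gd x y}" "unit_speed \<G> gd (gd x y) \<alpha>"
      using g(1) unfolding geodesic_segment_iff by blast
    obtain \<beta> where \<beta>: "\<beta> 0 = y" "\<beta> (gd y z) = z" "B = \<beta> ` {0..gd y z}" "unit_speed \<G> gd (gd y z) \<beta>"
      using g(2) unfolding geodesic_segment_iff by blast
    obtain \<gamma> where \<gamma>: "\<gamma> 0 = z" "\<gamma> (gd z x) = x" "C = \<gamma> ` {0..gd z x}" "unit_speed \<G> gd (gd z x) \<gamma>"
      using g(3) unfolding geodesic_segment_iff by blast
    obtain s where s: "0 \<le> s" "s \<le> gd x y" "p = \<alpha> s" using T(2) \<alpha>(3) by auto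
    show ?thesis
      apply (rule exI[of _ \<alpha>], rule exI[of _ \<beta>], rule exI[of _ \<gamma>])
      apply (rule exI[of _ "gd x y"], rule exI[of _ "gd y z"], rule exI[of _ "gd z x"], rule exI[of _ s])
      using \<alpha>(1,2,4) \<beta>(1,2,4) \<gamma>(1,2,4) s(1,2) T(3)[unfolded \<beta>(3) \<gamma>(3) s(3)] per nonneg by simp
  next
    case False
    have "unit_speed \<G> gd 0 (\<lambda>_. vx \<one>)" using o1 by (simp add: unit_speed_def)
    with False show ?thesis
      apply (intro exI[of _ "\<lambda>_. vx \<one>"])
      apply (intro exI[of _ 0])
      using lpos[of n] by (auto simp: less_imp_le)
  qed
  then obtain \<alpha> \<beta> \<gamma> a b c s where
    us: "\<And>n. unit_speed \<G> gd (a n) (\<alpha> n)" "\<And>n. unit_speed \<G> gd (b n) (\<beta> n)" "\<And>n. unit_speed \<G> gd (c n) (\<gamma> n)"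
    and corners: "\<And>n. \<alpha> n (a n) = \<beta> n 0" "\<And>n. \<beta> n (b n) = \<gamma> n 0" "\<And>n. \<gamma> n (c n) = \<alpha> n 0"
    and len: "\<And>n. 0 \<le> a n" "\<And>n. 0 \<le> b n" "\<And>n. 0 \<le> c n" "\<And>n. a n + b n + c n \<le> l n"
    and s: "\<And>n. 0 \<le> s n" "\<And>n. s n \<le> a n"
    and far: "\<And>n. r * l n < hyperbolicity_function \<G> gd (l n) \<Longrightarrow>
        \<forall>q\<in>\<beta> n ` {0..b n} \<union> \<gamma> n ` {0..c n}. r * l n < gd (\<alpha> n (s n)) q"
    by metis
  \<comment> \<open>\<open>g n\<close> moves the rounded corner to the rounded base point. The map
    \<open>\<tau> n\<close> rounds before translating, so it changes distances, but by at most
    2.\<close>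
  define g where "g n = rd (e n) \<otimes> inv (rd (\<alpha> n 0))" for n
  define \<tau> where "\<tau> n p = vx (g n \<otimes> rd p)" for n p
  have \<alpha>0: "\<alpha> n 0 \<in> \<G>" for n using unit_speed_in[OF us(1)] len by auto
  have g: "g n \<in> carrier G" for n unfolding g_def using rd_in \<alpha>0 base by simp
  have \<tau>_in: "p \<in> \<G> \<Longrightarrow> \<tau> n p \<in> \<G>" for n p unfolding \<tau>_def using g rd_in vx_in by simp
  have \<tau>_dist: "\<bar>gd (\<tau> n p) (\<tau> n q) - gd p q\<bar> \<le> 2" if "p \<in> \<G>" "q \<in> \<G>" for n p q
  proof -
    have "gd (\<tau> n p) (\<tau> n q) = vd (rd p) (rd q)"
      unfolding \<tau>_def using g rd_in that by (simp add: gd_vx vd_translate)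
    then show ?thesis using gd_coarse(1)[OF that] by linarith
  qed
  have conv: "\<exists>x. ((\<lambda>n. h n / l n) \<longlongrightarrow> x) \<omega>" if "\<And>n. 0 \<le> h n" "\<And>n. h n \<le> l n" for h
    using that lpos by (intro ultrafilter_convergent[OF ne u, of _ 1] always_eventually)
      (auto simp: abs_of_nonneg less_imp_le)
  obtain a' where a': "((\<lambda>n. a n / l n) \<longlongrightarrow> a') \<omega>" using conv[of a] len by (smt (verit))
  obtain b' where b': "((\<lambda>n. b n / l n) \<longlongrightarrow> b') \<omega>" using conv[of b] len by (smt (verit))
  obtain c' where c': "((\<lambda>n. c n / l n) \<longlongrightarrow> c') \<omega>" using conv[of c] len by (smt (verit))
  obtain s' where s': "((\<lambda>n. s n / l n) \<longlongrightarrow> s') \<omega>" using conv[of s] len s by (smt (verit))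
  have le1: "a n \<le> 1 * l n" "b n \<le> 1 * l n" "c n \<le> 1 * l n" "s n \<le> 1 * l n" for n
    using len(1-4)[of n] s(1,2)[of n] by linarith+
  have lim0: "0 \<le> x" if "((\<lambda>n. h n / l n) \<longlongrightarrow> x) \<omega>" "\<And>n. 0 \<le> h n" for h x
    using tendsto_lowerbound[OF that(1), of 0] that(2) lpos ne by (simp add: less_imp_le)
  have len': "0 \<le> a'" "0 \<le> b'" "0 \<le> c'" "0 \<le> s'" using lim0 a' b' c' s' len s by blast+
  have sa': "s' \<le> a'"
    by (rule tendsto_le[OF ne a' s']) (use s lpos in \<open>auto simp: divide_right_mono less_imp_le\<close>)
  define \<alpha>' \<beta>' \<gamma>' where "\<alpha>' n x = \<tau> n (\<alpha> n x)" and "\<beta>' n x = \<tau> n (\<beta> n x)" and "\<gamma>' n x = \<tau> n (\<gamma> n x)" for n x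
  have in\<alpha>: "\<alpha>' n x \<in> \<G>" if "0 \<le> x" "x \<le> a n" for n x
    unfolding \<alpha>'_def using \<tau>_in unit_speed_in[OF us(1) that] by blast
  have in\<beta>: "\<beta>' n x \<in> \<G>" if "0 \<le> x" "x \<le> b n" for n x
    unfolding \<beta>'_def using \<tau>_in unit_speed_in[OF us(2) that] by blast
  have in\<gamma>: "\<gamma>' n x \<in> \<G>" if "0 \<le> x" "x \<le> c n" for n x
    unfolding \<gamma>'_def using \<tau>_in unit_speed_in[OF us(3) that] by blast
  have iso\<alpha>: "\<bar>gd (\<alpha>' n x) (\<alpha>' n y) - \<bar>x - y\<bar>\<bar> \<le> 2" if "0 \<le> x" "x \<le> a n" "0 \<le> y" "y \<le> a n" for n x y
    using \<tau>_dist[of "\<alpha> n x" "\<alpha> n y" n] unit_speed_in[OF us(1)] unit_speed_iso[OF us(1) that] that by (simp add: \<alpha>'_def)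
  have iso\<beta>: "\<bar>gd (\<beta>' n x) (\<beta>' n y) - \<bar>x - y\<bar>\<bar> \<le> 2" if "0 \<le> x" "x \<le> b n" "0 \<le> y" "y \<le> b n" for n x y
    using \<tau>_dist[of "\<beta> n x" "\<beta> n y" n] unit_speed_in[OF us(2)] unit_speed_iso[OF us(2) that] that by (simp add: \<beta>'_def)
  have iso\<gamma>: "\<bar>gd (\<gamma>' n x) (\<gamma>' n y) - \<bar>x - y\<bar>\<bar> \<le> 2" if "0 \<le> x" "x \<le> c n" "0 \<le> y" "y \<le> c n" for n x y
    using \<tau>_dist[of "\<gamma> n x" "\<gamma> n y" n] unit_speed_in[OF us(3)] unit_speed_iso[OF us(3) that] that by (simp add: \<gamma>'_def)
  have "\<alpha>' n 0 = vx (rd (e n))" for n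
    unfolding \<alpha>'_def \<tau>_def g_def using rd_in \<alpha>0 base by (simp add: m_assoc)
  then have st\<alpha>: "(\<lambda>n. \<alpha>' n 0) \<in> \<S>"
    using pt_near(1)[OF base_seq, of "\<lambda>n. vx (rd (e n))" 2] gd_rd[OF base] vx_in rd_in base by simp
  note P\<alpha> = in\<alpha> iso\<alpha> len(1) st\<alpha> a'
  have corner\<beta>: "\<alpha>' n (a n) = \<beta>' n 0" for n using corners by (simp add: \<alpha>'_def \<beta>'_def)
  \<comment> \<open>Being in the cone is handed on around the triangle: each side starts where the
    preceding one ends.\<close>
  have st\<beta>: "(\<lambda>n. \<beta>' n 0) \<in> \<S>" using limit_path_seq[OF P\<alpha> len(1) order_refl le1(1)] corner\<beta> by simp
  note P\<beta> = in\<beta> iso\<beta> len(2) st\<beta> b'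
  have corner\<gamma>: "\<beta>' n (b n) = \<gamma>' n 0" for n using corners by (simp add: \<beta>'_def \<gamma>'_def)
  have st\<gamma>: "(\<lambda>n. \<gamma>' n 0) \<in> \<S>" using limit_path_seq[OF P\<beta> len(2) order_refl le1(2)] corner\<gamma> by simp
  note P\<gamma> = in\<gamma> iso\<gamma> len(3) st\<gamma> c'
  have corner\<alpha>: "\<gamma>' n (c n) = \<alpha>' n 0" for n using corners by (simp add: \<alpha>'_def \<gamma>'_def)
  have "limit_path \<alpha>' a s' \<in> limit_path \<beta>' b ` {0..b'} \<union> limit_path \<gamma>' c ` {0..c'}"
  proof (rule real_tree_geodesic_triangle[OF T len'(1-3)])
    show "limit_path \<alpha>' a a' = limit_path \<beta>' b 0"
      using limit_path_eq[OF P\<alpha> len(1) order_refl le1(1) a'] limit_path_0[OF P\<beta>] corner\<beta> by simp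
    show "limit_path \<beta>' b b' = limit_path \<gamma>' c 0"
      using limit_path_eq[OF P\<beta> len(2) order_refl le1(2) b'] limit_path_0[OF P\<gamma>] corner\<gamma> by simp
    show "limit_path \<gamma>' c c' = limit_path \<alpha>' a 0"
      using limit_path_eq[OF P\<gamma> len(3) order_refl le1(3) c'] limit_path_0[OF P\<alpha>] corner\<alpha> by simp
  qed (use limit_path_in[OF P\<alpha>] limit_path_in[OF P\<beta>] limit_path_in[OF P\<gamma>] limit_path_dist[OF P\<alpha>]
      limit_path_dist[OF P\<beta>] limit_path_dist[OF P\<gamma>] len' sa' in auto)
  then consider t where "0 \<le> t" "limit_path \<alpha>' a s' = limit_path \<beta>' b t"
    | t where "0 \<le> t" "limit_path \<alpha>' a s' = limit_path \<gamma>' c t" by auto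
  \<comment> \<open>The bound \<open>r\<close> on rescaled distances survives in the limit, since
    the rounding loses only \<open>2 / l n\<close>.\<close>
  moreover have apart: "limit_path \<alpha>' a s' \<noteq> pt (\<lambda>n. \<tau> n (q n))"
    if q: "\<And>n. q n \<in> \<beta> n ` {0..b n} \<union> \<gamma> n ` {0..c n}" and qS: "(\<lambda>n. \<tau> n (q n)) \<in> \<S>" for q
  proof
    assume eq: "limit_path \<alpha>' a s' = pt (\<lambda>n. \<tau> n (q n))"
    have S: "(\<lambda>n. \<alpha>' n (s n)) \<in> \<S>" by (rule limit_path_seq[OF P\<alpha> s le1(4)])
    have "limit_path \<alpha>' a s' = pt (\<lambda>n. \<alpha>' n (s n))" by (rule limit_path_eq[OF P\<alpha> s le1(4) s'])
    then have 0: "ld (\<lambda>n. \<alpha>' n (s n)) (\<lambda>n. \<tau> n (q n)) = 0" using pt_eq_iff[OF S qS] eq by simp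
    have "eventually (\<lambda>n. r \<le> gd (\<alpha>' n (s n)) (\<tau> n (q n)) / l n + 2 / l n) \<omega>"
      using bad
    proof eventually_elim
      case (elim n)
      have "q n \<in> \<G>" using q[of n] unit_speed_in[OF us(2)] unit_speed_in[OF us(3)] by auto
      moreover have "\<alpha> n (s n) \<in> \<G>" using unit_speed_in[OF us(1)] s by auto
      ultimately have "gd (\<alpha> n (s n)) (q n) \<le> gd (\<alpha>' n (s n)) (\<tau> n (q n)) + 2"
        unfolding \<alpha>'_def using \<tau>_dist[of "\<alpha> n (s n)" "q n" n] by linarith
      then have "r * l n \<le> gd (\<alpha>' n (s n)) (\<tau> n (q n)) + 2" using far[OF elim] q[of n] by force
      then show ?case using lpos[of n] by (simp add: field_simps)
    qed
    from lim_le[OF tendsto_const ld_lim[OF S qS] this] 0 r show False by simp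
  qed
  have mb: "0 \<le> min (t * l n) (b n)" "min (t * l n) (b n) \<le> b n" "min (t * l n) (b n) \<le> t * l n"
    "0 \<le> min (t * l n) (c n)" "min (t * l n) (c n) \<le> c n" "min (t * l n) (c n) \<le> t * l n" if "0 \<le> t" for t n
    using that len lpos[of n] by auto
  ultimately show False
  proof cases
    case (1 t)
    have "(\<lambda>n. \<tau> n (\<beta> n (min (t * l n) (b n)))) \<in> \<S>"
      using limit_path_seq[OF P\<beta> mb(1-3)[OF 1(1)]] by (simp add: \<beta>'_def)
    then show False using apart[of "\<lambda>n. \<beta> n (min (t * l n) (b n))"] 1 mb[OF 1(1)]
      by (simp add: limit_path_def \<beta>'_def)
  next
    case (2 t)
    have "(\<lambda>n. \<tau> n (\<gamma> n (min (t * l n) (c n)))) \<in> \<S>"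
      using limit_path_seq[OF P\<gamma> mb(4-6)[OF 2(1)]] by (simp add: \<gamma>'_def)
    then show False using apart[of "\<lambda>n. \<gamma> n (min (t * l n) (c n))"] 2 mb[OF 2(1)]
      by (simp add: limit_path_def \<gamma>'_def)
  qed
qed

text \<open>Along an ultrafilter, not being eventually fat is the same as being eventually not
  fat.\<close>

lemma hyperbolicity_function_sublinear:
  assumes T: "real_tree \<C> \<D>"
  shows "((\<lambda>n. hyperbolicity_function \<G> gd (l n) / l n) \<longlongrightarrow> 0) \<omega>"
proof (rule tendstoI)
  fix r :: real assume r: "0 < r"
  have nn: "0 \<le> hyperbolicity_function \<G> gd (l n)" for n
    
    using hyperbolicity_function_nonneg[where d=gd, OF nonneg vx_in[OF one_closed]] lpos[of n]
      gd_refl[OF vx_in[OF one_closed]] by simp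
  have "eventually (\<lambda>n. \<not> r / 2 * l n < hyperbolicity_function \<G> gd (l n)) \<omega>"
    using fat_triangles_in_cone[OF T, of "r / 2"] u r by auto
  then show "eventually (\<lambda>n. dist (hyperbolicity_function \<G> gd (l n) / l n) 0 < r) \<omega>"
  proof eventually_elim
    case (elim n)
    then have "hyperbolicity_function \<G> gd (l n) / l n \<le> r / 2" using lpos[of n] by (simp add: field_simps)
    then have "hyperbolicity_function \<G> gd (l n) / l n < r" using r by linarith
    then show ?case using nn[of n] lpos[of n] by (simp add: dist_real_def)
  qed
qed

end

section \<open>From slim triangles to the four-point inequality\<close>

text \<open>A discrete form of connectedness: if two properties cover the integers from
  \<open>0\<close> to \<open>n\<close> and hold at opposite ends, then somewhere they hold at equal
  or neighbouring integers.\<close>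

lemma nat_step:
  assumes "P 0" "Q n" "\<And>i. i \<le> n \<Longrightarrow> P i \<or> Q i"
  obtains i j :: nat where "i \<le> n" "j \<le> n" "P i" "Q j" "i \<le> j" "j \<le> Suc i"
  using assms
proof (induction n arbitrary: thesis)
  case 0
  then show ?case by auto
next
  case (Suc n)
  show ?case
  proof (cases "Q n")
    case True
    from Suc.prems(2,4) True obtain i j where "i \<le> n" "j \<le> n" "P i" "Q j" "i \<le> j" "j \<le> Suc i"
      by (rule_tac Suc.IH) auto
    then show ?thesis using Suc.prems(1)[of i j] by simp
  next
    case False
    then show ?thesis using Suc.prems(1)[of n "Suc n"] Suc.prems(3) Suc.prems(4)[of n] by simp
  qed
qed

text \<open>Twice the Gromov product of \<open>x\<close> and \<open>y\<close> at \<open>w\<close>;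
  the doubling avoids fractions.\<close>

definition gromov2 :: "('a \<Rightarrow> 'a \<Rightarrow> nat) \<Rightarrow> 'a \<Rightarrow> 'a \<Rightarrow> 'a \<Rightarrow> real" where
  "gromov2 D w x y = real (D w x) + real (D w y) - real (D x y)"

context connected_graph
begin

abbreviation md :: "('a \<Rightarrow> real) \<Rightarrow> ('a \<Rightarrow> real) \<Rightarrow> real" where "md p q \<equiv> real (vd (rd p) (rd q))"

lemma md_sym: "p \<in> \<G> \<Longrightarrow> q \<in> \<G> \<Longrightarrow> md p q = md q p"
  using vd_sym rd_in by simp

lemma md_triangle: "p \<in> \<G> \<Longrightarrow> q \<in> \<G> \<Longrightarrow> r \<in> \<G> \<Longrightarrow> md p r \<le> md p q + md q r"
  using vd_triangle[of "rd p" "rd q" "rd r"] rd_in by simp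

lemma md_gd: "p \<in> \<G> \<Longrightarrow> q \<in> \<G> \<Longrightarrow> \<bar>gd p q - md p q\<bar> \<le> 2"
  by (rule gd_coarse(1))

text \<open>For \<open>gd\<close> the distances to the two ends add up exactly; rounding each of
  them costs 2.\<close>

lemma segment_between:
  assumes x: "x \<in> V" and y: "y \<in> V" and S: "geodesic_segment \<G> gd (vx x) (vx y) S" and q: "q \<in> S"
  shows "q \<in> \<G>" "md (vx x) q + md q (vx y) \<le> real (vd x y) + 4"
proof -
  obtain c where c: "c 0 = vx x" "c (vd x y) = vx y" "S = c ` {0..real (vd x y)}" "unit_speed \<G> gd (vd x y) c"
    using S unfolding geodesic_segment_iff gd_vx[OF x y] by blast
  obtain s where s: "0 \<le> s" "s \<le> real (vd x y)" "q = c s" using q c(3) by auto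
  show qG: "q \<in> \<G>" using unit_speed_in[OF c(4)] s by simp
  have "gd (vx x) q = s" "gd q (vx y) = vd x y - s"
    using unit_speed_iso[OF c(4), of 0 s] unit_speed_iso[OF c(4), of s "vd x y"] c(1,2) s by auto
  then show "md (vx x) q + md q (vx y) \<le> real (vd x y) + 4"
    using md_gd[OF vx_in[OF x] qG] md_gd[OF qG vx_in[OF y]] by linarith
qed

text \<open>
  Walking along \<open>S\<close> from \<open>x\<close> to \<open>y\<close> one passes from points close to \<open>[w, x]\<close> to points close to
  \<open>[y, w]\<close>; where this happens, the distance to \<open>w\<close> is about the Gromov product of \<open>x\<close> and \<open>y\<close>.
\<close>

lemma slim_triangle_near_point:
  assumes V: "w \<in> V" "x \<in> V" "y \<in> V"
    and S: "geodesic_segment \<G> gd (vx x) (vx y) S" and B: "geodesic_segment \<G> gd (vx y) (vx w) B"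
    and C: "geodesic_segment \<G> gd (vx w) (vx x) C"
    and slim: "\<And>p. p \<in> S \<Longrightarrow> \<exists>q\<in>B \<union> C. gd p q \<le> \<delta>" and \<delta>: "0 \<le> \<delta>"
  obtains p where "p \<in> S" "2 * md (vx w) p \<le> gromov2 vd w x y + 4 * \<delta> + 40"
proof -
  define n where "n = vd x y"
  obtain c where c: "c 0 = vx x" "c n = vx y" "S = c ` {0..real n}" "unit_speed \<G> gd n c"
    using S unfolding geodesic_segment_iff gd_vx[OF V(2,3)] n_def by blast
  have xC: "vx x \<in> C" and yB: "vx y \<in> B"
    using geodesic_ends[where d=gd, OF nonneg B] geodesic_ends[where d=gd, OF nonneg C] by auto
  have cG: "c (real i) \<in> \<G>" "c (real i) \<in> S" if "i \<le> n" for i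
    using that unit_speed_in[OF c(4), of i] c(3) by auto
  \<comment> \<open>Closeness to the two other sides is sampled at integer parameters only, so the
    change of side happens between points at most one apart.\<close>
  define P where "P i \<longleftrightarrow> (\<exists>q\<in>C. gd (c (real i)) q \<le> \<delta>)" for i
  define Q where "Q i \<longleftrightarrow> (\<exists>q\<in>B. gd (c (real i)) q \<le> \<delta>)" for i
  have "P 0" unfolding P_def using xC c(1) gd_refl[OF vx_in[OF V(2)]] \<delta> by (intro bexI[of _ "vx x"]) auto
  moreover have "Q n" unfolding Q_def using yB c(2) gd_refl[OF vx_in[OF V(3)]] \<delta> by (intro bexI[of _ "vx y"]) auto
  moreover have "P i \<or> Q i" if "i \<le> n" for i unfolding P_def Q_def using slim cG(2)[OF that] by blast
  ultimately obtain i j where ij: "i \<le> n" "j \<le> n" "P i" "Q j" "i \<le> j" "j \<le> Suc i"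
    by (rule nat_step)
  obtain q r where q: "q \<in> C" "gd (c (real i)) q \<le> \<delta>" and r: "r \<in> B" "gd (c (real j)) r \<le> \<delta>"
    using ij unfolding P_def Q_def by blast
  define p p' where "p = c (real i)" and "p' = c (real j)"
  have G: "p \<in> \<G>" "p' \<in> \<G>" "vx w \<in> \<G>" "vx x \<in> \<G>" "vx y \<in> \<G>"
    using cG ij vx_in V by (auto simp: p_def p'_def)
  note sq = segment_between[OF V(1,2) C q(1)]
  note sr = segment_between[OF V(3,1) B r(1)]
  have pp': "md p p' \<le> 3"
    using md_gd[OF G(1,2)] unit_speed_iso[OF c(4), of i j] ij by (simp add: p_def p'_def)
  have qp: "md q p \<le> \<delta> + 2" using md_gd[OF G(1) sq(1)] q(2) md_sym[OF G(1) sq(1)] by (simp add: p_def)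
  have rp: "md r p' \<le> \<delta> + 2" using md_gd[OF G(2) sr(1)] r(2) md_sym[OF G(2) sr(1)] by (simp add: p'_def)
  have "real i \<le> md p (vx x) + 2"
    using md_gd[OF G(1,4)] unit_speed_iso[OF c(4), of i 0] ij c(1) by (simp add: p_def)
  moreover have "real n - real j \<le> md p' (vx y) + 2"
    using md_gd[OF G(2,5)] unit_speed_iso[OF c(4), of j n] ij c(2) by (simp add: p'_def)
  moreover have "md (vx w) p \<le> md (vx w) q + md q p" "md p (vx x) \<le> md q p + md q (vx x)"
    using md_triangle[OF G(3) sq(1) G(1)] md_triangle[OF G(1) sq(1) G(4)] md_sym[OF G(1) sq(1)] by auto
  moreover have "md (vx w) p' \<le> md (vx w) r + md r p'" "md p' (vx y) \<le> md r p' + md r (vx y)"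
    using md_triangle[OF G(3) sr(1) G(2)] md_triangle[OF G(2) sr(1) G(5)] md_sym[OF G(2) sr(1)] by auto
  moreover have "md (vx w) p \<le> md (vx w) p' + md p p'"
    using md_triangle[OF G(3) G(2) G(1)] md_sym[OF G(1,2)] by auto
  moreover have "md r (vx w) = md (vx w) r" "md (vx y) r = md r (vx y)"
    using md_sym[OF G(3) sr(1)] md_sym[OF G(5) sr(1)] by auto
  moreover have "real (vd y w) = real (vd w y)" using vd_sym V by simp
  moreover have "real j \<le> real i + 1" using ij by simp
  \<comment> \<open>The sum contains four detours of at most \<open>\<delta> + 2\<close>, the excess
    4 of either segment, and small rounding terms. Altogether 24 would suffice.\<close>
  ultimately have "2 * md (vx w) p \<le> real (vd w x) + real (vd w y) - real n + 4 * \<delta> + 40"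
    using sq(2) sr(2) qp rp pp' by linarith
  then show ?thesis using that[of p] cG(2)[OF ij(1)] by (simp add: gromov2_def n_def p_def)
qed

text \<open>The triangle on \<open>w\<close>, \<open>x\<close>, \<open>z\<close> yields a point
  \<open>p\<close> of \<open>S\<close> whose distance to \<open>w\<close> is about the Gromov
  product of \<open>x\<close> and \<open>z\<close>. The triangle on \<open>x\<close>,
  \<open>y\<close>, \<open>z\<close> has the same side \<open>S\<close>, so \<open>p\<close> is
  close to a point \<open>q\<close> of one of its other sides, and the distance from
  \<open>w\<close> to \<open>q\<close> bounds the Gromov product of the ends of that side.\<close>

lemma slim_four_point:
  assumes V: "w \<in> V" "x \<in> V" "y \<in> V" "z \<in> V"
    and t: "\<And>u v. u \<in> {w, x, y, z} \<Longrightarrow> v \<in> {w, x, y, z} \<Longrightarrow> 3 * real (vd u v) \<le> t"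
  shows "min (gromov2 vd w x y) (gromov2 vd w y z) \<le>
    gromov2 vd w x z + 6 * hyperbolicity_function \<G> gd t + 60"
proof -
  define \<delta> where "\<delta> = hyperbolicity_function \<G> gd t + 1"
  have "0 \<le> t" using t[of w w] by simp
  then have \<delta>: "0 \<le> \<delta>"
    using hyperbolicity_function_nonneg[where d=gd, OF nonneg vx_in[OF V(1)] gd_refl[OF vx_in[OF V(1)]]]
    by (simp add: \<delta>_def)
  have seg: "\<exists>S. geodesic_segment \<G> gd (vx u) (vx v) S" if "u \<in> V" "v \<in> V" for u v
    using vertex_geodesic[OF that] unfolding geodesic_segment_iff gd_vx[OF that] by metis
  obtain S B C A A' where S: "geodesic_segment \<G> gd (vx x) (vx z) S"
    and B: "geodesic_segment \<G> gd (vx z) (vx w) B" and C: "geodesic_segment \<G> gd (vx w) (vx x) C"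
    and A: "geodesic_segment \<G> gd (vx z) (vx y) A" and A': "geodesic_segment \<G> gd (vx y) (vx x) A'"
    using seg V by metis
  have tri: "(S, B, C) \<in> geodesic_triangles \<G> gd t" "(S, A, A') \<in> geodesic_triangles \<G> gd t"
  proof -
    have "gd (vx x) (vx z) + gd (vx z) (vx w) + gd (vx w) (vx x) \<le> t"
      using t[of x z] t[of z w] t[of w x] by (simp add: gd_vx V)
    then show "(S, B, C) \<in> geodesic_triangles \<G> gd t" unfolding geodesic_triangles_def
      using S B C vx_in V by blast
    have "gd (vx x) (vx z) + gd (vx z) (vx y) + gd (vx y) (vx x) \<le> t"
      using t[of x z] t[of z y] t[of y x] by (simp add: gd_vx V)
    then show "(S, A, A') \<in> geodesic_triangles \<G> gd t" unfolding geodesic_triangles_def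
      using S A A' vx_in V by blast
  qed
  have slim: "\<exists>q\<in>B \<union> C. gd p q \<le> \<delta>" "\<exists>q\<in>A \<union> A'. gd p q \<le> \<delta>" if "p \<in> S" for p
    using hyperbolicity_function_slim[where d=gd, OF nonneg tri(1) that]
      hyperbolicity_function_slim[where d=gd, OF nonneg tri(2) that] by (auto simp: \<delta>_def)
  obtain p where p: "p \<in> S" "2 * md (vx w) p \<le> gromov2 vd w x z + 4 * \<delta> + 40"
    using slim_triangle_near_point[OF V(1,2,4) S B C slim(1) \<delta>] by blast
  obtain q where q: "q \<in> A \<union> A'" "gd p q \<le> \<delta>" using slim(2)[OF p(1)] by blast
  have pG: "p \<in> \<G>" using segment_between(1)[OF V(2,4) S p(1)] .
  have far: "gromov2 vd w u v \<le> 2 * md (vx w) q + 4" and qG: "q \<in> \<G>"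
    if uv: "u \<in> V" "v \<in> V" "geodesic_segment \<G> gd (vx u) (vx v) T" "q \<in> T" for u v T
  proof -
    show qG: "q \<in> \<G>" using segment_between(1)[OF uv] .
    have "md (vx w) (vx u) \<le> md (vx w) q + md q (vx u)" "md (vx w) (vx v) \<le> md (vx w) q + md q (vx v)"
      using md_triangle[OF vx_in[OF V(1)] qG vx_in[OF uv(1)]] md_triangle[OF vx_in[OF V(1)] qG vx_in[OF uv(2)]]
      by auto
    then show "gromov2 vd w u v \<le> 2 * md (vx w) q + 4"
      using segment_between(2)[OF uv] md_sym[OF vx_in[OF uv(1)] qG] by (simp add: gromov2_def)
  qed
  have sym: "gromov2 vd w y x = gromov2 vd w x y" "gromov2 vd w z y = gromov2 vd w y z"
    using vd_sym V by (auto simp: gromov2_def)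
  have "min (gromov2 vd w x y) (gromov2 vd w y z) \<le> 2 * md (vx w) q + 4" and qG': "q \<in> \<G>"
    using q(1) far[OF V(4,3) A] far[OF V(3,2) A'] qG[OF V(4,3) A] qG[OF V(3,2) A'] sym by auto
  moreover have "md (vx w) q \<le> md (vx w) p + md p q"
    using md_triangle[OF vx_in[OF V(1)] pG qG'] .
  moreover have "md p q \<le> \<delta> + 2" using md_gd[OF pG qG'] q(2) by linarith
  \<comment> \<open>The terms sum to \<open>6 * F + 54\<close>: \<open>4 * F + 44\<close> from the
    choice of \<open>p\<close>, \<open>2 * F + 6\<close> from passing to \<open>q\<close>, and 4
    from rounding.\<close>
  moreover have "m \<le> g + 6 * F + 60"
    if "m \<le> 2 * wq + 4" "wq \<le> wp + pq" "pq \<le> F + 1 + 2" "2 * wp \<le> g + 4 * (F + 1) + 40"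
    for m g F wq wp pq :: real using that by argo
  ultimately show ?thesis using p(2) unfolding \<delta>_def by blast
qed

end

section \<open>The free product is a group\<close>

text \<open>
  Letters of both kinds are treated at once: \<open>letter_mult\<close> is meant for two letters of the same
  kind only.
\<close>

locale two_groups = G: group G + H: group H for G :: "('a, 'c) monoid_scheme" and H :: "('b, 'd) monoid_scheme"
begin

definition letter :: "'a + 'b \<Rightarrow> bool" where
  "letter x \<longleftrightarrow> (case x of Inl a \<Rightarrow> a \<in> carrier G | Inr b \<Rightarrow> b \<in> carrier H)"

definition trivial :: "'a + 'b \<Rightarrow> bool" where
  "trivial x \<longleftrightarrow> x = Inl \<one>\<^bsub>G\<^esub> \<or> x = Inr \<one>\<^bsub>H\<^esub>"

fun letter_mult :: "'a + 'b \<Rightarrow> 'a + 'b \<Rightarrow> 'a + 'b" where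
  "letter_mult (Inl a) (Inl b) = Inl (a \<otimes>\<^bsub>G\<^esub> b)"
| "letter_mult (Inr a) (Inr b) = Inr (a \<otimes>\<^bsub>H\<^esub> b)"
| "letter_mult x y = x"

fun letter_inv :: "'a + 'b \<Rightarrow> 'a + 'b" where
  "letter_inv (Inl a) = Inl (inv\<^bsub>G\<^esub> a)"
| "letter_inv (Inr b) = Inr (inv\<^bsub>H\<^esub> b)"

abbreviation "\<R> \<equiv> reduced_words G H"
abbreviation "P \<equiv> free_product G H"

text \<open>Extends left multiplication by a letter to trivial letters, so that the letters of one
  kind form a whole group acting on reduced words.\<close>

definition act :: "'a + 'b \<Rightarrow> ('a + 'b) list \<Rightarrow> ('a + 'b) list" where
  "act x w = (if trivial x then w else fp_cons G H x w)"

definition \<iota> :: "'a + 'b \<Rightarrow> ('a + 'b) list" where "\<iota> x = (if trivial x then [] else [x])"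

section \<open>The action of letters on reduced words\<close>

lemma fp_cons_Nil: "fp_cons G H x [] = [x]" by (cases x) auto

lemma fp_cons_Cons:
  "fp_cons G H x (y # w) = (if isl x = isl y then
     (if trivial (letter_mult x y) then w else letter_mult x y # w) else x # y # w)"
  by (cases x; cases y) (auto simp: trivial_def)

lemma letter_mult:
  assumes "letter x" "letter y" "isl x = isl y"
  shows "letter (letter_mult x y)" "isl (letter_mult x y) = isl x"
  using assms by (cases x; cases y; auto simp: letter_def)+

lemma letter_assoc:
  assumes "letter x" "letter y" "letter z" "isl x = isl y" "isl y = isl z"
  shows "letter_mult (letter_mult x y) z = letter_mult x (letter_mult y z)"
  using assms by (cases x; cases y; cases z) (auto simp: letter_def G.m_assoc H.m_assoc)

lemma letter_mult_trivial:
  assumes "letter x" "letter y" "isl x = isl y"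
  shows "trivial x \<Longrightarrow> letter_mult x y = y" "trivial y \<Longrightarrow> letter_mult x y = x"
  using assms by (cases x; cases y; auto simp: letter_def trivial_def)+

lemma letter_inv:
  assumes "letter x"
  shows "letter (letter_inv x)" "isl (letter_inv x) = isl x" "trivial (letter_mult (letter_inv x) x)"
    "trivial (letter_inv x) \<longleftrightarrow> trivial x"
  using assms by (cases x; auto simp: letter_def trivial_def)+

lemma letter_inv_mult_trivial:
  assumes "letter x" "letter y" "isl x = isl y"
  shows "trivial (letter_mult (letter_inv x) y) \<longleftrightarrow> x = y"
proof -
  have "inv\<^bsub>G\<^esub> a \<otimes>\<^bsub>G\<^esub> b = \<one>\<^bsub>G\<^esub> \<longleftrightarrow> a = b" if "a \<in> carrier G" "b \<in> carrier G" for a b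
    using that G.inv_solve_left[of "\<one>\<^bsub>G\<^esub>" a b] by auto
  moreover have "inv\<^bsub>H\<^esub> a \<otimes>\<^bsub>H\<^esub> b = \<one>\<^bsub>H\<^esub> \<longleftrightarrow> a = b" if "a \<in> carrier H" "b \<in> carrier H" for a b
    using that H.inv_solve_left[of "\<one>\<^bsub>H\<^esub>" a b] by auto
  ultimately show ?thesis using assms by (cases x; cases y) (auto simp: letter_def trivial_def)
qed

lemma reduced_Nil: "[] \<in> \<R>" by (simp add: reduced_words_def)

lemma reduced_iff: "w \<in> \<R> \<longleftrightarrow> (\<forall>x\<in>set w. letter x \<and> \<not> trivial x) \<and> successively (\<lambda>x y. isl x \<noteq> isl y) w"
proof -
  have "x \<in> Inl ` (carrier G - {\<one>\<^bsub>G\<^esub>}) \<union> Inr ` (carrier H - {\<one>\<^bsub>H\<^esub>}) \<longleftrightarrow> letter x \<and> \<not> trivial x" for x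
    by (cases x) (auto simp: letter_def trivial_def)
  then show ?thesis unfolding reduced_words_def by blast
qed

lemma reduced_Cons:
  "x # w \<in> \<R> \<longleftrightarrow> letter x \<and> \<not> trivial x \<and> w \<in> \<R> \<and> (w = [] \<or> isl x \<noteq> isl (hd w))"
  unfolding reduced_iff by (auto simp: successively_Cons)

lemma act_reduced: assumes "letter x" "w \<in> \<R>" shows "act x w \<in> \<R>"
proof (cases w)
  case Nil
  then show ?thesis using assms by (auto simp: act_def fp_cons_Nil reduced_Cons)
next
  case (Cons y v)
  then show ?thesis using assms letter_mult[of x y] by (auto simp: act_def fp_cons_Cons reduced_Cons)
qed

text \<open>The heart of van der Waerden's argument: each factor acts on the reduced words, and
  associativity of the product of words is deduced from this.\<close>

lemma act_act:
  assumes "letter x" "letter y" "isl x = isl y" "w \<in> \<R>"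
  shows "act x (act y w) = act (letter_mult x y) w"
proof -
  \<comment> \<open>In \<open>plain\<close> and \<open>absorb\<close> the result is
    \<open>\<iota>\<close> of a single letter in front of a fixed word. As \<open>\<iota>\<close>
    drops trivial letters, this treats cancellation together with the other cases.\<close>
  have plain: "act z v = \<iota> z @ v" if "v = [] \<or> isl z \<noteq> isl (hd v)" for z v
    using that by (cases v) (auto simp: act_def \<iota>_def fp_cons_Nil fp_cons_Cons)
  have absorb: "act z (u # v) = \<iota> (letter_mult z u) @ v" if "letter z" "letter u" "isl z = isl u" "\<not> trivial u" for z u v
    using that letter_mult_trivial[of z u] by (auto simp: act_def \<iota>_def fp_cons_Cons)
  note xy = letter_mult[OF assms(1-3)]
  show ?thesis
  proof (cases "w = [] \<or> isl y \<noteq> isl (hd w)")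
    case True
    show ?thesis
    proof (cases "trivial y")
      case True
      then show ?thesis using letter_mult_trivial[OF assms(1-3)] by (simp add: act_def)
    next
      case False
      then have "act x (act y w) = \<iota> (letter_mult x y) @ w"
        using plain[OF True] absorb[OF assms(1-3)] by (simp add: \<iota>_def)
      then show ?thesis using plain[of w "letter_mult x y"] True xy assms(3) by simp
    qed
  next
    case False
    then obtain z v where w: "w = z # v" "isl z = isl y" by (cases w) auto
    have z: "letter z" "\<not> trivial z" "v = [] \<or> isl z \<noteq> isl (hd v)" using assms(4) w by (auto simp: reduced_Cons)
    have 1: "act y w = \<iota> (letter_mult y z) @ v" unfolding w using absorb z assms w by simp
    have 2: "act (letter_mult x y) w = \<iota> (letter_mult (letter_mult x y) z) @ v"
      unfolding w(1) using absorb[of "letter_mult x y" z v] z w xy assms(3) by simp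
    have yz: "letter (letter_mult y z)" "isl (letter_mult y z) = isl y"
      using letter_mult[of y z] z w assms by auto
    have "act x (\<iota> (letter_mult y z) @ v) = \<iota> (letter_mult x (letter_mult y z)) @ v"
    proof (cases "trivial (letter_mult y z)")
      case True
      then have "letter_mult x (letter_mult y z) = x"
        using letter_mult_trivial(2)[of x "letter_mult y z"] yz assms by simp
      moreover have "act x v = \<iota> x @ v" using z w assms by (intro plain) auto
      ultimately show ?thesis using True by (simp add: \<iota>_def)
    next
      case False
      then show ?thesis using absorb[of x "letter_mult y z" v] yz assms by (simp add: \<iota>_def)
    qed
    then show ?thesis
      unfolding 1 2 letter_assoc[OF assms(1,2) z(1) assms(3) w(2)[symmetric]] .
  qed
qed

lemma P_simps: "carrier P = \<R>" "\<one>\<^bsub>P\<^esub> = []" "u \<otimes>\<^bsub>P\<^esub> v = foldr (fp_cons G H) u v"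
  by (simp_all add: free_product_def)

lemma foldr_act: "u \<in> \<R> \<Longrightarrow> foldr (fp_cons G H) u v = foldr act u v"
  by (induction u) (auto simp: reduced_Cons act_def)

lemma mult_act: "u \<in> \<R> \<Longrightarrow> u \<otimes>\<^bsub>P\<^esub> v = foldr act u v"
  by (simp add: P_simps foldr_act)

lemma foldr_act_reduced: "(\<And>x. x \<in> set u \<Longrightarrow> letter x) \<Longrightarrow> v \<in> \<R> \<Longrightarrow> foldr act u v \<in> \<R>"
  by (induction u) (auto intro: act_reduced)

text \<open>Reducing \<open>x # u\<close> matters only if \<open>x\<close> merges with the first
  letter of \<open>u\<close>, and merging two letters is compatible with the action by
  \<open>act_act\<close>.\<close>

lemma act_foldr:
  assumes "letter x" "u \<in> \<R>" "v \<in> \<R>" shows "foldr act (act x u) v = act x (foldr act u v)"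
proof -
  have lu: "letter y" if "y \<in> set u" for y using assms(2) that by (simp add: reduced_iff)
  show ?thesis
  proof (cases "trivial x")
    case True then show ?thesis by (simp add: act_def)
  next
    case False
    show ?thesis
    proof (cases u)
      case Nil then show ?thesis using False by (simp add: act_def fp_cons_Nil)
    next
      case (Cons y w)
      have y: "letter y" "w \<in> \<R>" using assms(2) Cons by (auto simp: reduced_Cons)
      show ?thesis
      proof (cases "isl x = isl y")
        case True
        have "foldr act (act x u) v = act (letter_mult x y) (foldr act w v)"
          using Cons True False by (auto simp: act_def fp_cons_Cons)
        also have "\<dots> = act x (act y (foldr act w v))"
          using y lu Cons assms True by (intro act_act[symmetric] foldr_act_reduced) auto
        finally show ?thesis by (simp add: Cons)
      next
        case False
        then show ?thesis using Cons \<open>\<not> trivial x\<close> by (simp add: act_def fp_cons_Cons)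
      qed
    qed
  qed
qed

lemma foldr_act_assoc:
  assumes "\<And>x. x \<in> set u \<Longrightarrow> letter x" "v \<in> \<R>" "w \<in> \<R>"
  shows "foldr act (foldr act u v) w = foldr act u (foldr act v w)"
  using assms by (induction u) (auto simp: act_foldr foldr_act_reduced)

definition word_inv :: "('a + 'b) list \<Rightarrow> ('a + 'b) list" where "word_inv u = rev (map letter_inv u)"

lemma word_inv_reduced: assumes "u \<in> \<R>" shows "word_inv u \<in> \<R>"
proof -
  have *: "letter x" "\<not> trivial x" if "x \<in> set u" for x using assms that by (auto simp: reduced_iff)
  have "successively (\<lambda>x y. isl x \<noteq> isl y) (map letter_inv u)"
    unfolding successively_map using assms
    by (auto simp: reduced_iff letter_inv(2) * elim!: successively_mono)
  then have "successively (\<lambda>x y. isl x \<noteq> isl y) (word_inv u)"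
    unfolding word_inv_def successively_rev by (simp add: eq_commute)
  then show ?thesis using * letter_inv by (auto simp: reduced_iff word_inv_def)
qed

lemma letter_inv_act: assumes "letter x" "w \<in> \<R>" shows "act (letter_inv x) (act x w) = w"
  using act_act[of "letter_inv x" x w] letter_inv[OF assms(1)] assms by (simp add: act_def)

lemma Cons_act: "x # w \<in> \<R> \<Longrightarrow> x # w = act x w"
  by (cases w) (auto simp: reduced_Cons act_def fp_cons_Nil fp_cons_Cons)

lemma word_inv_mult: "u \<in> \<R> \<Longrightarrow> foldr act (word_inv u) u = []"
proof (induction u)
  case (Cons x u)
  have "foldr act (word_inv (x # u)) (x # u) = foldr act (word_inv u) (act (letter_inv x) (act x u))"
    by (simp add: word_inv_def Cons_act[OF Cons.prems, symmetric])
  also have "\<dots> = foldr act (word_inv u) u" using Cons.prems by (simp add: letter_inv_act reduced_Cons)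
  finally show ?case using Cons by (simp add: reduced_Cons)
qed (simp add: word_inv_def)

lemma group_free_product: "group P"
proof (rule groupI)
  have l: "letter x" if "u \<in> \<R>" "x \<in> set u" for u x using that by (simp add: reduced_iff)
  fix u v w assume "u \<in> carrier P" "v \<in> carrier P" "w \<in> carrier P"
  then have r: "u \<in> \<R>" "v \<in> \<R>" "w \<in> \<R>" by (auto simp: P_simps)
  show "u \<otimes>\<^bsub>P\<^esub> v \<in> carrier P" using r l by (simp add: mult_act P_simps(1) foldr_act_reduced)
  show "u \<otimes>\<^bsub>P\<^esub> v \<otimes>\<^bsub>P\<^esub> w = u \<otimes>\<^bsub>P\<^esub> (v \<otimes>\<^bsub>P\<^esub> w)"
    using r l by (simp add: mult_act foldr_act_reduced foldr_act_assoc)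
  show "\<one>\<^bsub>P\<^esub> \<otimes>\<^bsub>P\<^esub> u = u" by (simp add: P_simps)
  show "\<exists>y\<in>carrier P. y \<otimes>\<^bsub>P\<^esub> u = \<one>\<^bsub>P\<^esub>"
    using r word_inv_reduced word_inv_mult
    by (intro bexI[of _ "word_inv u"]) (auto simp: mult_act P_simps(1,2))
qed (simp add: P_simps reduced_Nil)

sublocale P: group "free_product G H" by (rule group_free_product)

section \<open>Inclusions of the factors and maps out of the free product\<close>

lemma mult_append: assumes "u @ v \<in> \<R>" shows "u \<otimes>\<^bsub>P\<^esub> v = u @ v"
proof -
  have "foldr act u v = u @ v" using assms by (induction u) (auto simp: Cons_act[symmetric] reduced_Cons)
  moreover have "u \<in> \<R>" using assms by (auto simp: reduced_iff successively_append_iff)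
  ultimately show ?thesis by (simp add: mult_act)
qed

lemma \<iota>_in: "letter x \<Longrightarrow> \<iota> x \<in> \<R>" by (simp add: \<iota>_def reduced_Cons reduced_Nil)

lemma \<iota>_mult:
  assumes "letter x" "w \<in> \<R>" shows "\<iota> x \<otimes>\<^bsub>P\<^esub> w = act x w"
  using assms by (auto simp: \<iota>_def P_simps act_def)

lemma act_\<iota>: assumes "letter x" "letter y" "isl x = isl y" shows "act x (\<iota> y) = \<iota> (letter_mult x y)"
  using letter_mult_trivial[OF assms] assms by (auto simp: \<iota>_def act_def fp_cons_Nil fp_cons_Cons)

lemma \<iota>_hom: assumes "letter x" "letter y" "isl x = isl y" shows "\<iota> x \<otimes>\<^bsub>P\<^esub> \<iota> y = \<iota> (letter_mult x y)"
  using assms by (simp add: \<iota>_mult \<iota>_in act_\<iota>)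

lemma hom_Inl: "(\<lambda>a. \<iota> (Inl a)) \<in> hom G P" and hom_Inr: "(\<lambda>b. \<iota> (Inr b)) \<in> hom H P"
  by (auto simp: hom_def \<iota>_hom \<iota>_in P_simps(1) letter_def)

text \<open>The existence half of the universal property, from which the retractions onto the
  factors arise. Multiplying the images of the letters is compatible with the action of a single
  letter, hence with products of words.\<close>

lemma lift_exists:
  assumes "group K" and \<phi>: "\<phi> \<in> hom G K" and \<psi>: "\<psi> \<in> hom H K"
  shows "\<exists>\<theta>\<in>hom P K. (\<forall>a\<in>carrier G. \<theta> (\<iota> (Inl a)) = \<phi> a) \<and> (\<forall>b\<in>carrier H. \<theta> (\<iota> (Inr b)) = \<psi> b)"
proof -
  interpret K: group K by fact
  define f where "f = case_sum \<phi> \<psi>"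
  define \<theta> where "\<theta> w = foldr (\<lambda>x y. f x \<otimes>\<^bsub>K\<^esub> y) w \<one>\<^bsub>K\<^esub>" for w
  have f_in: "f x \<in> carrier K" if "letter x" for x
    using that \<phi> \<psi> by (cases x) (auto simp: letter_def f_def hom_def)
  have f_mult: "f (letter_mult x y) = f x \<otimes>\<^bsub>K\<^esub> f y" if "letter x" "letter y" "isl x = isl y" for x y
    using that \<phi> \<psi> by (cases x; cases y) (auto simp: letter_def f_def hom_def)
  have f_trivial: "f x = \<one>\<^bsub>K\<^esub>" if "trivial x" for x
    using that hom_one[OF \<phi> G.is_group \<open>group K\<close>] hom_one[OF \<psi> H.is_group \<open>group K\<close>]
    by (auto simp: trivial_def f_def)
  have \<theta>_in: "\<theta> w \<in> carrier K" if "\<And>x. x \<in> set w \<Longrightarrow> letter x" for w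
    using that by (induction w) (auto simp: \<theta>_def f_in)
  have l: "letter x" if "u \<in> \<R>" "x \<in> set u" for u x using that by (simp add: reduced_iff)
  have \<theta>_act: "\<theta> (act x w) = f x \<otimes>\<^bsub>K\<^esub> \<theta> w" if x: "letter x" and w: "w \<in> \<R>" for x w
  proof (cases w)
    case Nil
    then show ?thesis using x f_trivial f_in by (simp add: act_def \<theta>_def fp_cons_Nil)
  next
    case (Cons y v)
    have y: "letter y" "\<theta> v \<in> carrier K" "\<theta> w = f y \<otimes>\<^bsub>K\<^esub> \<theta> v"
      using w Cons l \<theta>_in by (auto simp: \<theta>_def reduced_Cons)
    show ?thesis
    proof (cases "trivial x")
      case True then show ?thesis using y f_trivial f_in by (simp add: act_def)
    next
      case False
      show ?thesis
      proof (cases "isl x = isl y")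
        case True
        have "\<theta> (act x w) = f (letter_mult x y) \<otimes>\<^bsub>K\<^esub> \<theta> v"
          using True False Cons f_trivial[of "letter_mult x y"] y(2)
          by (cases "trivial (letter_mult x y)") (simp_all add: act_def fp_cons_Cons \<theta>_def)
        then show ?thesis using f_mult[OF x y(1) True] y f_in x by (simp add: K.m_assoc)
      next
        case False
        then show ?thesis using Cons \<open>\<not> trivial x\<close> by (simp add: act_def fp_cons_Cons \<theta>_def)
      qed
    qed
  qed
  have \<theta>_mult: "\<theta> (foldr act u v) = \<theta> u \<otimes>\<^bsub>K\<^esub> \<theta> v" if "\<And>x. x \<in> set u \<Longrightarrow> letter x" "v \<in> \<R>" for u v
    using that
  proof (induction u)
    case Nil then show ?case using \<theta>_in l by (simp add: \<theta>_def)
  next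
    case (Cons x u)
    have "\<theta> (x # u) = f x \<otimes>\<^bsub>K\<^esub> \<theta> u" by (simp add: \<theta>_def)
    then show ?case using Cons \<theta>_act[of x "foldr act u v"] foldr_act_reduced[of u v] f_in \<theta>_in[of u] \<theta>_in[of v] l
      by (simp add: K.m_assoc)
  qed
  have "\<theta> \<in> hom P K" unfolding hom_def P_simps(1) using \<theta>_in \<theta>_mult l by (auto simp: mult_act)
  moreover have "\<theta> (\<iota> x) = f x" if "letter x" for x
    using that f_trivial f_in by (simp add: \<iota>_def \<theta>_def)
  ultimately show ?thesis by (intro bexI[of _ \<theta>]) (auto simp: letter_def f_def)
qed

end

section \<open>The word metric of a free product\<close>

locale two_cayley = G: cayley G X + H: cayley H Y
  for G :: "('a, 'c) monoid_scheme" and X and H :: "('b, 'd) monoid_scheme" and Y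
begin

sublocale two_groups G H ..

text \<open>For the union of the generators of the factors, the length of a reduced word is the sum
  of the lengths of its letters.\<close>

definition Z :: "('a + 'b) list set" where "Z = \<iota> ` (Inl ` X \<union> Inr ` Y)"

lemma Z_letter: "x \<in> Inl ` X \<union> Inr ` Y \<Longrightarrow> letter x"
  using G.X_sub H.X_sub by (auto simp: letter_def)

lemma Z_sub: "Z \<subseteq> carrier P"
  unfolding Z_def P_simps using Z_letter \<iota>_in by auto

lemma \<iota>_generated: assumes "letter x" shows "\<iota> x \<in> generate P Z"
proof (cases x)
  case (Inl a)
  have "a \<in> generate G X" using assms Inl G.gen_X by (simp add: letter_def)
  then have "\<iota> (Inl a) \<in> generate P ((\<lambda>a. \<iota> (Inl a)) ` X)"
    using group_hom.generate_img[of G P "\<lambda>a. \<iota> (Inl a)" X] hom_Inl G.X_sub G.is_group P.is_group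
    by (auto simp: group_hom_def group_hom_axioms_def)
  also have "\<dots> \<subseteq> generate P Z" by (rule P.mono_generate) (auto simp: Z_def)
  finally show ?thesis by (simp add: Inl)
next
  case (Inr b)
  have "b \<in> generate H Y" using assms Inr H.gen_X by (simp add: letter_def)
  then have "\<iota> (Inr b) \<in> generate P ((\<lambda>b. \<iota> (Inr b)) ` Y)"
    using group_hom.generate_img[of H P "\<lambda>b. \<iota> (Inr b)" Y] hom_Inr H.X_sub H.is_group P.is_group
    by (auto simp: group_hom_def group_hom_axioms_def)
  also have "\<dots> \<subseteq> generate P Z" by (rule P.mono_generate) (auto simp: Z_def)
  finally show ?thesis by (simp add: Inr)
qed

lemma Z_generating: "finite_generating_set P Z"
proof -
  have "finite Z" using G.gen H.gen by (simp add: Z_def finite_generating_set_def)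
  moreover have "u \<in> generate P Z" if "u \<in> \<R>" for u
    using that
  proof (induction u)
    case Nil show ?case using generate.one[of P Z] by (simp add: P_simps)
  next
    case (Cons x u)
    then have "\<iota> x \<otimes>\<^bsub>P\<^esub> u = x # u" using \<iota>_mult[of x u] Cons_act[of x u] by (simp add: reduced_Cons)
    moreover have "\<iota> x \<otimes>\<^bsub>P\<^esub> u \<in> generate P Z"
      using Cons \<iota>_generated by (intro generate.eng) (auto simp: reduced_Cons)
    ultimately show ?case by simp
  qed
  ultimately show ?thesis using Z_sub P.generate_in_carrier[OF Z_sub] unfolding finite_generating_set_def P_simps(1)
    by blast
qed

sublocale PZ: cayley "free_product G H" Z
  by unfold_locales (rule Z_generating)

definition letter_length :: "'a + 'b \<Rightarrow> nat" where
  "letter_length x = (case x of Inl a \<Rightarrow> G.vd \<one>\<^bsub>G\<^esub> a | Inr b \<Rightarrow> H.vd \<one>\<^bsub>H\<^esub> b)"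

definition word_length :: "('a + 'b) list \<Rightarrow> nat" where
  "word_length w = (\<Sum>x\<leftarrow>w. letter_length x)"

lemma word_length_simps [simp]:
  "word_length [] = 0" "word_length (x # w) = letter_length x + word_length w"
  "word_length (u @ v) = word_length u + word_length v"
  by (simp_all add: word_length_def)

lemma letter_length_trivial: "trivial x \<Longrightarrow> letter_length x = 0"
  by (auto simp: trivial_def letter_length_def)

lemma word_length_\<iota>: "word_length (\<iota> x) = letter_length x"
  by (simp add: \<iota>_def letter_length_trivial)

lemma letter_length_mult_generator:
  assumes "letter x" "z \<in> Inl ` X \<union> Inr ` Y" "isl x = isl z"
  shows "\<bar>int (letter_length (letter_mult x z)) - int (letter_length x)\<bar> \<le> 1"
proof (cases x)
  case (Inl a)
  then obtain s where s: "z = Inl s" "s \<in> X" "a \<in> carrier G" "s \<in> carrier G"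
    using assms G.X_sub by (auto simp: letter_def)
  have "G.vd a (a \<otimes>\<^bsub>G\<^esub> s) \<le> 1"
    by (rule G.vd_edge) (use s in \<open>auto simp: cayley_edges_def\<close>)
  then show ?thesis
    using G.vd_triangle[of "\<one>\<^bsub>G\<^esub>" a "a \<otimes>\<^bsub>G\<^esub> s"] G.vd_triangle[of "\<one>\<^bsub>G\<^esub>" "a \<otimes>\<^bsub>G\<^esub> s" a]
      G.vd_sym[of a "a \<otimes>\<^bsub>G\<^esub> s"] Inl s by (simp add: letter_length_def)
next
  case (Inr a)
  then obtain s where s: "z = Inr s" "s \<in> Y" "a \<in> carrier H" "s \<in> carrier H"
    using assms H.X_sub by (auto simp: letter_def)
  have "H.vd a (a \<otimes>\<^bsub>H\<^esub> s) \<le> 1"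
    by (rule H.vd_edge) (use s in \<open>auto simp: cayley_edges_def\<close>)
  then show ?thesis
    using H.vd_triangle[of "\<one>\<^bsub>H\<^esub>" a "a \<otimes>\<^bsub>H\<^esub> s"] H.vd_triangle[of "\<one>\<^bsub>H\<^esub>" "a \<otimes>\<^bsub>H\<^esub> s" a]
      H.vd_sym[of a "a \<otimes>\<^bsub>H\<^esub> s"] Inr s by (simp add: letter_length_def)
qed

text \<open>Isolates the part of a word affected by right multiplication by a letter of kind
  \<open>k\<close>. If the word does not end in this kind, the trivial letter of that kind is split
  off, so that one normal form suffices.\<close>

lemma reduced_split_last:
  assumes "u \<in> \<R>"
  obtains v x where "letter x" "isl x = k" "u = v @ \<iota> x" "\<And>y. letter y \<Longrightarrow> isl y = k \<Longrightarrow> v @ \<iota> y \<in> \<R>"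
proof (cases "u \<noteq> [] \<and> isl (last u) = k")
  case True
  then obtain v x where u: "u = v @ [x]" "isl x = k" by (metis append_butlast_last_id)
  have x: "letter x" "\<not> trivial x" using assms u by (auto simp: reduced_iff)
  have "v @ \<iota> y \<in> \<R>" if "letter y" "isl y = k" for y
    using assms u that by (auto simp: reduced_iff successively_append_iff \<iota>_def)
  then show ?thesis using that[of x v] u x by (simp add: \<iota>_def)
next
  case False
  define x :: "'a + 'b" where "x = (if k then Inl \<one>\<^bsub>G\<^esub> else Inr \<one>\<^bsub>H\<^esub>)"
  have x: "letter x" "trivial x" "isl x = k" by (auto simp: x_def letter_def trivial_def)
  have "u @ \<iota> y \<in> \<R>" if "letter y" "isl y = k" for y
    using assms False that by (auto simp: reduced_iff successively_append_iff \<iota>_def)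
  then show ?thesis using that[of x u] x by (simp add: \<iota>_def)
qed

lemma word_length_mult_generator:
  assumes "u \<in> \<R>" "z \<in> Z"
  shows "\<bar>int (word_length (u \<otimes>\<^bsub>P\<^esub> z)) - int (word_length u)\<bar> \<le> 1"
proof -
  obtain y where y: "y \<in> Inl ` X \<union> Inr ` Y" "z = \<iota> y" using assms(2) by (auto simp: Z_def)
  obtain v x where v: "letter x" "isl x = isl y" "u = v @ \<iota> x"
    "\<And>y'. letter y' \<Longrightarrow> isl y' = isl y \<Longrightarrow> v @ \<iota> y' \<in> \<R>"
    using reduced_split_last[OF assms(1)] by metis
  note ly = Z_letter[OF y(1)]
  have vR: "v \<in> \<R>" using assms(1) v(3) by (auto simp: reduced_iff successively_append_iff)
  have "u \<otimes>\<^bsub>P\<^esub> z = (v \<otimes>\<^bsub>P\<^esub> \<iota> x) \<otimes>\<^bsub>P\<^esub> \<iota> y" using mult_append[of v "\<iota> x"] assms(1) v(3) y(2) by simp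
  also have "\<dots> = v \<otimes>\<^bsub>P\<^esub> \<iota> (letter_mult x y)"
    using P.m_assoc[of v "\<iota> x" "\<iota> y"] vR \<iota>_in[OF v(1)] \<iota>_in[OF ly] \<iota>_hom[OF v(1) ly v(2)]
    by (simp add: P_simps(1))
  also have "\<dots> = v @ \<iota> (letter_mult x y)"
    using letter_mult[OF v(1) ly v(2)] v by (intro mult_append) auto
  finally show ?thesis using letter_length_mult_generator[OF v(1) y(1) v(2)] v(3) by (simp add: word_length_\<iota>)
qed

lemma word_length_le: assumes "u \<in> \<R>" "(u, v) \<in> PZ.\<E> ^^ n" shows "word_length v \<le> word_length u + n"
  using assms(2)
proof (induction n arbitrary: v)
  case (Suc n)
  then obtain w where w: "(u, w) \<in> PZ.\<E> ^^ n" "(w, v) \<in> PZ.\<E>" by auto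
  have "int (word_length v) \<le> int (word_length w) + 1"
    using w(2) word_length_mult_generator[of w] word_length_mult_generator[of v]
    unfolding cayley_edges_def P_simps(1) by (auto simp: abs_le_iff) (smt (verit))+
  then show ?case using Suc.IH[OF w(1)] by linarith
qed simp

lemma vd_\<iota>: assumes "letter x" shows "PZ.vd [] (\<iota> x) \<le> letter_length x"
proof (cases x)
  case (Inl a)
  have "PZ.vd (\<iota> (Inl \<one>\<^bsub>G\<^esub>)) (\<iota> (Inl a)) \<le> G.vd \<one>\<^bsub>G\<^esub> a"
    by (rule hom_vertex_dist_le[OF G.cayley_axioms PZ.cayley_axioms hom_Inl])
      (use assms Inl in \<open>auto simp: Z_def letter_def\<close>)
  then show ?thesis by (simp add: Inl letter_length_def \<iota>_def[of "Inl \<one>\<^bsub>G\<^esub>"] trivial_def)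
next
  case (Inr b)
  have "PZ.vd (\<iota> (Inr \<one>\<^bsub>H\<^esub>)) (\<iota> (Inr b)) \<le> H.vd \<one>\<^bsub>H\<^esub> b"
    by (rule hom_vertex_dist_le[OF H.cayley_axioms PZ.cayley_axioms hom_Inr])
      (use assms Inr in \<open>auto simp: Z_def letter_def\<close>)
  then show ?thesis by (simp add: Inr letter_length_def \<iota>_def[of "Inr \<one>\<^bsub>H\<^esub>"] trivial_def)
qed

text \<open>Crossing an edge changes \<open>word_length\<close> by at most 1, which gives one
  inequality. For the other, a path is assembled letter by letter from translated paths of the
  factors.\<close>

lemma vd_word_length: assumes "u \<in> \<R>" shows "PZ.vd [] u = word_length u"
proof (rule antisym)
  have "([], u) \<in> PZ.\<E> ^^ PZ.vd [] u" using PZ.vd_path[of "[]" u] assms reduced_Nil by (simp add: P_simps(1))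
  from word_length_le[OF reduced_Nil this] show "word_length u \<le> PZ.vd [] u" by simp
  show "PZ.vd [] u \<le> word_length u" using assms
  proof (induction u)
    case (Cons x u)
    have x: "letter x" "\<iota> x \<in> \<R>" "u \<in> \<R>" "x # u \<in> \<R>" using Cons.prems \<iota>_in by (auto simp: reduced_Cons)
    have eq: "x # u = \<iota> x \<otimes>\<^bsub>P\<^esub> u" using \<iota>_mult[OF x(1,3)] Cons_act[OF x(4)] by simp
    have "PZ.vd [] (x # u) \<le> PZ.vd [] (\<iota> x) + PZ.vd (\<iota> x) (x # u)"
      by (rule PZ.vd_triangle) (use x reduced_Nil in \<open>auto simp: P_simps(1)\<close>)
    also have "PZ.vd (\<iota> x) (x # u) = PZ.vd (\<iota> x \<otimes>\<^bsub>P\<^esub> \<one>\<^bsub>P\<^esub>) (\<iota> x \<otimes>\<^bsub>P\<^esub> u)"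
      unfolding eq by (subst P.r_one) (use x in \<open>auto simp: P_simps(1)\<close>)
    also have "\<dots> = PZ.vd \<one>\<^bsub>P\<^esub> u" by (rule PZ.vd_translate) (use x reduced_Nil in \<open>auto simp: P_simps(1,2)\<close>)
    also have "\<dots> = PZ.vd [] u" by (simp add: P_simps(2))
    finally show ?case using vd_\<iota>[OF x(1)] Cons.IH x by simp
  qed simp
qed

lemma vd_eq: assumes "u \<in> \<R>" "v \<in> \<R>" shows "PZ.vd u v = word_length (foldr act (word_inv u) v)"
proof -
  have r: "word_inv u \<in> \<R>" by (rule word_inv_reduced[OF assms(1)])
  then have "letter x" if "x \<in> set (word_inv u)" for x using that by (simp add: reduced_iff)
  then have r': "foldr act (word_inv u) v \<in> \<R>" using assms(2) by (rule foldr_act_reduced)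
  have "PZ.vd u v = PZ.vd (word_inv u \<otimes>\<^bsub>P\<^esub> u) (word_inv u \<otimes>\<^bsub>P\<^esub> v)"
    by (rule PZ.vd_translate[symmetric]) (use r assms in \<open>auto simp: P_simps(1)\<close>)
  also have "\<dots> = PZ.vd [] (foldr act (word_inv u) v)"
    using mult_act[OF r] word_inv_mult[OF assms(1)] by simp
  finally show ?thesis using vd_word_length[OF r'] by simp
qed

section \<open>Gromov products of reduced words\<close>

lemma letter_length_inv: "letter x \<Longrightarrow> letter_length (letter_inv x) = letter_length x"
  using G.vd_translate[of a "\<one>\<^bsub>G\<^esub>" "inv\<^bsub>G\<^esub> a" for a] H.vd_translate[of a "\<one>\<^bsub>H\<^esub>" "inv\<^bsub>H\<^esub> a" for a]
  by (cases x) (auto simp: letter_length_def letter_def G.vd_sym H.vd_sym)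

lemma word_length_inv: "u \<in> \<R> \<Longrightarrow> word_length (word_inv u) = word_length u"
  by (induction u) (auto simp: word_inv_def reduced_Cons letter_length_inv)

text \<open>The doubled Gromov product at the identity, which is \<open>0\<close> for letters of different kinds.\<close>

fun letter_gromov2 :: "'a + 'b \<Rightarrow> 'a + 'b \<Rightarrow> real" where
  "letter_gromov2 (Inl a) (Inl b) = gromov2 G.vd \<one>\<^bsub>G\<^esub> a b"
| "letter_gromov2 (Inr a) (Inr b) = gromov2 H.vd \<one>\<^bsub>H\<^esub> a b"
| "letter_gromov2 x y = 0"

lemma letter_gromov2_mult:
  assumes "letter x" "letter y" "isl x = isl y"
  shows "letter_gromov2 x y = letter_length x + letter_length y - real (letter_length (letter_mult (letter_inv x) y))"
proof -
  have "G.vd \<one>\<^bsub>G\<^esub> (inv\<^bsub>G\<^esub> a \<otimes>\<^bsub>G\<^esub> b) = G.vd a b" if "a \<in> carrier G" "b \<in> carrier G" for a b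
    using G.vd_translate[of "inv\<^bsub>G\<^esub> a" a b] that by simp
  moreover have "H.vd \<one>\<^bsub>H\<^esub> (inv\<^bsub>H\<^esub> a \<otimes>\<^bsub>H\<^esub> b) = H.vd a b" if "a \<in> carrier H" "b \<in> carrier H" for a b
    using H.vd_translate[of "inv\<^bsub>H\<^esub> a" a b] that by simp
  ultimately show ?thesis using assms
    by (cases x; cases y) (auto simp: letter_def letter_length_def gromov2_def)
qed

lemma letter_gromov2_le:
  assumes "letter x" "letter y" shows "letter_gromov2 x y \<le> 2 * letter_length x"
proof -
  have "gromov2 G.vd \<one>\<^bsub>G\<^esub> a b \<le> 2 * G.vd \<one>\<^bsub>G\<^esub> a" if "a \<in> carrier G" "b \<in> carrier G" for a b
    using G.vd_triangle[of "\<one>\<^bsub>G\<^esub>" a b] that by (simp add: gromov2_def)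
  moreover have "gromov2 H.vd \<one>\<^bsub>H\<^esub> a b \<le> 2 * H.vd \<one>\<^bsub>H\<^esub> a" if "a \<in> carrier H" "b \<in> carrier H" for a b
    using H.vd_triangle[of "\<one>\<^bsub>H\<^esub>" a b] that by (simp add: gromov2_def)
  ultimately show ?thesis
    using assms by (cases x; cases y) (simp_all add: letter_def letter_length_def)
qed

abbreviation "N \<equiv> gromov2 PZ.vd []"

lemma N_nonneg: "u \<in> \<R> \<Longrightarrow> v \<in> \<R> \<Longrightarrow> 0 \<le> N u v"
  using PZ.vd_triangle[of u "[]" v] PZ.vd_sym[of u "[]"] reduced_Nil by (simp add: gromov2_def P_simps(1))

lemma N_Nil: "u \<in> \<R> \<Longrightarrow> N [] u = 0" "u \<in> \<R> \<Longrightarrow> N u [] = 0"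
  using PZ.vd_sym[of u "[]"] reduced_Nil by (auto simp: gromov2_def P_simps(1))

text \<open>The common first letter cancels in the quotient of the two words, while it is counted in
  both of their lengths.\<close>

lemma N_same:
  assumes "x # u \<in> \<R>" "x # v \<in> \<R>" shows "N (x # u) (x # v) = 2 * letter_length x + N u v"
proof -
  have r: "letter x" "u \<in> \<R>" "v \<in> \<R>" using assms by (auto simp: reduced_Cons)
  have "PZ.vd (x # u) (x # v) = word_length (foldr act (word_inv u) (act (letter_inv x) (act x v)))"
    using vd_eq[OF assms] Cons_act[OF assms(2)] by (simp add: word_inv_def)
  also have "\<dots> = PZ.vd u v" using vd_eq r by (simp add: letter_inv_act)
  finally show ?thesis using r assms by (simp add: gromov2_def vd_word_length)
qed

text \<open>In the quotient of the words, \<open>letter_inv x\<close> and \<open>y\<close> either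
  merge to one nontrivial letter or, being of different kinds, stay side by side. Nothing else can
  merge, so the tails \<open>u\<close> and \<open>v\<close> drop out of the product.\<close>

lemma N_diff:
  assumes "x # u \<in> \<R>" "y # v \<in> \<R>" "x \<noteq> y" shows "N (x # u) (y # v) = letter_gromov2 x y"
proof -
  have r: "letter x" "letter y" "u \<in> \<R>" "v \<in> \<R>" "\<not> trivial x" "\<not> trivial y"
    "u = [] \<or> isl x \<noteq> isl (hd u)" "v = [] \<or> isl y \<noteq> isl (hd v)"
    using assms by (auto simp: reduced_Cons)
  have ui: "word_inv u \<in> \<R>" "word_inv u = [] \<or> isl (last (word_inv u)) \<noteq> isl x"
  proof -
    show "word_inv u \<in> \<R>" by (rule word_inv_reduced[OF r(3)])
    show "word_inv u = [] \<or> isl (last (word_inv u)) \<noteq> isl x"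
    proof (cases u)
      case (Cons z w)
      then have "letter z" using r(3) by (simp add: reduced_Cons)
      then show ?thesis using Cons r(7) letter_inv(2) by (simp add: word_inv_def)
    qed (simp add: word_inv_def)
  qed
  have join: "word_inv u @ z # w \<in> \<R>" if "z # w \<in> \<R>" "isl z = isl x" for z w
    using ui that by (auto simp: reduced_iff successively_append_iff)
  have foldr_join: "foldr act (word_inv u) (z # w) = word_inv u @ z # w" if "z # w \<in> \<R>" "isl z = isl x" for z w
    using mult_append[OF join[OF that]] mult_act[OF ui(1)] by simp
  have eq: "PZ.vd (x # u) (y # v) = word_length (foldr act (word_inv u) (act (letter_inv x) (y # v)))"
    using vd_eq[OF assms(1,2)] by (simp add: word_inv_def)
  note ix = letter_inv[OF r(1)]
  show ?thesis
  proof (cases "isl x = isl y")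
    case True
    define z where "z = letter_mult (letter_inv x) y"
    have z: "\<not> trivial z" "letter z" "isl z = isl x"
      using letter_inv_mult_trivial[OF r(1,2) True] assms(3) letter_mult[of "letter_inv x" y] ix r True
      by (auto simp: z_def)
    have "act (letter_inv x) (y # v) = z # v"
      using z ix r True by (simp add: act_def fp_cons_Cons z_def)
    moreover have "z # v \<in> \<R>" using z r True by (auto simp: reduced_Cons)
    ultimately have "PZ.vd (x # u) (y # v) = word_length u + letter_length z + word_length v"
      using eq foldr_join z(3) word_length_inv[OF r(3)] by simp
    then show ?thesis
      using letter_gromov2_mult[OF r(1,2) True] assms by (simp add: gromov2_def vd_word_length z_def)
  next
    case False
    have "act (letter_inv x) (y # v) = letter_inv x # y # v"
      using ix r False by (simp add: act_def fp_cons_Cons)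
    moreover have "letter_inv x # y # v \<in> \<R>" using ix r assms False by (simp add: reduced_Cons)
    ultimately have "PZ.vd (x # u) (y # v) = word_length (x # u) + word_length (y # v)"
      using eq foldr_join ix(2) word_length_inv[OF r(3)] letter_length_inv[OF r(1)] by simp
    moreover have "letter_gromov2 x y = 0" using False by (cases x; cases y) auto
    ultimately show ?thesis using assms by (simp add: gromov2_def vd_word_length)
  qed
qed

text \<open>Common first letters are stripped by induction; each adds
  \<open>2 * letter_length x\<close> to all three products, so \<delta> enters only once. A letter
  is no longer than its word, so the four-point inequality of a factor is called upon only within
  radius \<open>R\<close>.\<close>

lemma free_product_four_point:
  assumes four_G: "\<And>a b c. a \<in> carrier G \<Longrightarrow> b \<in> carrier G \<Longrightarrow> c \<in> carrier G \<Longrightarrow>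
      G.vd \<one>\<^bsub>G\<^esub> a \<le> R \<Longrightarrow> G.vd \<one>\<^bsub>G\<^esub> b \<le> R \<Longrightarrow> G.vd \<one>\<^bsub>G\<^esub> c \<le> R \<Longrightarrow>
      min (gromov2 G.vd \<one>\<^bsub>G\<^esub> a b) (gromov2 G.vd \<one>\<^bsub>G\<^esub> b c) \<le> gromov2 G.vd \<one>\<^bsub>G\<^esub> a c + \<delta>"
    and four_H: "\<And>a b c. a \<in> carrier H \<Longrightarrow> b \<in> carrier H \<Longrightarrow> c \<in> carrier H \<Longrightarrow>
      H.vd \<one>\<^bsub>H\<^esub> a \<le> R \<Longrightarrow> H.vd \<one>\<^bsub>H\<^esub> b \<le> R \<Longrightarrow> H.vd \<one>\<^bsub>H\<^esub> c \<le> R \<Longrightarrow>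
      min (gromov2 H.vd \<one>\<^bsub>H\<^esub> a b) (gromov2 H.vd \<one>\<^bsub>H\<^esub> b c) \<le> gromov2 H.vd \<one>\<^bsub>H\<^esub> a c + \<delta>"
    and \<delta>: "0 \<le> \<delta>"
    and uvw: "u \<in> \<R>" "v \<in> \<R>" "w \<in> \<R>" "PZ.vd [] u \<le> R" "PZ.vd [] v \<le> R" "PZ.vd [] w \<le> R"
  shows "min (N u v) (N v w) \<le> N u w + \<delta>"
proof -
  have four: "min (letter_gromov2 x y) (letter_gromov2 y z) \<le> letter_gromov2 x z + \<delta>"
    if "letter x" "letter y" "letter z" "letter_length x \<le> R" "letter_length y \<le> R" "letter_length z \<le> R"
      "isl x = isl y" "isl y = isl z" for x y z
    using that four_G four_H by (cases x; cases y; cases z) (simp_all add: letter_def letter_length_def)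
  have mixed: "letter_gromov2 x y = 0" if "isl x \<noteq> isl y" for x y using that by (cases x; cases y) auto
  have "word_length u \<le> R" "word_length v \<le> R" "word_length w \<le> R" using uvw by (simp_all add: vd_word_length)
  with uvw(1-3) show ?thesis
  proof (induction u arbitrary: v w)
    case Nil
    then show ?case using N_nonneg[of v w] \<delta> by (simp add: N_Nil)
  next
    case (Cons x u)
    show ?case
    proof (cases "v = [] \<or> w = []")
      case True
      then show ?thesis using N_nonneg Cons.prems \<delta> N_Nil by (auto simp: min_def) 
    next
      case False
      then obtain y v' z w' where vw: "v = y # v'" "w = z # w'" by (auto simp: neq_Nil_conv)
      note R = Cons.prems(1) Cons.prems(2,3)[unfolded vw]
      have l: "letter x" "letter y" "letter z" using R by (auto simp: reduced_Cons)
      have len: "letter_length x \<le> R" "letter_length y \<le> R" "letter_length z \<le> R"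
        using Cons.prems(4-6) vw by auto
      have gnn: "0 \<le> letter_gromov2 x z" if "x \<noteq> z" using N_nonneg[OF R(1,3)] N_diff[OF R(1,3) that] by simp
      \<comment> \<open>If exactly two first letters agree, either two of the three products
        coincide or, for \<open>x = z\<close>, the length of \<open>x\<close> separates them. If all
        differ, they are letters of one factor, or one product on the left vanishes.\<close>
      consider "x = y" "y = z" | "x = z" "x \<noteq> y" | "x = y" "x \<noteq> z" | "y = z" "x \<noteq> z"
        | "x \<noteq> y" "y \<noteq> z" "x \<noteq> z" by blast
      then show ?thesis
      proof cases
        case 1
        have "min (N u v') (N v' w') \<le> N u w' + \<delta>"
          by (rule Cons.IH) (use R Cons.prems(4-6) vw in \<open>auto simp: reduced_Cons\<close>)
        moreover have "N (x # u) v = 2 * letter_length x + N u v'" "N v w = 2 * letter_length x + N v' w'"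
          "N (x # u) w = 2 * letter_length x + N u w'"
          using 1 R vw by (simp_all add: N_same)
        ultimately show ?thesis by linarith
      next
        case 2
        have "0 \<le> N u w'" using R by (intro N_nonneg) (auto simp: reduced_Cons)
        then have "2 * letter_length x \<le> N (x # u) w" using N_same[of x u w'] 2 R vw by simp
        moreover have "N (x # u) v \<le> 2 * letter_length x"
          using N_diff[OF R(1,2)] 2 letter_gromov2_le[OF l(1,2)] vw by simp
        ultimately show ?thesis using \<delta> by linarith
      next
        case 3
        then have "N v w = N (x # u) w" using N_diff[OF R(1,3)] N_diff[OF R(2,3)] vw by simp
        then show ?thesis using \<delta> by linarith
      next
        case 4
        then have "N (x # u) v = N (x # u) w" using N_diff[OF R(1,3)] N_diff[OF R(1,2)] vw by simp
        then show ?thesis using \<delta> by linarith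
      next
        case 5
        have N: "N (x # u) v = letter_gromov2 x y" "N v w = letter_gromov2 y z" "N (x # u) w = letter_gromov2 x z"
          using N_diff[OF R(1,2)] N_diff[OF R(2,3)] N_diff[OF R(1,3)] 5 vw by auto
        show ?thesis
        proof (cases "isl x = isl y \<and> isl y = isl z")
          case True
          then show ?thesis unfolding N using four[OF l len] by simp
        next
          case False
          then have "letter_gromov2 x y = 0 \<or> letter_gromov2 y z = 0" using mixed by blast
          then show ?thesis unfolding N using gnn[OF 5(3)] \<delta> by linarith
        qed
      qed
    qed
  qed
qed

end

section \<open>Cones of retracts\<close>

lemma group_hyperbolicity_function_cayley:
  assumes "cayley G X"
  shows "group_hyperbolicity_function G X =
    hyperbolicity_function (graph_points (carrier G) (cayley_edges G X)) (graph_dist (carrier G) (cayley_edges G X))"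
  using cayley.cayley_graph_eq[OF assms] cayley.cayley_dist_eq[OF assms]
  by (simp add: group_hyperbolicity_function_def)

lemma lacunary_hyperbolicI:
  assumes "finite_generating_set G X" "nonprincipal_ultrafilter \<omega>" "scaling_sequence l"
    "\<And>n. e n \<in> cayley_graph G X"
    "real_tree (asymptotic_cone (cayley_graph G X) (cayley_dist G X) \<omega> e l)
      (cone_dist (cayley_graph G X) (cayley_dist G X) \<omega> e l)"
  shows "lacunary_hyperbolic G"
  unfolding lacunary_hyperbolic_def
  by (intro exI[of _ X] exI[of _ \<omega>] exI[of _ e] exI[of _ l] conjI allI assms)

lemma cayley_coneI:
  assumes "group G" "finite_generating_set G X" "nonprincipal_ultrafilter \<omega>" "scaling_sequence l"
    "\<And>n. e n \<in> cayley_graph G X"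
  shows "cayley_cone G X \<omega> e l"
proof -
  interpret cayley G X using assms(1,2) by (simp add: cayley_def cayley_axioms_def)
  show ?thesis by unfold_locales (use assms(3-5) cayley_graph_eq in auto)
qed

locale retract = K: cayley_cone K Z \<omega> e l + G: group G
  for K :: "('k, 'm) monoid_scheme" and Z \<omega> e l and G :: "('g, 'n) monoid_scheme" +
  fixes i \<rho>
  assumes i: "i \<in> hom G K" and \<rho>: "\<rho> \<in> hom K G" and \<rho>_i: "\<And>g. g \<in> carrier G \<Longrightarrow> \<rho> (i g) = g"
begin

lemma i_in: "g \<in> carrier G \<Longrightarrow> i g \<in> carrier K" and \<rho>_in: "k \<in> carrier K \<Longrightarrow> \<rho> k \<in> carrier G"
  using i \<rho> by (auto simp: hom_def)

lemma i_mult: "g \<in> carrier G \<Longrightarrow> h \<in> carrier G \<Longrightarrow> i (g \<otimes>\<^bsub>G\<^esub> h) = i g \<otimes>\<^bsub>K\<^esub> i h"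
  using i by (auto simp: hom_def)

lemma retract_generating: "finite_generating_set G (\<rho> ` Z)"
proof -
  interpret \<rho>: group_hom K G \<rho>
    using \<rho> K.is_group G.is_group by (simp add: group_hom_def group_hom_axioms_def)
  have "generate G (\<rho> ` Z) = \<rho> ` carrier K" using \<rho>.generate_img[OF K.X_sub] K.gen_X by simp
  also have "\<dots> = carrier G" using \<rho>_in i_in \<rho>_i by (force simp: image_iff)
  finally show ?thesis using K.gen K.X_sub \<rho>_in by (auto simp: finite_generating_set_def)
qed

sublocale G: cayley_cone G "\<rho> ` Z" \<omega> "\<lambda>_. edge_point \<one>\<^bsub>G\<^esub> \<one>\<^bsub>G\<^esub> 0" l
proof -
  interpret GX: cayley G "\<rho> ` Z" by unfold_locales (rule retract_generating)
  show "cayley_cone G (\<rho> ` Z) \<omega> (\<lambda>_. edge_point \<one>\<^bsub>G\<^esub> \<one>\<^bsub>G\<^esub> 0) l"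
    using GX.vx_in[OF G.one_closed]
    by (intro cayley_coneI[OF G.is_group retract_generating K.ultra K.scale])
      (simp add: GX.cayley_graph_eq GX.vx_def)
qed

lemma G_base: "edge_point \<one>\<^bsub>G\<^esub> \<one>\<^bsub>G\<^esub> 0 = G.vx \<one>\<^bsub>G\<^esub>" by (simp add: G.vx_def)

text \<open>The generating set of \<open>G\<close> is the image of \<open>Z\<close>, so \<rho> does
  not increase distances, and it undoes \<open>i\<close>.\<close>

lemma vd_lower: "g \<in> carrier G \<Longrightarrow> h \<in> carrier G \<Longrightarrow> G.vd g h \<le> K.vd (i g) (i h)"
  using hom_vertex_dist_le[OF K.cayley_axioms G.cayley_axioms \<rho> order_refl, of "i g" "i h"]
  by (simp add: \<rho>_i i_in)

text \<open>A crude bound for the length in \<open>K\<close> of every generator of \<open>G\<close>;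
  unlike a maximum, the sum also makes sense when \<open>Z\<close> is empty.\<close>

definition C :: nat where "C = (\<Sum>x\<in>\<rho> ` Z. K.vd \<one>\<^bsub>K\<^esub> (i x))"

lemma vd_upper: assumes "g \<in> carrier G" "h \<in> carrier G" shows "K.vd (i g) (i h) \<le> C * G.vd g h"
proof -
  have gen: "K.vd (i g) (i (g \<otimes>\<^bsub>G\<^esub> x)) \<le> C" if "g \<in> carrier G" "x \<in> \<rho> ` Z" for g x
  proof -
    have x: "x \<in> carrier G" using that G.X_sub by blast
    have "K.vd (i g) (i (g \<otimes>\<^bsub>G\<^esub> x)) = K.vd (i g \<otimes>\<^bsub>K\<^esub> \<one>\<^bsub>K\<^esub>) (i g \<otimes>\<^bsub>K\<^esub> i x)"
      using that x i_in by (simp add: i_mult)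
    also have "\<dots> = K.vd \<one>\<^bsub>K\<^esub> (i x)" using that x i_in by (intro K.vd_translate) auto
    also have "\<dots> \<le> C" unfolding C_def
      using that G.gen by (intro member_le_sum) (auto simp: finite_generating_set_def)
    finally show ?thesis .
  qed
  have "K.vd (i u) (i v) \<le> C * n \<and> v \<in> carrier G" if "(u, v) \<in> G.\<E> ^^ n" "u \<in> carrier G" for u v n
    using that
  proof (induction n arbitrary: v)
    case (Suc n)
    then obtain w where w: "(u, w) \<in> G.\<E> ^^ n" "(w, v) \<in> G.\<E>" by auto
    then have c: "w \<in> carrier G" "v \<in> carrier G" by (auto simp: cayley_edges_def)
    obtain x where "x \<in> \<rho> ` Z" "v = w \<otimes>\<^bsub>G\<^esub> x \<or> w = v \<otimes>\<^bsub>G\<^esub> x" using w(2) by (auto simp: cayley_edges_def)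
    then have "K.vd (i w) (i v) \<le> C" using gen c K.vd_sym[OF i_in i_in] by metis
    moreover have "K.vd (i u) (i v) \<le> K.vd (i u) (i w) + K.vd (i w) (i v)"
      using c Suc.prems i_in by (intro K.vd_triangle) auto
    moreover have "K.vd (i u) (i w) \<le> C * n" using Suc.IH[OF w(1)] Suc.prems by simp
    ultimately show ?case using c by simp
  qed simp
  from this[OF G.vd_path[of g h]] show ?thesis using assms by simp
qed

text \<open>In the cone the additive errors of \<open>up\<close> and \<open>low\<close> vanish: the
  upper bound makes the map \<Phi> of cones Lipschitz, the lower one makes it injective.\<close>

lemma retract_real_tree:
  assumes T: "real_tree K.\<C> K.\<D>" shows "real_tree G.\<C> G.\<D>"
proof -
  \<comment> \<open>The cone of \<open>G\<close> is based at the identity, that of \<open>K\<close>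
    at arbitrary points \<open>e n\<close>; the translation by \<open>K.rd (e n)\<close> matches the
    two.\<close>
  define \<phi> where "\<phi> n p = K.vx (K.rd (e n) \<otimes>\<^bsub>K\<^esub> i (G.rd p))" for n p
  have c: "K.rd (e n) \<in> carrier K" for n using K.base K.rd_in by blast
  have \<phi>_in: "\<phi> n p \<in> K.\<G>" if "p \<in> G.\<G>" for n p
    unfolding \<phi>_def using c i_in G.rd_in[OF that] by (intro K.vx_in) simp
  have \<phi>_dist: "K.gd (\<phi> n p) (\<phi> n q) = K.vd (i (G.rd p)) (i (G.rd q))" if "p \<in> G.\<G>" "q \<in> G.\<G>" for n p q
    unfolding \<phi>_def using c i_in G.rd_in that by (simp add: K.gd_vx K.vd_translate)
  have up: "K.gd (\<phi> n p) (\<phi> n q) \<le> C * G.gd p q + 2 * C" and low: "G.gd p q \<le> K.gd (\<phi> n p) (\<phi> n q) + 2"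
    if "p \<in> G.\<G>" "q \<in> G.\<G>" for n p q
  proof -
    have "K.gd (\<phi> n p) (\<phi> n q) \<le> real (C * G.vd (G.rd p) (G.rd q))"
      unfolding \<phi>_dist[OF that] using vd_upper[of "G.rd p" "G.rd q"] G.rd_in that by (simp only: of_nat_le_iff)
    also have "\<dots> \<le> C * (G.gd p q + 2)"
      unfolding of_nat_mult using G.gd_coarse(1)[OF that] by (intro mult_left_mono) auto
    finally show "K.gd (\<phi> n p) (\<phi> n q) \<le> C * G.gd p q + 2 * C" by (simp add: algebra_simps)
    have "real (G.vd (G.rd p) (G.rd q)) \<le> K.gd (\<phi> n p) (\<phi> n q)"
      unfolding \<phi>_dist[OF that] using vd_lower[of "G.rd p" "G.rd q"] G.rd_in that by (simp only: of_nat_le_iff)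
    then show "G.gd p q \<le> K.gd (\<phi> n p) (\<phi> n q) + 2" using G.gd_coarse(1)[OF that] by linarith
  qed
  have \<phi>_seq: "(\<lambda>n. \<phi> n (f n)) \<in> K.\<S>" if f: "f \<in> G.\<S>" for f
  proof -
    have fG: "f n \<in> G.\<G>" for n using G.seq_in[OF f] .
    have b: "G.vx \<one>\<^bsub>G\<^esub> \<in> G.\<G>" by (rule G.vx_in) simp
    obtain B where B: "\<And>n. G.gd (G.vx \<one>\<^bsub>G\<^esub>) (f n) \<le> B * l n" using f[unfolded G.seq_iff] unfolding G_base by blast
    have "i \<one>\<^bsub>G\<^esub> = \<one>\<^bsub>K\<^esub>" by (rule hom_one[OF i G.is_group K.is_group])
    then have \<phi>_base: "\<phi> n (G.vx \<one>\<^bsub>G\<^esub>) = K.vx (K.rd (e n))" for n using c by (simp add: \<phi>_def)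
    have start: "(\<lambda>n. K.vx (K.rd (e n))) \<in> K.\<S>"
      by (rule K.pt_near(1)[OF K.base_seq K.vx_in[OF c] K.gd_rd[OF K.base]])
    show ?thesis
    proof (rule K.near_seq[OF start \<phi>_in[OF fG]])
      fix n
      have "C * G.gd (G.vx \<one>\<^bsub>G\<^esub>) (f n) \<le> C * (B * l n)" using B by (intro mult_left_mono) auto
      then show "K.gd (K.vx (K.rd (e n))) (\<phi> n (f n)) \<le> (C * B) * l n + 2 * C"
        using up[OF b fG, of n n] \<phi>_base by simp
    qed
  qed
  have ld_up: "K.ld (\<lambda>n. \<phi> n (f n)) (\<lambda>n. \<phi> n (g n)) \<le> C * G.ld f g"
    and ld_low: "G.ld f g \<le> K.ld (\<lambda>n. \<phi> n (f n)) (\<lambda>n. \<phi> n (g n))" if f: "f \<in> G.\<S>" and g: "g \<in> G.\<S>" for f g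
  proof -
    note fg = G.seq_in[OF f] G.seq_in[OF g]
    show "K.ld (\<lambda>n. \<phi> n (f n)) (\<lambda>n. \<phi> n (g n)) \<le> C * G.ld f g"
    proof (rule K.lim_le[OF K.ld_lim[OF \<phi>_seq[OF f] \<phi>_seq[OF g]] tendsto_mult[OF tendsto_const G.ld_lim[OF f g]]])
      have "K.gd (\<phi> n (f n)) (\<phi> n (g n)) / l n \<le> (C * G.gd (f n) (g n) + 2 * C) / l n" for n
        by (intro divide_right_mono up fg less_imp_le[OF K.lpos])
      then show "eventually (\<lambda>n. K.gd (\<phi> n (f n)) (\<phi> n (g n)) / l n \<le> C * (G.gd (f n) (g n) / l n) + (2 * C) / l n) \<omega>"
        by (simp add: add_divide_distrib)
    qed
    show "G.ld f g \<le> K.ld (\<lambda>n. \<phi> n (f n)) (\<lambda>n. \<phi> n (g n))"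
      by (rule K.lim_le[OF G.ld_lim[OF f g] K.ld_lim[OF \<phi>_seq[OF f] \<phi>_seq[OF g]], of 2])
        (use divide_right_mono[OF low[OF fg] less_imp_le[OF K.lpos]] in \<open>simp add: add_divide_distrib\<close>)
  qed
  define rep where "rep F = (SOME f. f \<in> G.\<S> \<and> F = G.pt f)" for F
  have rep: "rep F \<in> G.\<S>" "F = G.pt (rep F)" if "F \<in> G.\<C>" for F
  proof -
    have "\<exists>f. f \<in> G.\<S> \<and> F = G.pt f" using that by (auto elim: G.cone_E)
    from someI_ex[OF this] show "rep F \<in> G.\<S>" "F = G.pt (rep F)" by (auto simp: rep_def)
  qed
  define \<Phi> where "\<Phi> F = K.pt (\<lambda>n. \<phi> n (rep F n))" for F
  have dG: "G.\<D> F F' = G.ld (rep F) (rep F')" if "F \<in> G.\<C>" "F' \<in> G.\<C>" for F F'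
    using G.dist_pt[OF rep(1)[OF that(1)] rep(1)[OF that(2)]] rep(2) that by simp
  have dK: "K.\<D> (\<Phi> F) (\<Phi> F') = K.ld (\<lambda>n. \<phi> n (rep F n)) (\<lambda>n. \<phi> n (rep F' n))" if "F \<in> G.\<C>" "F' \<in> G.\<C>" for F F'
    unfolding \<Phi>_def by (rule K.dist_pt[OF \<phi>_seq[OF rep(1)[OF that(1)]] \<phi>_seq[OF rep(1)[OF that(2)]]])
  have \<Phi>_in: "\<Phi> F \<in> K.\<C>" if "F \<in> G.\<C>" for F
    unfolding \<Phi>_def by (rule K.pt_in[OF \<phi>_seq[OF rep(1)[OF that]]])
  show ?thesis
  proof (rule real_tree_pullback[OF T G.metric G.cone_geodesic])
    show "\<Phi> \<in> G.\<C> \<rightarrow> K.\<C>" using \<Phi>_in by blast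
    show "K.\<D> (\<Phi> F) (\<Phi> F') \<le> C * G.\<D> F F'" if "F \<in> G.\<C>" "F' \<in> G.\<C>" for F F'
      unfolding dG[OF that] dK[OF that] by (rule ld_up[OF rep(1)[OF that(1)] rep(1)[OF that(2)]])
    show "inj_on \<Phi> G.\<C>"
    proof (rule inj_onI)
      fix F F' assume F: "F \<in> G.\<C>" "F' \<in> G.\<C>" and "\<Phi> F = \<Phi> F'"
      then have "K.\<D> (\<Phi> F) (\<Phi> F') = 0" using K.cone.zero \<Phi>_in by metis
      then have "G.\<D> F F' \<le> 0"
        using ld_low[OF rep(1)[OF F(1)] rep(1)[OF F(2)]] dG[OF F] dK[OF F] by simp
      then show "F = F'" using G.cone.nonneg[of F F'] G.cone.zero[OF F] by simp
    qed
  qed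
qed

end

lemma retract_of_lacunary_hyperbolic:
  assumes K: "cayley_cone K Z \<omega> e l" and G: "group G"
    and T: "real_tree (asymptotic_cone (cayley_graph K Z) (cayley_dist K Z) \<omega> e l)
      (cone_dist (cayley_graph K Z) (cayley_dist K Z) \<omega> e l)"
    and hom: "i \<in> hom G K" "\<rho> \<in> hom K G" "\<And>g. g \<in> carrier G \<Longrightarrow> \<rho> (i g) = g"
  obtains X where "finite_generating_set G X" "lacunary_hyperbolic G"
    "((\<lambda>n. group_hyperbolicity_function G X (l n) / l n) \<longlongrightarrow> 0) \<omega>"
proof -
  interpret K: cayley_cone K Z \<omega> e l by (rule K)
  interpret retract K Z \<omega> e l G i \<rho>
    using K G hom by (simp add: retract_def retract_axioms_def)
  have t: "real_tree G.\<C> G.\<D>" using retract_real_tree T by (simp add: K.cayley_graph_eq K.cayley_dist_eq)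
  have "lacunary_hyperbolic G"
    by (rule lacunary_hyperbolicI[OF retract_generating K.ultra K.scale])
      (use t G.base in \<open>simp_all add: G.cayley_graph_eq G.cayley_dist_eq\<close>)
  moreover have "((\<lambda>n. group_hyperbolicity_function G (\<rho> ` Z) (l n) / l n) \<longlongrightarrow> 0) \<omega>"
    using G.hyperbolicity_function_sublinear[OF t] group_hyperbolicity_function_cayley[OF G.cayley_axioms]
    by simp
  ultimately show ?thesis using that retract_generating by blast
qed

section \<open>A common scale for both factors\<close>

lemma group_hyperbolicity_function_nonneg:
  assumes "group G" "finite_generating_set G X" "0 \<le> t" shows "0 \<le> group_hyperbolicity_function G X t"
proof -
  interpret cayley G X using assms(1,2) by (simp add: cayley_def cayley_axioms_def)
  show ?thesis
    using hyperbolicity_function_nonneg[where d=gd, OF nonneg vx_in[OF one_closed]]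
      gd_refl[OF vx_in[OF one_closed]] assms(3)
      group_hyperbolicity_function_cayley[OF cayley_axioms] by simp
qed

text \<open>The indices at which both quotients are below \<open>1 / Suc j\<close> and
  \<open>l n\<close> exceeds a given number form a set of the ultrafilter, hence a nonempty one.
  Having the same \<omega> on both sides is essential here.\<close>

lemma common_scale_sequence:
  fixes f g :: "real \<Rightarrow> real"
  assumes \<omega>: "nonprincipal_ultrafilter \<omega>" and l: "scaling_sequence l"
    and nn: "\<And>t. 0 \<le> t \<Longrightarrow> 0 \<le> f t" "\<And>t. 0 \<le> t \<Longrightarrow> 0 \<le> g t"
    and lim: "((\<lambda>n. f (l n) / l n) \<longlongrightarrow> 0) \<omega>" "((\<lambda>n. g (l n) / l n) \<longlongrightarrow> 0) \<omega>"
  obtains x :: "nat \<Rightarrow> real" where "strict_mono x" "filterlim x at_top sequentially"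
    "(\<lambda>j. f (x j) / x j) \<longlonglongrightarrow> 0" "(\<lambda>j. g (x j) / x j) \<longlonglongrightarrow> 0"
proof -
  define P where "P j t \<longleftrightarrow> real j < t \<and> f t / t < 1 / real (Suc j) \<and> g t / t < 1 / real (Suc j)" for j t
  have ne: "\<omega> \<noteq> bot" using \<omega> by (simp add: nonprincipal_ultrafilter_def)
  have ltop: "filterlim l at_top \<omega>"
    using l nonprincipal_ultrafilter_le_sequentially[OF \<omega>] filterlim_mono
    unfolding scaling_sequence_def by blast
  have ex: "\<exists>t. P j t \<and> s < t" for j s
  proof -
    have "eventually (\<lambda>n. f (l n) / l n < 1 / real (Suc j)) \<omega>" "eventually (\<lambda>n. g (l n) / l n < 1 / real (Suc j)) \<omega>"
      using order_tendstoD(2)[OF lim(1), of "1 / real (Suc j)"] order_tendstoD(2)[OF lim(2), of "1 / real (Suc j)"]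
      by simp_all
    moreover have "eventually (\<lambda>n. max (real j) s < l n) \<omega>"
      using ltop by (simp only: filterlim_at_top_dense)
    ultimately have "eventually (\<lambda>n. P j (l n) \<and> s < l n) \<omega>"
      by eventually_elim (simp add: P_def)
    from eventually_happens'[OF ne this] show ?thesis by blast
  qed
  have "\<exists>x. \<forall>j. P j (x j) \<and> x j < x (Suc j)"
    by (rule dependent_nat_choice) (use ex in blast)+
  then obtain x where x: "\<And>j. P j (x j)" "\<And>j. x j < x (Suc j)" by blast
  have top: "filterlim x at_top sequentially"
    by (rule filterlim_at_top_mono[OF filterlim_real_sequentially])
      (use x(1) in \<open>auto simp: P_def intro!: always_eventually less_imp_le\<close>)
  have pos: "0 < x j" for j using x(1)[of j] by (simp add: P_def)
  have lim0: "(\<lambda>j. h (x j) / x j) \<longlonglongrightarrow> 0"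
    if "\<And>t. 0 \<le> t \<Longrightarrow> 0 \<le> h t" "\<And>j. h (x j) / x j < 1 / real (Suc j)" for h
  proof (rule tendsto_sandwich[OF _ _ tendsto_const LIMSEQ_Suc[OF lim_1_over_n]])
    show "eventually (\<lambda>j. 0 \<le> h (x j) / x j) sequentially" using that(1) pos by (simp add: less_imp_le)
    show "eventually (\<lambda>j. h (x j) / x j \<le> 1 / real (Suc j)) sequentially"
      using that(2) by (intro always_eventually allI less_imp_le)
  qed
  show ?thesis
  proof (rule that)
    show "strict_mono x" using x(2) by (simp add: strict_mono_Suc_iff)
    show "filterlim x at_top sequentially" by (rule top)
    show "(\<lambda>j. f (x j) / x j) \<longlonglongrightarrow> 0" using nn(1) x(1) by (intro lim0) (auto simp: P_def)
    show "(\<lambda>j. g (x j) / x j) \<longlonglongrightarrow> 0" using nn(2) x(1) by (intro lim0) (auto simp: P_def)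
  qed
qed

lemma (in two_groups) lacunary_hyperbolic_imp_synchronized:
  assumes "lacunary_hyperbolic P" shows "synchronized_LH G H"
proof -
  obtain Z \<omega> e l where Z: "finite_generating_set P Z" "nonprincipal_ultrafilter \<omega>" "scaling_sequence l"
    "\<And>n. e n \<in> cayley_graph P Z"
    and T: "real_tree (asymptotic_cone (cayley_graph P Z) (cayley_dist P Z) \<omega> e l)
      (cone_dist (cayley_graph P Z) (cayley_dist P Z) \<omega> e l)"
    using assms unfolding lacunary_hyperbolic_def by blast
  note K = cayley_coneI[OF P.is_group Z]
  \<comment> \<open>The retraction onto a factor is the identity on this factor and trivial on the
    other.\<close>
  have "(\<lambda>a. a) \<in> hom G G" "(\<lambda>_. \<one>\<^bsub>G\<^esub>) \<in> hom H G" "(\<lambda>b. b) \<in> hom H H" "(\<lambda>_. \<one>\<^bsub>H\<^esub>) \<in> hom G H"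
    by (auto simp: hom_def)
  note hom = this
  obtain \<rho> where \<rho>: "\<rho> \<in> hom P G" "\<And>a. a \<in> carrier G \<Longrightarrow> \<rho> (\<iota> (Inl a)) = a"
      "\<And>b. b \<in> carrier H \<Longrightarrow> \<rho> (\<iota> (Inr b)) = \<one>\<^bsub>G\<^esub>"
    using lift_exists[OF G.is_group hom(1,2)] by blast
  obtain \<rho>' where \<rho>': "\<rho>' \<in> hom P H" 
      "\<And>a. a \<in> carrier G \<Longrightarrow> \<rho>' (\<iota> (Inl a)) = \<one>\<^bsub>H\<^esub>"
      "\<And>b. b \<in> carrier H \<Longrightarrow> \<rho>' (\<iota> (Inr b)) = b"
    using lift_exists[OF H.is_group hom(4,3)] by blast
  obtain X where X: "finite_generating_set G X" "lacunary_hyperbolic G"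
    "((\<lambda>n. group_hyperbolicity_function G X (l n) / l n) \<longlongrightarrow> 0) \<omega>"
    using retract_of_lacunary_hyperbolic[OF K G.is_group T hom_Inl \<rho>(1,2)] .
  obtain Y where Y: "finite_generating_set H Y" "lacunary_hyperbolic H"
    "((\<lambda>n. group_hyperbolicity_function H Y (l n) / l n) \<longlongrightarrow> 0) \<omega>"
    using retract_of_lacunary_hyperbolic[OF K H.is_group T hom_Inr \<rho>'(1,3)] .
  obtain x :: "nat \<Rightarrow> real" where x: "strict_mono x" "filterlim x at_top sequentially"
    "(\<lambda>j. group_hyperbolicity_function G X (x j) / x j) \<longlonglongrightarrow> 0"
    "(\<lambda>j. group_hyperbolicity_function H Y (x j) / x j) \<longlonglongrightarrow> 0"
    using common_scale_sequence[OF Z(2,3) group_hyperbolicity_function_nonneg[OF G.is_group X(1)]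
        group_hyperbolicity_function_nonneg[OF H.is_group Y(1)] X(3) Y(3)] .
  show ?thesis unfolding synchronized_LH_def using X Y x by blast
qed

section \<open>The cone of a free product\<close>

text \<open>Points of a ball of radius \<open>R\<close> are at distance at most
  \<open>2 * R\<close>, so triangles between them have perimeter at most
  \<open>6 * R\<close>.\<close>

lemma (in cayley) slim_four_point_one:
  assumes "a \<in> carrier G" "b \<in> carrier G" "c \<in> carrier G" "vd \<one> a \<le> R" "vd \<one> b \<le> R" "vd \<one> c \<le> R"
    and t: "6 * real R \<le> t"
  shows "min (gromov2 vd \<one> a b) (gromov2 vd \<one> b c) \<le>
    gromov2 vd \<one> a c + (6 * group_hyperbolicity_function G X t + 60)"
proof -
  have norm: "vd \<one> u \<le> R" "u \<in> carrier G" if "u \<in> {\<one>, a, b, c}" for u using that assms by auto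
  have "3 * real (vd u v) \<le> t" if "u \<in> {\<one>, a, b, c}" "v \<in> {\<one>, a, b, c}" for u v
  proof -
    have "vd u v \<le> vd u \<one> + vd \<one> v" using norm that by (intro vd_triangle) auto
    also have "\<dots> \<le> R + R" using norm that vd_sym[of u \<one>] by (intro add_mono) auto
    finally have "real (vd u v) \<le> 2 * real R" by simp
    then show ?thesis using t by linarith
  qed
  from slim_four_point[OF one_closed assms(1-3) this] show ?thesis
    using group_hyperbolicity_function_cayley[OF cayley_axioms] by simp
qed

text \<open>
  At the scale \<open>l k\<close>, the triangles of perimeter up to \<open>Suc k * l k\<close> are slim up to \<open>o(l k)\<close>;
  hence, for every \<open>C\<close>, so are eventually all triangles of perimeter \<open>C * l k\<close>.
\<close>

lemma slow_scale_sequence: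
  fixes f g :: "real \<Rightarrow> real"
  assumes x: "filterlim x at_top sequentially" "(\<lambda>j. f (x j) / x j) \<longlonglongrightarrow> 0" "(\<lambda>j. g (x j) / x j) \<longlonglongrightarrow> (0 :: real)"
  shows "\<exists>l :: nat \<Rightarrow> real. scaling_sequence l \<and> (\<forall>k. f (Suc k * l k) \<le> l k / Suc k \<and> g (Suc k * l k) \<le> l k / Suc k)"
proof -
  define P where "P k L \<longleftrightarrow> real (Suc k) \<le> L \<and> f (Suc k * L) \<le> L / Suc k \<and> g (Suc k * L) \<le> L / Suc k" for k and L :: real
  have ex: "\<exists>L. P k L \<and> L0 \<le> L" for k L0
  proof -
    define c where "c = real (Suc k)"
    have c: "0 < c" by (simp add: c_def)
    \<comment> \<open>The scale will be \<open>x j / c\<close>. One factor \<open>c\<close> of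
      \<open>1 / c\<^sup>2\<close> pays for the perimeter being \<open>c\<close> times the scale;
      the other remains as the decaying error.\<close>
    have "eventually (\<lambda>j. f (x j) / x j < 1 / c\<^sup>2) sequentially" "eventually (\<lambda>j. g (x j) / x j < 1 / c\<^sup>2) sequentially"
      using order_tendstoD(2)[OF x(2), of "1 / c\<^sup>2"] order_tendstoD(2)[OF x(3), of "1 / c\<^sup>2"] c by simp_all
    moreover have "eventually (\<lambda>j. c * max c L0 < x j) sequentially"
      using x(1) by (simp only: filterlim_at_top_dense)
    ultimately have "eventually (\<lambda>j. P k (x j / c) \<and> L0 \<le> x j / c) sequentially"
    proof eventually_elim
      case (elim j)
      have "c * c \<le> c * max c L0" "c * L0 \<le> c * max c L0" using c by (auto intro: mult_left_mono)
      then have big: "c * c < x j" "c * L0 < x j" using elim(3) by linarith+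
      have "0 < c * c" using c by simp
      then have pos: "0 < x j" using big by linarith
      have "f (x j) < x j / c\<^sup>2" "g (x j) < x j / c\<^sup>2"
        using elim(1,2) pos by (simp_all add: pos_divide_less_eq)
      then have "f (c * (x j / c)) \<le> x j / c / c" "g (c * (x j / c)) \<le> x j / c / c"
        using c by (simp_all add: power2_eq_square)
      moreover have "c \<le> x j / c" "L0 \<le> x j / c" using big c by (simp_all add: pos_le_divide_eq mult.commute)
      ultimately show ?case by (simp add: P_def c_def)
    qed
    from eventually_happens'[OF _ this] show ?thesis by auto
  qed
  have "\<exists>l. \<forall>k. P k (l k) \<and> l k \<le> l (Suc k)"
    by (rule dependent_nat_choice) (use ex in blast)+
  then obtain l where l: "\<And>k. P k (l k)" "\<And>k. l k \<le> l (Suc k)" by blast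
  have "scaling_sequence l"
    unfolding scaling_sequence_def
  proof (intro conjI allI)
    show "mono l" using l(2) by (simp add: mono_iff_le_Suc)
    show "0 < l k" for k using l(1)[of k] by (simp add: P_def)
    have "real k \<le> l k" for k using l(1)[of k] by (simp add: P_def)
    then show "filterlim l at_top sequentially"
      by (intro filterlim_at_top_mono[OF filterlim_real_sequentially]) simp
  qed
  then show ?thesis using l(1) by (auto simp: P_def)
qed

text \<open>Translating by the inverse of the first point turns Gromov products at that point into
  products \<open>N\<close> at the empty word. The other points then lie in a ball whose radius is a
  fixed multiple of \<open>l n\<close>, where the factors eventually satisfy the four-point
  inequality with error \<open>o(l n)\<close>.\<close>

lemma (in two_cayley) free_product_cone_real_tree:
  fixes l :: "nat \<Rightarrow> real"
  assumes C: "cayley_cone P Z \<omega> e l"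
    and fG: "\<And>k. group_hyperbolicity_function G X (Suc k * l k) \<le> l k / Suc k"
    and fH: "\<And>k. group_hyperbolicity_function H Y (Suc k * l k) \<le> l k / Suc k"
  shows "real_tree (asymptotic_cone PZ.\<G> PZ.gd \<omega> e l) (cone_dist PZ.\<G> PZ.gd \<omega> e l)"
proof -
  interpret C: cayley_cone P Z \<omega> e l by (rule C)
  show ?thesis
  proof (rule C.cone.four_point_real_tree[OF _ C.cone_geodesic])
    fix F1 F2 F3 F4 assume "F1 \<in> C.\<C>" "F2 \<in> C.\<C>" "F3 \<in> C.\<C>" "F4 \<in> C.\<C>"
    then obtain w x y z where w: "w \<in> C.\<S>" "F1 = C.pt w" and x: "x \<in> C.\<S>" "F2 = C.pt x"
      and y: "y \<in> C.\<S>" "F3 = C.pt y" and z: "z \<in> C.\<S>" "F4 = C.pt z" by (metis C.cone_E)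
    note S = C.seq_in[OF w(1)] C.seq_in[OF x(1)] C.seq_in[OF y(1)] C.seq_in[OF z(1)]
    define t where "t n p = inv\<^bsub>P\<^esub> (PZ.rd (w n)) \<otimes>\<^bsub>P\<^esub> PZ.rd p" for n p
    have t_in: "t n p \<in> carrier P" if "p \<in> PZ.\<G>" for n p
      unfolding t_def using PZ.rd_in S(1) that by simp
    have t_vd: "PZ.vd (t n p) (t n q) = PZ.vd (PZ.rd p) (PZ.rd q)" if "p \<in> PZ.\<G>" "q \<in> PZ.\<G>" for n p q
      unfolding t_def using PZ.rd_in S(1) that by (intro PZ.vd_translate) auto
    have t_w: "t n (w n) = []" for n
      using P.l_inv[OF PZ.rd_in[OF S(1)]] by (simp add: t_def P_simps(2))
    have t_norm: "PZ.vd [] (t n p) = PZ.vd (PZ.rd (w n)) (PZ.rd p)" if "p \<in> PZ.\<G>" for n p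
      using t_vd[OF S(1) that, of n n] t_w by simp
    have norm_le: "real (PZ.vd [] (t n p)) \<le> PZ.gd (w n) p + 2" if "p \<in> PZ.\<G>" for n p
      using PZ.gd_coarse(1)[OF S(1) that, of n] t_norm[OF that] by simp
    have N_close: "\<bar>N (t n p) (t n q) - (PZ.gd (w n) p + PZ.gd (w n) q - PZ.gd p q)\<bar> \<le> 6"
      if "p \<in> PZ.\<G>" "q \<in> PZ.\<G>" for n p q
      using PZ.gd_coarse(1)[OF S(1) that(1), of n] PZ.gd_coarse(1)[OF S(1) that(2), of n] PZ.gd_coarse(1)[OF that]
      unfolding gromov2_def t_vd[OF that] t_norm[OF that(1)] t_norm[OF that(2)] by linarith
    obtain B1 B2 B3 where B: "\<And>n. PZ.gd (w n) (x n) \<le> B1 * l n" "\<And>n. PZ.gd (w n) (y n) \<le> B2 * l n"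
      "\<And>n. PZ.gd (w n) (z n) \<le> B3 * l n" "0 \<le> B1" "0 \<le> B2" "0 \<le> B3"
      using C.seq_dist_bound[OF w(1) x(1)] C.seq_dist_bound[OF w(1) y(1)] C.seq_dist_bound[OF w(1) z(1)] by metis
    \<comment> \<open>The last summand absorbs the rounding error 2 at every index, because
      \<open>l n\<close> is at least \<open>l 0\<close>.\<close>
    define B where "B = B1 + B2 + B3 + 2 / l 0"
    have l0: "2 \<le> 2 / l 0 * l n" for n using C.const_le_l[of 2 n] by simp
    have bound: "PZ.vd [] (t n (x n)) \<le> nat \<lfloor>B * l n\<rfloor>" "PZ.vd [] (t n (y n)) \<le> nat \<lfloor>B * l n\<rfloor>"
      "PZ.vd [] (t n (z n)) \<le> nat \<lfloor>B * l n\<rfloor>" "0 \<le> B * l n" for n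
    proof -
      have Bi: "B1 * l n + 2 \<le> B * l n" "B2 * l n + 2 \<le> B * l n" "B3 * l n + 2 \<le> B * l n"
        using l0[of n] mult_nonneg_nonneg[OF B(4), of "l n"] mult_nonneg_nonneg[OF B(5), of "l n"]
          mult_nonneg_nonneg[OF B(6), of "l n"] C.lpos[of n] by (simp_all add: B_def distrib_right)
      have fl: "m \<le> nat \<lfloor>B * l n\<rfloor>" if "real m \<le> B * l n" for m using that by (simp add: le_nat_floor)
      show "PZ.vd [] (t n (x n)) \<le> nat \<lfloor>B * l n\<rfloor>" using norm_le[OF S(2), of n n] B(1)[of n] Bi by (intro fl) linarith
      show "PZ.vd [] (t n (y n)) \<le> nat \<lfloor>B * l n\<rfloor>" using norm_le[OF S(3), of n n] B(2)[of n] Bi by (intro fl) linarith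
      show "PZ.vd [] (t n (z n)) \<le> nat \<lfloor>B * l n\<rfloor>" using norm_le[OF S(4), of n n] B(3)[of n] Bi by (intro fl) linarith
      show "0 \<le> B * l n" using Bi(1) mult_nonneg_nonneg[OF B(4), of "l n"] C.lpos[of n] by linarith
    qed
    define a where "a p q n = (PZ.gd (w n) (p n) / l n + PZ.gd (w n) (q n) / l n) - PZ.gd (p n) (q n) / l n" for p q n
    have lim: "(a p q \<longlongrightarrow> (C.ld w p + C.ld w q) - C.ld p q) \<omega>" if "p \<in> C.\<S>" "q \<in> C.\<S>" for p q
      unfolding a_def by (intro tendsto_diff tendsto_add C.ld_lim that w)
    \<comment> \<open>The constant 72 is 60 from the factors plus an error of 6 on either side of
      the inequality for replacing \<open>gd\<close> by vertex distances.\<close>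
    have ev: "eventually (\<lambda>n. min (a x y n) (a y z n) \<le> a x z n + 6 * (1 / real (Suc n)) + 72 / l n) \<omega>"
    proof (rule eventually_mono)
      \<comment> \<open>From here on the perimeter \<open>6 * B * l n\<close> needed for the ball of
        radius \<open>B * l n\<close> is covered by \<open>Suc n * l n\<close>.\<close>
      show "eventually (\<lambda>n. 6 * B \<le> real n) \<omega>"
        using filter_leD[OF C.le_seq] eventually_ge_at_top[of "nat \<lceil>6 * B\<rceil>"]
        by (auto simp: eventually_sequentially le_filter_def)
      fix n assume n: "6 * B \<le> real n"
      define \<delta> where "\<delta> = 6 * (l n / Suc n) + 60"
      have \<delta>: "0 \<le> \<delta>" using C.lpos[of n] by (simp add: \<delta>_def)
      have "6 * B \<le> real (Suc n)" using n by simp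
      then have "6 * B * l n \<le> real (Suc n) * l n" using C.lpos[of n] by (intro mult_right_mono) auto
      then have R: "6 * real (nat \<lfloor>B * l n\<rfloor>) \<le> Suc n * l n" using bound(4)[of n] by linarith
      have "min (N (t n (x n)) (t n (y n))) (N (t n (y n)) (t n (z n))) \<le> N (t n (x n)) (t n (z n)) + \<delta>"
      proof (rule free_product_four_point[where R = "nat \<lfloor>B * l n\<rfloor>", OF _ _ \<delta>])
        show "min (gromov2 G.vd \<one>\<^bsub>G\<^esub> a b) (gromov2 G.vd \<one>\<^bsub>G\<^esub> b c) \<le> gromov2 G.vd \<one>\<^bsub>G\<^esub> a c + \<delta>"
          if "a \<in> carrier G" "b \<in> carrier G" "c \<in> carrier G" "G.vd \<one>\<^bsub>G\<^esub> a \<le> nat \<lfloor>B * l n\<rfloor>"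
            "G.vd \<one>\<^bsub>G\<^esub> b \<le> nat \<lfloor>B * l n\<rfloor>" "G.vd \<one>\<^bsub>G\<^esub> c \<le> nat \<lfloor>B * l n\<rfloor>" for a b c
          using G.slim_four_point_one[OF that R] fG[of n] unfolding \<delta>_def by linarith
        show "min (gromov2 H.vd \<one>\<^bsub>H\<^esub> a b) (gromov2 H.vd \<one>\<^bsub>H\<^esub> b c) \<le> gromov2 H.vd \<one>\<^bsub>H\<^esub> a c + \<delta>"
          if "a \<in> carrier H" "b \<in> carrier H" "c \<in> carrier H" "H.vd \<one>\<^bsub>H\<^esub> a \<le> nat \<lfloor>B * l n\<rfloor>"
            "H.vd \<one>\<^bsub>H\<^esub> b \<le> nat \<lfloor>B * l n\<rfloor>" "H.vd \<one>\<^bsub>H\<^esub> c \<le> nat \<lfloor>B * l n\<rfloor>" for a b c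
          using H.slim_four_point_one[OF that R] fH[of n] unfolding \<delta>_def by linarith
      qed (use t_in S bound in \<open>simp_all add: P_simps(1)\<close>)
      then have main: "min (a x y n * l n) (a y z n * l n) \<le> a x z n * l n + \<delta> + 12"
        using N_close[OF S(2,3), of n n n] N_close[OF S(3,4), of n n n] N_close[OF S(2,4), of n n n] C.lpos[of n]
        by (simp add: a_def left_diff_distrib distrib_right)
      have "min (a x y n) (a y z n) * l n = min (a x y n * l n) (a y z n * l n)"
        using C.lpos[of n] by (simp add: min_mult_distrib_right)
      also have "\<dots> \<le> (a x z n + 6 * (1 / real (Suc n)) + 72 / l n) * l n"
        using main C.lpos[of n] by (simp add: \<delta>_def distrib_right)
      finally show "min (a x y n) (a y z n) \<le> a x z n + 6 * (1 / real (Suc n)) + 72 / l n"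
        using C.lpos[of n] by simp
    qed
    have "((\<lambda>n. 1 / real (Suc n)) \<longlongrightarrow> 0) \<omega>"
      by (rule tendsto_mono[OF C.le_seq LIMSEQ_Suc[OF lim_1_over_n]])
    then have "((\<lambda>n. a x z n + 6 * (1 / real (Suc n)) + 72 / l n) \<longlongrightarrow>
        ((C.ld w x + C.ld w z) - C.ld x z) + 6 * 0 + 0) \<omega>"
      by (intro tendsto_add tendsto_mult tendsto_const lim x z C.const_over_l)
    from tendsto_le[OF C.ne this tendsto_min[OF lim lim] ev] x y z
    show "min (C.\<D> F1 F2 + C.\<D> F1 F3 - C.\<D> F2 F3) (C.\<D> F1 F3 + C.\<D> F1 F4 - C.\<D> F3 F4)
        \<le> C.\<D> F1 F2 + C.\<D> F1 F4 - C.\<D> F2 F4"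
      by (simp add: w x y z C.dist_pt)
  qed
qed

section \<open>The converse implication and the theorem\<close>

lemma (in two_groups) synchronized_imp_lacunary_hyperbolic:
  assumes "synchronized_LH G H" shows "lacunary_hyperbolic P"
proof -
  obtain x :: "nat \<Rightarrow> real" and X Y where x: "filterlim x at_top sequentially"
    and gen: "finite_generating_set G X" "finite_generating_set H Y"
    and f: "(\<lambda>j. group_hyperbolicity_function G X (x j) / x j) \<longlonglongrightarrow> 0"
      "(\<lambda>j. group_hyperbolicity_function H Y (x j) / x j) \<longlonglongrightarrow> 0"
    using assms unfolding synchronized_LH_def by blast
  interpret two_cayley G X H Y
    using gen by (intro two_cayley.intro cayley.intro cayley_axioms.intro) unfold_locales
  obtain l :: "nat \<Rightarrow> real" where l: "scaling_sequence l" "\<And>k. group_hyperbolicity_function G X (Suc k * l k) \<le> l k / Suc k"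
    "\<And>k. group_hyperbolicity_function H Y (Suc k * l k) \<le> l k / Suc k"
    using slow_scale_sequence[OF x f] by blast
  \<comment> \<open>Any nonprincipal ultrafilter serves, because the estimates along
    \<open>l\<close> hold at every index.\<close>
  obtain \<omega> where \<omega>: "nonprincipal_ultrafilter \<omega>" using ex_nonprincipal_ultrafilter by blast
  have e: "PZ.vx [] \<in> cayley_graph P Z"
    unfolding PZ.cayley_graph_eq using reduced_Nil by (intro PZ.vx_in) (simp add: P_simps(1))
  have "real_tree (asymptotic_cone (cayley_graph P Z) (cayley_dist P Z) \<omega> (\<lambda>_. PZ.vx []) l)
      (cone_dist (cayley_graph P Z) (cayley_dist P Z) \<omega> (\<lambda>_. PZ.vx []) l)"
    unfolding PZ.cayley_graph_eq PZ.cayley_dist_eq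
    by (rule free_product_cone_real_tree[OF cayley_coneI[OF P.is_group Z_generating \<omega> l(1) e] l(2,3)])
  then show ?thesis by (rule lacunary_hyperbolicI[OF Z_generating \<omega> l(1) e])
qed

theorem theorem1p3:
  fixes G :: "('a, 'c) monoid_scheme" and H :: "('b, 'd) monoid_scheme"
  assumes "group G" and "group H"
  shows "lacunary_hyperbolic (free_product G H) \<longleftrightarrow> synchronized_LH G H"
proof -
  interpret two_groups G H using assms by (simp add: two_groups_def)
  show ?thesis using lacunary_hyperbolic_imp_synchronized synchronized_imp_lacunary_hyperbolic by blast
qed

end
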